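(* For each $d \ge 1$ and $c > 0$, the variational problem \[ \text{maximise} \quad J_c[f_1,f_2] - I[f_1] - I[f_2] \quad \text{over} \quad f_1, f_2 \in C(\mathbb{R}^d) \] has a finite solution (i.e. maximal value) $V_G^d(c)$ that is attained for a pair $f_1, f_2 \in C(\mathbb{R}^d)$. The function $c \mapsto V_G^d(c)$ is continuous, strictly decreasing, convex, and satisfies \[ \lim_{c \to 0} V_G^d(c) = \log 2 - 1 \quad \text{and} \quad V_G^d(c) = -d \log c + O(1) \quad \text{as } c \to \infty. \] Moreover, the function $c \mapsto V_G^1(c)$ is smooth, satisfies \[ V_G^1(c) = \log 2 - 1 - c/3 + O(c^2) \quad \text{as } c \to 0, \] and has the representation \[ V_G^1(c) = \log 2 - h_c(0)^2 + \int_0^c \left[ \frac{2}{c} \log h_c(s) - \frac{1}{2} \left( h_c(s) + \dot{h}_c(s) \right)^2 \right] ds, \] where $h_c$ is the positive analytic function on $[0,c]$ that is the unique solution to the boundary value ODE on $[0,c]$ \[ \ddot{y} = -\frac{2}{c y} + y, \qquad \dot{y}(0) = y(0) = y(c) = -\dot{y}(c). \]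
   Context: Let $|\cdot|$ be the Euclidean norm on $\mathbb{R}^d$ and $C(\mathbb{R}^d)$ the space of continuous functions $\mathbb{R}^d \to \mathbb{R}$. Let $\mathcal{H} \subset C(\mathbb{R}^d)$ be the reproducing kernel Hilbert space of the kernel $\kappa(s,t) = e^{-|s-t|}$ on $\mathbb{R}^d$, i.e. the completion of the space of finite linear combinations $\sum_i a_i \kappa(s_i,\cdot)$ ($a_i \in \mathbb{R}$, $s_i \in \mathbb{R}^d$) under the inner product $\langle \sum_i a_i \kappa(s_i,\cdot), \sum_j a'_j \kappa(s'_j,\cdot)\rangle_{\mathcal{H}} = \sum_{i,j} a_i a'_j \kappa(s_i,s'_j)$; its norm is $\|\cdot\|_{\mathcal{H}}$. For $f \in C(\mathbb{R}^d)$ define $I[f] = \frac12 \|f\|_{\mathcal{H}}^2$ if $f \in \mathcal{H}$ and $I[f] = \infty$ otherwise. For $c > 0$ and $f_1,f_2 \in C(\mathbb{R}^d)$ define \[ J_c[f_1,f_2] = c^{-d} \int_{[0,c]^d} \log\left( f_1(s)^2 + f_2(s)^2 \right) ds, \] with $\log 0 = -\infty$. Dots denote derivatives in the variable $s \in [0,c]$. *)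

theory Defs
  imports
    "HOL-Analysis.Analysis"
    "HOL-Library.Poly_Mapping"
    "HOL-Library.Landau_Symbols"
begin

definition kappa :: "'a::euclidean_space \<Rightarrow> 'a \<Rightarrow> real" where
  "kappa s t = exp (- norm (s - t))"

text \<open>
  A finite linear combination of the functions \<open>kappa s\<close> is given by its finitely supported
  coefficient function \<open>a\<close>; \<open>kspan a\<close> is the function it represents.
\<close>

definition kspan :: "('a::euclidean_space \<Rightarrow>\<^sub>0 real) \<Rightarrow> 'a \<Rightarrow> real" where
  "kspan a t = (\<Sum>s\<in>Poly_Mapping.keys a. Poly_Mapping.lookup a s * kappa s t)"

definition kinner :: "('a::euclidean_space \<Rightarrow>\<^sub>0 real) \<Rightarrow> ('a \<Rightarrow>\<^sub>0 real) \<Rightarrow> real" where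
  "kinner a b = (\<Sum>s\<in>Poly_Mapping.keys a. \<Sum>t\<in>Poly_Mapping.keys b.
     Poly_Mapping.lookup a s * Poly_Mapping.lookup b t * kappa s t)"

definition knorm :: "('a::euclidean_space \<Rightarrow>\<^sub>0 real) \<Rightarrow> real" where
  "knorm a = sqrt (kinner a a)"

text \<open>
  The completion is realised as a space of functions in the usual way: convergence in norm implies
  pointwise convergence, so the class of a Cauchy sequence is identified with its pointwise limit,
  and the norm of that limit is the limit of the norms. Two Cauchy sequences with the same
  pointwise limit are equivalent, so the norm does not depend on the sequence.
\<close>

definition kapprox :: "(nat \<Rightarrow> 'a::euclidean_space \<Rightarrow>\<^sub>0 real) \<Rightarrow> ('a \<Rightarrow> real) \<Rightarrow> bool" where
  "kapprox A f \<longleftrightarrow>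
     (\<forall>e>0. \<exists>M. \<forall>m\<ge>M. \<forall>n\<ge>M. knorm (A m - A n) < e) \<and>
     (\<forall>t. (\<lambda>n. kspan (A n) t) \<longlonglongrightarrow> f t)"

definition rkhs :: "('a::euclidean_space \<Rightarrow> real) set" where
  "rkhs = {f. \<exists>A. kapprox A f}"

definition rkhs_norm :: "('a::euclidean_space \<Rightarrow> real) \<Rightarrow> real" where
  "rkhs_norm f = (THE r. \<exists>A. kapprox A f \<and> (\<lambda>n. knorm (A n)) \<longlonglongrightarrow> r)"

definition I_fun :: "('a::euclidean_space \<Rightarrow> real) \<Rightarrow> ereal" where
  "I_fun f = (if f \<in> rkhs then ereal (1/2 * (rkhs_norm f)\<^sup>2) else \<infinity>)"

text \<open>The extended logarithm is only applied to nonnegative arguments.\<close>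

definition elog :: "real \<Rightarrow> ereal" where
  "elog x = (if x = 0 then -\<infinity> else ereal (ln x))"

text \<open>
  The integral is the extended-real Lebesgue integral, positive part minus negative part
  (\<^const>\<open>e2ennreal\<close> sends negative values to \<open>0\<close>). For continuous arguments the positive
  part is finite, so \<open>J_fun c f1 f2\<close> lies in \<open>[-\<infinity>, \<infinity>)\<close>; together with
  \<open>0 \<le> I_fun\<close> this means that no expression \<open>\<infinity> - \<infinity>\<close> arises in the objective.
  The set \<open>cbox 0 (c *\<^sub>R One)\<close> is the cube of all \<open>s\<close> with coordinates in \<open>[0, c]\<close>.
\<close>

definition J_fun :: "real \<Rightarrow> ('a::euclidean_space \<Rightarrow> real) \<Rightarrow> ('a \<Rightarrow> real) \<Rightarrow> ereal" where
  "J_fun c f1 f2 = ereal (inverse (c ^ DIM('a))) *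
     (enn2ereal (\<integral>\<^sup>+ s \<in> cbox 0 (c *\<^sub>R One). e2ennreal (elog ((f1 s)\<^sup>2 + (f2 s)\<^sup>2)) \<partial>lborel)
    - enn2ereal (\<integral>\<^sup>+ s \<in> cbox 0 (c *\<^sub>R One). e2ennreal (- elog ((f1 s)\<^sup>2 + (f2 s)\<^sup>2)) \<partial>lborel))"

definition objective :: "real \<Rightarrow> ('a::euclidean_space \<Rightarrow> real) \<Rightarrow> ('a \<Rightarrow> real) \<Rightarrow> ereal" where
  "objective c f1 f2 = J_fun c f1 f2 - I_fun f1 - I_fun f2"

text \<open>
  The dimension is that of the type \<^typ>\<open>'a\<close>; the one-dimensional case is \<open>V_G TYPE(real)\<close>.
\<close>

definition V_G_ereal :: "'a::euclidean_space itself \<Rightarrow> real \<Rightarrow> ereal" where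
  "V_G_ereal _ c =
     (SUP (f1, f2) \<in> {(f1 :: 'a \<Rightarrow> real, f2 :: 'a \<Rightarrow> real).
        continuous_on UNIV f1 \<and> continuous_on UNIV f2}. objective c f1 f2)"

definition V_G :: "'a::euclidean_space itself \<Rightarrow> real \<Rightarrow> real" where
  "V_G T c = real_of_ereal (V_G_ereal T c)"

definition smooth_on :: "real set \<Rightarrow> (real \<Rightarrow> real) \<Rightarrow> bool" where
  "smooth_on U f \<longleftrightarrow> open U \<and> (\<forall>k. ((deriv ^^ k) f) differentiable_on U)"

text \<open>
  At an end point of a closed interval the power series represents the function on the inner side
  only, which amounts to an analytic extension to a neighbourhood of the interval.
\<close>

definition real_analytic_on :: "real set \<Rightarrow> (real \<Rightarrow> real) \<Rightarrow> bool" where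
  "real_analytic_on S f \<longleftrightarrow>
     (\<forall>x\<in>S. \<exists>a r. r > 0 \<and> (\<forall>y\<in>S. \<bar>y - x\<bar> < r \<longrightarrow> (\<lambda>n. a n * (y - x) ^ n) sums f y))"

text \<open>
  \<open>y\<close> is a positive solution, with derivative \<open>y'\<close>, of the boundary value problem on \<open>[0, c]\<close>.
  Positivity is part of the notion because \<open>- y\<close> solves the problem whenever \<open>y\<close> does, so that
  uniqueness only holds among positive solutions.
\<close>

definition positive_bvp_solution :: "real \<Rightarrow> (real \<Rightarrow> real) \<Rightarrow> (real \<Rightarrow> real) \<Rightarrow> bool" where
  "positive_bvp_solution c y y' \<longleftrightarrow>
     (\<forall>s\<in>{0..c}. y s > 0 \<and>
        (y has_real_derivative y' s) (at s within {0..c}) \<and>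
        (y' has_real_derivative (- 2 / (c * y s) + y s)) (at s within {0..c})) \<and>
     y' 0 = y 0 \<and> y 0 = y c \<and> y c = - y' c"

end

theory Submission
  imports Defs "HOL-Probability.Probability_Measure" "HOL-Real_Asymp.Real_Asymp"
begin

text \<open>
  After rescaling to the unit cube \<open>Q\<close>, let \<open>K\<close> be the integral operator with kernel
  \<open>exp (- c \<bar>s - t\<bar>)\<close>. The problem is dual to the minimisation of \<open>\<langle>u, K u\<rangle> - 2 \<integral> ln u\<close> over \<open>u > 0\<close>:
  from \<open>ln x \<le> x - 1\<close> one gets \<open>ln \<bar>f\<bar>\<^sup>2 \<le> sqrt 2 u \<bar>f\<bar> - 2 + ln 2 - 2 ln u\<close>, and
  \<open>sqrt 2 \<integral> u \<bar>f\<bar> - \<parallel>f\<parallel>\<^sup>2 / 2 \<le> \<langle>u, K u\<rangle>\<close> because the kernel is nonnegative. Equality holds when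
  \<open>u \<cdot> K u = 1\<close> and \<open>f = sqrt 2 K u\<close>; this Schroedinger equation is solved uniquely by the projective
  contraction \<open>u \<mapsto> 1 / K u\<close>. Hence \<open>V = ln 2 - 1 - 2 \<integral> ln u\<close>.

  The density \<open>u(s) u(t) exp (- c \<bar>s - t\<bar>)\<close> is a coupling of the uniform distribution with itself,
  and \<open>1 + x \<le> exp x\<close> shows that its mean distance is minus the slope of a supporting line of \<open>V\<close> at
  \<open>c\<close>. This gives convexity, monotonicity and the behaviour at \<open>0\<close> (where \<open>u = 1\<close>). Trial functions
  \<open>u\<close> give the upper bounds, and \<open>(K u)\<^sup>2 \<ge> \<integral> exp (- 2 c \<bar>s - t\<bar>) dt\<close> the lower bound at infinity.

  For \<open>d = 1\<close> the function \<open>h(s) = K u (s / c)\<close> solves the boundary value problem, and conversely every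
  positive solution arises in this way, since the kernel is a Green function. Analyticity follows from
  geometric bounds on the Taylor coefficients of a polynomial system. For smoothness in \<open>c\<close>, the first
  integral of the equation expresses \<open>c\<close> and \<open>V\<close> as explicit smooth functions of \<open>g = c h(0)\<^sup>2 / 4\<close> with
  \<open>dc / dg > 0\<close>.
\<close>

section \<open>Positive semidefiniteness of the kernel\<close>

text \<open>Nothing can be said about \<open>rkhs_norm\<close> before Cauchy-Schwarz is available
  for \<open>kinner\<close>: the \<open>THE\<close> in its definition is meaningful only if equal
  pointwise limits force equal limits of norms. This is why semidefiniteness is needed, and it is
  obtained by writing exp (- |x|) as a mixture of Gaussians over all scales, which works in every
  dimension at once. The logarithm of f1^2 + f2^2 is not concave in (f1, f2). It becomes tractable
  through its tangents in |f|, and the dual variable u records the point of tangency. Supporting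
  lines yield convexity but no smoothness in c. In dimension one an explicit description of the
  trajectory is needed, and h cannot serve as its parameter because h' has a zero inside the
  interval. The logarithmic derivative w = h' / h runs from 1 to - 1 for every c, so the domain of
  integration no longer depends on c. The price is an inversion of p exp (- 2 p), whose branch point
  p = 1 / 2 the trajectory must be shown to avoid.\<close>

lemma sum_inner_power_nonneg:
  fixes S :: "'a::euclidean_space set" and a :: "'a \<Rightarrow> real"
  shows "0 \<le> (\<Sum>s\<in>S. \<Sum>t\<in>S. a s * a t * (s \<bullet> t) ^ n)"
proof (induction n arbitrary: a)
  case 0
  have "(\<Sum>s\<in>S. \<Sum>t\<in>S. a s * a t * (s \<bullet> t) ^ 0) = (\<Sum>s\<in>S. a s)\<^sup>2"
    by (simp add: power2_eq_square sum_product)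
  then show ?case by simp
next
  case (Suc n)
  \<comment> \<open>One factor s \<bullet> t is expanded in the orthonormal basis and its
    coordinates are absorbed into the weights; this is why the induction runs over all
    \<open>a\<close>.\<close>
  have "(\<Sum>s\<in>S. \<Sum>t\<in>S. a s * a t * (s \<bullet> t) ^ Suc n) =
    (\<Sum>s\<in>S. \<Sum>t\<in>S. \<Sum>b\<in>Basis. (a s * (s \<bullet> b)) * (a t * (t \<bullet> b)) * (s \<bullet> t) ^ n)"
  proof (intro sum.cong refl)
    fix s t
    have "(\<Sum>b\<in>Basis. (a s * (s \<bullet> b)) * (a t * (t \<bullet> b)) * (s \<bullet> t) ^ n) =
       a s * a t * (s \<bullet> t) ^ n * (\<Sum>b\<in>Basis. (s \<bullet> b) * (t \<bullet> b))"
      by (simp add: sum_distrib_left mult_ac)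
    then show "a s * a t * (s \<bullet> t) ^ Suc n = (\<Sum>b\<in>Basis. (a s * (s \<bullet> b)) * (a t * (t \<bullet> b)) * (s \<bullet> t) ^ n)"
      by (simp add: euclidean_inner[of s t, symmetric])
  qed
  also have "\<dots> = (\<Sum>b\<in>Basis. \<Sum>s\<in>S. \<Sum>t\<in>S. (a s * (s \<bullet> b)) * (a t * (t \<bullet> b)) * (s \<bullet> t) ^ n)"
    by (subst (2) sum.swap) (simp add: sum.swap[of _ _ "Basis"])
  also have "\<dots> \<ge> 0"
    by (intro sum_nonneg[of Basis] Suc)
  finally show ?case .
qed

text \<open>The Gaussian is exp (- \<tau> |s|^2) exp (- \<tau> |t|^2) exp (2 \<tau> s \<bullet> t).
  The first two factors only rescale the weights, and the power series of the third has nonnegative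
  coefficients in front of the power kernels.\<close>

lemma gaussian_kernel_nonneg:
  fixes S :: "'a::euclidean_space set" and a :: "'a \<Rightarrow> real"
  assumes "finite S" "0 \<le> \<tau>"
  shows "0 \<le> (\<Sum>s\<in>S. \<Sum>t\<in>S. a s * a t * exp (- \<tau> * (norm (s - t))\<^sup>2))"
proof -
  define b where "b s = a s * exp (- \<tau> * (norm s)\<^sup>2)" for s
  have eq: "a s * a t * exp (- \<tau> * (norm (s - t))\<^sup>2) = b s * b t * exp (2 * \<tau> * (s \<bullet> t))" for s t
  proof -
    have "- \<tau> * (norm (s - t))\<^sup>2 = - \<tau> * (norm s)\<^sup>2 + (- \<tau> * (norm t)\<^sup>2) + 2 * \<tau> * (s \<bullet> t)"
      by (simp add: power2_norm_eq_inner inner_diff_left inner_diff_right inner_commute algebra_simps)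
    then show ?thesis unfolding b_def by (simp only: exp_add mult_ac)
  qed
  have "(\<lambda>n. b s * b t * ((2 * \<tau> * (s \<bullet> t)) ^ n /\<^sub>R fact n)) sums (b s * b t * exp (2 * \<tau> * (s \<bullet> t)))" for s t
    by (intro sums_mult exp_converges)
  then have sm: "(\<lambda>n. \<Sum>s\<in>S. \<Sum>t\<in>S. b s * b t * ((2 * \<tau> * (s \<bullet> t)) ^ n /\<^sub>R fact n)) sums
      (\<Sum>s\<in>S. \<Sum>t\<in>S. b s * b t * exp (2 * \<tau> * (s \<bullet> t)))"
    by (intro sums_sum)
  have "0 \<le> (\<Sum>s\<in>S. \<Sum>t\<in>S. b s * b t * ((2 * \<tau> * (s \<bullet> t)) ^ n /\<^sub>R fact n))" for n
  proof -
    have "(\<Sum>s\<in>S. \<Sum>t\<in>S. b s * b t * ((2 * \<tau> * (s \<bullet> t)) ^ n /\<^sub>R fact n)) =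
       (2 * \<tau>) ^ n / fact n * (\<Sum>s\<in>S. \<Sum>t\<in>S. b s * b t * (s \<bullet> t) ^ n)"
      by (simp add: sum_distrib_left power_mult_distrib divide_inverse mult_ac)
    also have "\<dots> \<ge> 0" using assms sum_inner_power_nonneg[of b n S] by simp
    finally show ?thesis .
  qed
  then show ?thesis unfolding eq by (rule sums_le[OF _ sums_zero sm])
qed

text \<open>The antiderivative \<open>H\<close> in the proof is the one behind the Cauchy-Schloemilch substitution.\<close>

lemma exp_gaussian_mixture:
  obtains A :: real where "A > 0"
    "\<And>b. b \<ge> 0 \<Longrightarrow>
      (\<lambda>n. integral {1 / real (Suc n)..real (Suc n)} (\<lambda>w. exp (- w\<^sup>2 - b\<^sup>2 / w\<^sup>2))) \<longlonglongrightarrow> A * exp (- 2 * b)"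
proof -
  have "\<exists>F. \<forall>x. - \<infinity> < ereal x \<longrightarrow> ereal x < \<infinity> \<longrightarrow> (F has_vector_derivative exp (- x\<^sup>2)) (at x)"
    by (rule einterval_antiderivative) (auto intro!: continuous_intros)
  then obtain F where F: "\<And>x. (F has_real_derivative exp (- x\<^sup>2)) (at x)"
    by (auto simp: has_real_derivative_iff_has_vector_derivative)
  define G where "G x = F x - F 0" for x
  have G: "(G has_real_derivative exp (- x\<^sup>2) * D) (at x within S)" if "D = 1" for x D S
    unfolding G_def using that by (auto intro!: derivative_eq_intros has_field_derivative_at_within[OF F])
  have G': "((\<lambda>x. G (f x)) has_real_derivative exp (- (f x)\<^sup>2) * D) (at x within S)"
    if "(f has_real_derivative D) (at x within S)" for f x D S
    using DERIV_chain2[OF _ that, of G "exp (- (f x)\<^sup>2)"] G[of 1] by simp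
  have G0: "G 0 = 0" by (simp add: G_def)
  have Gmono: "G x \<le> G y" if "x \<le> y" for x y
    by (rule DERIV_nonneg_imp_nondecreasing[OF that]) (use G[of 1 _ UNIV] in force)
  have Godd: "G (- x) = - G x" for x
  proof -
    have "((\<lambda>x. G x + G (- x)) has_real_derivative 0) (at y)" for y
      by (auto intro!: derivative_eq_intros G')
    then have "G x + G (- x) = G 0 + G (- 0)"
      using DERIV_isconst_all[of "\<lambda>x. G x + G (- x)" x 0] by blast
    then show ?thesis using G0 by simp
  qed
  \<comment> \<open>Comparison with \<open>arctan\<close> keeps \<open>G\<close> bounded, so the
    supremum \<open>A\<close> is finite.\<close>
  have Gbd: "G x \<le> pi / 2" if "0 \<le> x" for x
  proof -
    have "exp (- y\<^sup>2) \<le> 1 / (1 + y\<^sup>2)" for y :: real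
    proof -
      have "1 + y\<^sup>2 \<le> exp (y\<^sup>2)" by (rule exp_ge_add_one_self)
      then show ?thesis by (simp add: exp_minus field_simps add_pos_nonneg)
    qed
    then have "arctan 0 - G 0 \<le> arctan x - G x"
      by (intro DERIV_nonneg_imp_nondecreasing[OF that])
         (auto intro!: exI derivative_eq_intros G' simp: divide_inverse)
    then show ?thesis using G0 arctan_ubound[of x] by simp
  qed
  define A where "A = (SUP n. G (real n))"
  have bdd: "bdd_above (range (\<lambda>n. G (real n)))" using Gbd by (intro bdd_aboveI[of _ "pi / 2"]) auto
  have GA: "G x \<le> A" for x
    unfolding A_def using Gmono[of x "real (nat \<lceil>x\<rceil>)"] cSUP_upper[OF _ bdd, of "nat \<lceil>x\<rceil>"]
    by (meson UNIV_I order_trans real_nat_ceiling_ge)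
  have Glim: "(G \<longlongrightarrow> A) at_top"
  proof (rule increasing_tendsto)
    show "\<forall>\<^sub>F x in at_top. G x \<le> A" using GA by simp
  next
    fix e assume "e < A"
    then obtain n where n: "e < G (real n)"
      unfolding A_def using less_cSUP_iff[OF _ bdd, of e] by auto
    show "\<forall>\<^sub>F x in at_top. e < G x"
      by (rule eventually_at_top_linorderI[of "real n"]) (rule less_le_trans[OF n Gmono])
  qed
  have "G 0 < G 1" by (rule DERIV_pos_imp_increasing[of 0 1]) (use G[of 1 _ UNIV] in force)+
  then have "A > 0" using G0 GA[of 1] by simp
  moreover have "(\<lambda>n. integral {1 / real (Suc n)..real (Suc n)} (\<lambda>w. exp (- w\<^sup>2 - b\<^sup>2 / w\<^sup>2)))
      \<longlonglongrightarrow> A * exp (- 2 * b)" if "b \<ge> 0" for b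
  proof -
    define H where "H w = (exp (2 * b) * G (w + b / w) + exp (- 2 * b) * G (w - b / w)) / 2" for w
    have HD: "(H has_real_derivative exp (- w\<^sup>2 - b\<^sup>2 / w\<^sup>2)) (at w within S)" if "w > 0" for w S
    proof -
      have e: "(w + b / w)\<^sup>2 = w\<^sup>2 + b\<^sup>2 / w\<^sup>2 + 2 * b" "(w - b / w)\<^sup>2 = w\<^sup>2 + b\<^sup>2 / w\<^sup>2 - 2 * b"
        using that by (auto simp: power2_eq_square field_simps)
      define E where "E = exp (- w\<^sup>2 - b\<^sup>2 / w\<^sup>2)"
      have e1: "exp (2 * b) * exp (- (w + b / w)\<^sup>2) = E" unfolding e E_def by (simp add: exp_add[symmetric])
      have e2: "exp (- 2 * b) * exp (- (w - b / w)\<^sup>2) = E" unfolding e E_def by (simp add: exp_add[symmetric])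
      have "(H has_real_derivative (exp (2 * b) * (exp (- (w + b / w)\<^sup>2) * (1 - b / w\<^sup>2)) +
           exp (- 2 * b) * (exp (- (w - b / w)\<^sup>2) * (1 + b / w\<^sup>2))) / 2) (at w within S)"
      proof -
        have d: "((\<lambda>w. w + b / w) has_real_derivative 1 - b / w\<^sup>2) (at w within S)"
          "((\<lambda>w. w - b / w) has_real_derivative 1 + b / w\<^sup>2) (at w within S)"
          using that by (auto intro!: derivative_eq_intros simp: power2_eq_square)
        show ?thesis unfolding H_def by (intro DERIV_cdivide DERIV_add DERIV_cmult G' d)
      qed
      also have "(exp (2 * b) * (exp (- (w + b / w)\<^sup>2) * (1 - b / w\<^sup>2)) +
           exp (- 2 * b) * (exp (- (w - b / w)\<^sup>2) * (1 + b / w\<^sup>2))) / 2 = E"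
        unfolding mult.assoc[symmetric] e1 e2 by (simp add: algebra_simps)
      finally show ?thesis unfolding E_def .
    qed
    have "((\<lambda>w. exp (- w\<^sup>2 - b\<^sup>2 / w\<^sup>2)) has_integral (H (real (Suc n)) - H (1 / real (Suc n))))
       {1 / real (Suc n)..real (Suc n)}" for n
    proof (rule fundamental_theorem_of_calculus)
      show "1 / real (Suc n) \<le> real (Suc n)" by (rule order_trans[of _ 1]) (simp_all add: field_simps)
      show "(H has_vector_derivative exp (- x\<^sup>2 - b\<^sup>2 / x\<^sup>2)) (at x within {1 / real (Suc n)..real (Suc n)})"
        if "x \<in> {1 / real (Suc n)..real (Suc n)}" for x
      proof -
        have "0 < 1 / real (Suc n)" by simp
        then have "x > 0" using that by (meson atLeastAtMost_iff less_le_trans)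
        then show ?thesis using HD by (simp add: has_real_derivative_iff_has_vector_derivative)
      qed
    qed
    then have I: "integral {1 / real (Suc n)..real (Suc n)} (\<lambda>w. exp (- w\<^sup>2 - b\<^sup>2 / w\<^sup>2)) =
       H (real (Suc n)) - H (1 / real (Suc n))" for n by (rule integral_unique)
    have R: "filterlim (\<lambda>n. real (Suc n)) at_top sequentially"
      by (rule filterlim_compose[OF filterlim_real_sequentially filterlim_Suc])
    have Z: "(\<lambda>n. 1 / real (Suc n)) \<longlonglongrightarrow> 0" using LIMSEQ_inverse_real_of_nat by (simp add: inverse_eq_divide)
    \<comment> \<open>As w decreases to 0, w - b / w tends to - \<infinity> if b > 0 but to 0 if b =
      0, so the limit of \<open>H\<close> at 0 jumps. For b > 0 the boundary terms leave ((e^(2b) +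
      e^(-2b)) - (e^(2b) - e^(-2b))) A / 2 = A e^(-2b).\<close>
    show ?thesis
    proof (cases "b = 0")
      case True
      have "isCont G 0" using G[of 1 0 UNIV] DERIV_isCont by blast
      then have "(\<lambda>n. G (1 / real (Suc n))) \<longlonglongrightarrow> G 0"
        using Z by (rule isCont_tendsto_compose)
      moreover have "(\<lambda>n. G (real (Suc n))) \<longlonglongrightarrow> A" by (rule filterlim_compose[OF Glim R])
      ultimately have "(\<lambda>n. G (real (Suc n)) - G (1 / real (Suc n))) \<longlonglongrightarrow> A - G 0" by (intro tendsto_diff)
      then show ?thesis unfolding I H_def using True G0 by simp
    next
      case False
      then have b: "b > 0" using that by simp
      have Hinf: "(\<lambda>n. H (real (Suc n))) \<longlonglongrightarrow> (exp (2 * b) * A + exp (- 2 * b) * A) / 2"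
      proof -
        have "(\<lambda>n. b / real (Suc n)) \<longlonglongrightarrow> 0" using tendsto_mult_right_zero[OF Z, of b] by simp
        note Zb = this
        have l: "filterlim (\<lambda>n. b / real (Suc n) + real (Suc n)) at_top sequentially"
           "filterlim (\<lambda>n. - (b / real (Suc n)) + real (Suc n)) at_top sequentially"
          using filterlim_tendsto_add_at_top[OF Zb R] filterlim_tendsto_add_at_top[OF tendsto_minus[OF Zb] R] by simp_all
        have e: "real (Suc n) + b / real (Suc n) = b / real (Suc n) + real (Suc n)"
          "real (Suc n) - b / real (Suc n) = - (b / real (Suc n)) + real (Suc n)" for n by simp_all
        show ?thesis unfolding H_def e
          by (rule tendsto_divide[OF tendsto_add[OF tendsto_mult[OF tendsto_const filterlim_compose[OF Glim l(1)]]
              tendsto_mult[OF tendsto_const filterlim_compose[OF Glim l(2)]]] tendsto_const]) simp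
      qed
      have Hzero: "(\<lambda>n. H (1 / real (Suc n))) \<longlonglongrightarrow> (exp (2 * b) * A + exp (- 2 * b) * (- A)) / 2"
      proof -
        have R': "filterlim (\<lambda>n. b * real (Suc n)) at_top sequentially"
          by (rule filterlim_tendsto_pos_mult_at_top[OF tendsto_const b R])
        have l: "filterlim (\<lambda>n. 1 / real (Suc n) + b * real (Suc n)) at_top sequentially"
           "filterlim (\<lambda>n. - (1 / real (Suc n)) + b * real (Suc n)) at_top sequentially"
          using filterlim_tendsto_add_at_top[OF Z R'] filterlim_tendsto_add_at_top[OF tendsto_minus[OF Z] R'] by simp_all
        have e: "1 / real (Suc n) + b / (1 / real (Suc n)) = 1 / real (Suc n) + b * real (Suc n)"
            "G (1 / real (Suc n) - b / (1 / real (Suc n))) = - G (- (1 / real (Suc n)) + b * real (Suc n))" for n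
          unfolding Godd[symmetric] by simp_all
        show ?thesis unfolding H_def e
          by (rule tendsto_divide[OF tendsto_add[OF tendsto_mult[OF tendsto_const filterlim_compose[OF Glim l(1)]]
              tendsto_mult[OF tendsto_const tendsto_minus[OF filterlim_compose[OF Glim l(2)]]]] tendsto_const]) simp
      qed
      show ?thesis unfolding I using tendsto_diff[OF Hinf Hzero] by (simp add: field_simps)
    qed
  qed
  ultimately show thesis by (rule that)
qed

text \<open>With b = norm (s - t) / 2 the mixture tends to A * kappa s t, and at each w its
  integrand is, up to the factor exp (- w^2), the Gaussian kernel with \<tau> = 1 / (4 w^2). The
  truncated integrals inherit nonnegativity and the limit keeps it.\<close>

lemma exp_kernel_nonneg:
  fixes S :: "'a::euclidean_space set" and a :: "'a \<Rightarrow> real"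
  assumes "finite S"
  shows "0 \<le> (\<Sum>s\<in>S. \<Sum>t\<in>S. a s * a t * kappa s t)"
proof -
  obtain A :: real where A: "A > 0"
    "\<And>b. b \<ge> 0 \<Longrightarrow>
      (\<lambda>n. integral {1 / real (Suc n)..real (Suc n)} (\<lambda>w. exp (- w\<^sup>2 - b\<^sup>2 / w\<^sup>2))) \<longlonglongrightarrow> A * exp (- 2 * b)"
    using exp_gaussian_mixture by blast
  define J where "J b n = integral {1 / real (Suc n)..real (Suc n)} (\<lambda>w. exp (- w\<^sup>2 - b\<^sup>2 / w\<^sup>2))" for b n
  have "(\<lambda>n. \<Sum>s\<in>S. \<Sum>t\<in>S. a s * a t * J (norm (s - t) / 2) n) \<longlonglongrightarrow>
     (\<Sum>s\<in>S. \<Sum>t\<in>S. a s * a t * (A * exp (- 2 * (norm (s - t) / 2))))"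
    unfolding J_def by (intro tendsto_intros A) auto
  moreover have "0 \<le> (\<Sum>s\<in>S. \<Sum>t\<in>S. a s * a t * J (norm (s - t) / 2) n)" for n
  proof -
    have int: "(\<lambda>w. exp (- w\<^sup>2 - b\<^sup>2 / w\<^sup>2)) integrable_on {1 / real (Suc n)..real (Suc n)}" for b :: real
    proof -
      have "0 < 1 / real (Suc n)" by simp
      then show ?thesis
        by (intro integrable_continuous_interval continuous_intros) (auto simp del: of_nat_Suc)
    qed
    have "((\<lambda>w. \<Sum>s\<in>S. \<Sum>t\<in>S. a s * a t * exp (- w\<^sup>2 - (norm (s - t) / 2)\<^sup>2 / w\<^sup>2)) has_integral
       (\<Sum>s\<in>S. \<Sum>t\<in>S. a s * a t * J (norm (s - t) / 2) n)) {1 / real (Suc n)..real (Suc n)}"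
      unfolding J_def by (intro has_integral_sum assms has_integral_mult_right integrable_integral int)
    then show ?thesis
    proof (rule has_integral_nonneg)
      fix w
      have "(\<Sum>s\<in>S. \<Sum>t\<in>S. a s * a t * exp (- w\<^sup>2 - (norm (s - t) / 2)\<^sup>2 / w\<^sup>2)) =
        exp (- w\<^sup>2) * (\<Sum>s\<in>S. \<Sum>t\<in>S. a s * a t * exp (- (1 / (4 * w\<^sup>2)) * (norm (s - t))\<^sup>2))"
        unfolding sum_distrib_left
      proof (intro sum.cong refl)
        fix s t :: 'a
        have "- w\<^sup>2 - (norm (s - t) / 2)\<^sup>2 / w\<^sup>2 = - w\<^sup>2 + (- (1 / (4 * w\<^sup>2)) * (norm (s - t))\<^sup>2)"
          by (simp add: power_divide)
        then show "a s * a t * exp (- w\<^sup>2 - (norm (s - t) / 2)\<^sup>2 / w\<^sup>2) =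
            exp (- w\<^sup>2) * (a s * a t * exp (- (1 / (4 * w\<^sup>2)) * (norm (s - t))\<^sup>2))"
          by (simp only: exp_add mult_ac)
      qed
      also have "\<dots> \<ge> 0" by (intro mult_nonneg_nonneg gaussian_kernel_nonneg assms) auto
      finally show "0 \<le> (\<Sum>s\<in>S. \<Sum>t\<in>S. a s * a t * exp (- w\<^sup>2 - (norm (s - t) / 2)\<^sup>2 / w\<^sup>2))" .
    qed
  qed
  ultimately have "0 \<le> (\<Sum>s\<in>S. \<Sum>t\<in>S. a s * a t * (A * exp (- 2 * (norm (s - t) / 2))))"
    by (meson LIMSEQ_le_const)
  also have "\<dots> = A * (\<Sum>s\<in>S. \<Sum>t\<in>S. a s * a t * kappa s t)"
    by (simp add: kappa_def sum_distrib_left mult_ac)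
  finally show ?thesis using A(1) by (simp add: zero_le_mult_iff)
qed

section \<open>The reproducing kernel Hilbert space\<close>

lemma kspan_superset:
  assumes "finite S" "Poly_Mapping.keys a \<subseteq> S"
  shows "kspan a t = (\<Sum>s\<in>S. Poly_Mapping.lookup a s * kappa s t)"
  unfolding kspan_def by (rule sum.mono_neutral_left) (use assms in \<open>auto simp: in_keys_iff\<close>)

lemma kappa_commute: "kappa s t = kappa t s"
  by (simp add: kappa_def norm_minus_commute)

lemma kappa_le_1: "kappa s t \<le> 1"
  by (simp add: kappa_def)

lemma kappa_nonneg: "0 \<le> kappa s t"
  by (simp add: kappa_def)

text \<open>The constant 1 is uniform in s, so potentials of bounded charges inherit a Lipschitz
  constant, which later controls discretisation errors.\<close>

lemma kappa_lipschitz: "\<bar>kappa s x - kappa s y\<bar> \<le> norm (x - y)"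
proof -
  have *: "kappa s x - kappa s y \<le> norm (x - y)" for x y
  proof (cases "norm (s - x) \<le> norm (s - y)")
    case True
    define r where "r = norm (s - y) - norm (s - x)"
    have "r \<le> norm ((s - y) - (s - x))" unfolding r_def by (rule norm_triangle_ineq2)
    then have r: "0 \<le> r" "r \<le> norm (x - y)" using True by (simp_all add: r_def)
    have "kappa s x - kappa s y = exp (- norm (s - x)) * (1 - exp (- r))"
      unfolding kappa_def r_def by (simp add: algebra_simps exp_add[symmetric])
    also have "\<dots> \<le> 1 * r"
    proof (rule mult_mono)
      show "1 - exp (- r) \<le> r" using exp_ge_add_one_self[of "- r"] by simp
    qed (use r in auto)
    finally show ?thesis using r by simp
  next
    case False
    then have "kappa s x \<le> kappa s y" by (simp add: kappa_def)
    then show ?thesis by (smt (verit) norm_ge_zero)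
  qed
  show ?thesis using *[of x y] *[of y x] by (simp add: norm_minus_commute abs_le_iff)
qed

lemma kinner_superset:
  assumes "finite S" "Poly_Mapping.keys a \<subseteq> S" "Poly_Mapping.keys b \<subseteq> S"
  shows "kinner a b = (\<Sum>s\<in>S. \<Sum>t\<in>S. Poly_Mapping.lookup a s * Poly_Mapping.lookup b t * kappa s t)"
proof -
  have "kinner a b = (\<Sum>s\<in>Poly_Mapping.keys a. \<Sum>t\<in>S. Poly_Mapping.lookup a s * Poly_Mapping.lookup b t * kappa s t)"
    unfolding kinner_def
    by (intro sum.cong refl sum.mono_neutral_left) (use assms in \<open>auto simp: in_keys_iff\<close>)
  also have "\<dots> = (\<Sum>s\<in>S. \<Sum>t\<in>S. Poly_Mapping.lookup a s * Poly_Mapping.lookup b t * kappa s t)"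
    by (rule sum.mono_neutral_left) (use assms in \<open>auto simp: in_keys_iff\<close>)
  finally show ?thesis .
qed

lemma kinner_kspan: "kinner a b = (\<Sum>t\<in>Poly_Mapping.keys b. Poly_Mapping.lookup b t * kspan a t)"
  unfolding kinner_def kspan_def by (subst sum.swap) (simp add: sum_distrib_left mult_ac)

lemma kinner_commute: "kinner a b = kinner b a"
  unfolding kinner_def by (subst sum.swap) (simp add: mult_ac kappa_commute)

lemma kinner_diff_right: "kinner a (b - c) = kinner a b - kinner a c"
proof -
  define S where "S = Poly_Mapping.keys a \<union> Poly_Mapping.keys b \<union> Poly_Mapping.keys c"
  have S: "finite S" "Poly_Mapping.keys a \<subseteq> S" "Poly_Mapping.keys b \<subseteq> S" "Poly_Mapping.keys c \<subseteq> S"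
    "Poly_Mapping.keys (b - c) \<subseteq> S"
    using keys_diff[of b c] by (auto simp: S_def)
  show ?thesis
    by (simp add: kinner_superset[OF S(1,2)] S lookup_minus algebra_simps sum_subtractf)
qed

lemma kinner_diff_left: "kinner (b - c) a = kinner b a - kinner c a"
  by (metis kinner_commute kinner_diff_right)

lemma kspan_diff: "kspan (b - c) t = kspan b t - kspan c t"
proof -
  define S where "S = Poly_Mapping.keys b \<union> Poly_Mapping.keys c"
  have S: "finite S" "Poly_Mapping.keys b \<subseteq> S" "Poly_Mapping.keys c \<subseteq> S"
    "Poly_Mapping.keys (b - c) \<subseteq> S"
    using keys_diff[of b c] by (auto simp: S_def)
  show ?thesis
    by (simp add: kspan_superset[OF S(1)] S lookup_minus algebra_simps sum_subtractf)
qed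

text \<open>The quadratic form of x a + y b, written out so that no scalar multiples of finitely
  supported functions occur. Special values of x and y give nonnegativity and the Cauchy-Schwarz
  inequality.\<close>

lemma kinner_combination_nonneg:
  "0 \<le> x\<^sup>2 * kinner a a + 2 * x * y * kinner a b + y\<^sup>2 * kinner b b"
proof -
  define S where "S = Poly_Mapping.keys a \<union> Poly_Mapping.keys b"
  have S: "finite S" "Poly_Mapping.keys a \<subseteq> S" "Poly_Mapping.keys b \<subseteq> S" by (auto simp: S_def)
  let ?a = "Poly_Mapping.lookup a" and ?b = "Poly_Mapping.lookup b"
  have "0 \<le> (\<Sum>s\<in>S. \<Sum>t\<in>S. (x * ?a s + y * ?b s) * (x * ?a t + y * ?b t) * kappa s t)"
    by (rule exp_kernel_nonneg[OF S(1)])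
  also have "\<dots> = x\<^sup>2 * kinner a a + x * y * kinner a b + x * y * kinner b a + y\<^sup>2 * kinner b b"
    by (simp add: kinner_superset[OF S(1)] S sum_distrib_left power2_eq_square distrib_left distrib_right
        sum.distrib mult_ac)
  finally show ?thesis by (simp add: kinner_commute[of b a])
qed

lemma kinner_nonneg: "0 \<le> kinner a a"
  using kinner_combination_nonneg[of 1 a 0] by simp

lemma knorm_nonneg: "0 \<le> knorm a"
  by (simp add: knorm_def kinner_nonneg)

lemma knorm_power2: "(knorm a)\<^sup>2 = kinner a a"
  by (simp add: knorm_def kinner_nonneg)

lemma kinner_Cauchy_Schwarz: "\<bar>kinner a b\<bar> \<le> knorm a * knorm b"
proof -
  let ?A = "kinner a a" and ?B = "kinner b b" and ?C = "kinner a b"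
  have "?C\<^sup>2 \<le> ?A * ?B"
  proof (cases "?B = 0")
    case True
    have "?C = 0"
    proof (rule ccontr)
      assume C: "?C \<noteq> 0"
      \<comment> \<open>Semidefiniteness leaves room for null vectors. With ?B = 0 this coefficient
        makes the form equal to ?A - (?A + 1) = - 1.\<close>
      then show False using kinner_combination_nonneg[of 1 a "- (?A + 1) / (2 * ?C)" b] True
        by (simp add: field_simps)
    qed
    then show ?thesis using True by simp
  next
    case False
    then have B: "?B > 0" using kinner_nonneg[of b] by simp
    \<comment> \<open>The coefficients ?B and - ?C are those of the residual of \<open>a\<close>
      after projection onto \<open>b\<close>, cleared of denominators.\<close>
    have "0 \<le> ?B * (?A * ?B - ?C\<^sup>2)"
      using kinner_combination_nonneg[of ?B a "- ?C" b] by (simp add: power2_eq_square algebra_simps)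
    then show ?thesis using B by (simp add: zero_le_mult_iff)
  qed
  then have "sqrt (?C\<^sup>2) \<le> sqrt (?A * ?B)" by (rule real_sqrt_le_mono)
  then show ?thesis by (simp add: knorm_def real_sqrt_mult)
qed

lemma knorm_triangle: "knorm a \<le> knorm b + knorm (a - b)"
proof -
  have "(knorm a)\<^sup>2 = (knorm b)\<^sup>2 + 2 * kinner b (a - b) + (knorm (a - b))\<^sup>2"
    by (simp add: knorm_power2 kinner_diff_left kinner_diff_right kinner_commute[of b a])
  also have "\<dots> \<le> (knorm b + knorm (a - b))\<^sup>2"
    using kinner_Cauchy_Schwarz[of b "a - b"] by (simp add: power2_sum)
  finally show ?thesis using knorm_nonneg[of b] knorm_nonneg[of "a - b"] by (simp add: power2_le_iff_abs_le)
qed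

lemma knorm_minus_commute: "knorm (a - b) = knorm (b - a)"
  by (simp add: knorm_def kinner_diff_left kinner_diff_right)

lemma knorm_diff_le: "\<bar>knorm a - knorm b\<bar> \<le> knorm (a - b)"
  using knorm_triangle[of a b] knorm_triangle[of b a] knorm_minus_commute[of a b] by linarith

text \<open>The reproducing property: pairing with the point mass at t evaluates at t, and this mass
  is a unit vector because kappa t t = 1.\<close>

lemma kspan_le_knorm: "\<bar>kspan a t\<bar> \<le> knorm a"
proof -
  have "kinner a (Poly_Mapping.single t 1) = kspan a t" "knorm (Poly_Mapping.single t (1::real)) = 1"
    by (simp_all add: kinner_kspan knorm_def kspan_def kappa_def)
  then show ?thesis using kinner_Cauchy_Schwarz[of a "Poly_Mapping.single t 1"] by simp
qed

lemma kapprox_knorm_convergent: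
  assumes "kapprox A f"
  shows "convergent (\<lambda>n. knorm (A n))"
proof -
  have "Cauchy (\<lambda>n. knorm (A n))"
  proof (rule metric_CauchyI)
    fix e :: real assume "0 < e"
    then obtain M where M: "\<And>m n. m \<ge> M \<Longrightarrow> n \<ge> M \<Longrightarrow> knorm (A m - A n) < e"
      using assms unfolding kapprox_def by blast
    show "\<exists>M. \<forall>m\<ge>M. \<forall>n\<ge>M. dist (knorm (A m)) (knorm (A n)) < e"
      using M knorm_diff_le by (metis dist_real_def le_less_trans)
  qed
  then show ?thesis by (rule Cauchy_convergent)
qed

text \<open>This makes the norm of the completion well defined. For fixed M,
  \<open>kinner (D n) (D M)\<close> is a finite combination of values of \<open>kspan (D n)\<close>
  and tends to 0. The remainder of the squared norm is at most
  \<open>knorm (D n) * knorm (D n - D M)\<close>, which the Cauchy property makes small.\<close>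

lemma kapprox_zero_knorm:
  assumes D: "kapprox D (\<lambda>t. 0)"
  shows "(\<lambda>n. knorm (D n)) \<longlonglongrightarrow> 0"
proof -
  obtain r where r: "(\<lambda>n. knorm (D n)) \<longlonglongrightarrow> r"
    using kapprox_knorm_convergent[OF D] by (auto simp: convergent_def)
  have r0: "0 \<le> r" using r knorm_nonneg by (meson LIMSEQ_le_const)
  have "r\<^sup>2 \<le> r * e" if e: "0 < e" for e
  proof -
    obtain M where M: "\<And>m n. m \<ge> M \<Longrightarrow> n \<ge> M \<Longrightarrow> knorm (D m - D n) < e"
      using D e unfolding kapprox_def by blast
    have "(\<lambda>n. kinner (D n) (D M)) \<longlonglongrightarrow> (\<Sum>t\<in>Poly_Mapping.keys (D M). Poly_Mapping.lookup (D M) t * 0)"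
      unfolding kinner_kspan using D unfolding kapprox_def by (intro tendsto_intros) auto
    then have "(\<lambda>n. kinner (D n) (D M) + knorm (D n) * e) \<longlonglongrightarrow> 0 + r * e"
      by (intro tendsto_intros r) simp_all
    moreover have "(\<lambda>n. (knorm (D n))\<^sup>2) \<longlonglongrightarrow> r\<^sup>2" by (intro tendsto_intros r)
    moreover have "(knorm (D n))\<^sup>2 \<le> kinner (D n) (D M) + knorm (D n) * e" if "n \<ge> M" for n
    proof -
      have "(knorm (D n))\<^sup>2 = kinner (D n) (D M) + kinner (D n) (D n - D M)"
        by (simp add: knorm_power2 kinner_diff_right)
      also have "kinner (D n) (D n - D M) \<le> knorm (D n) * knorm (D n - D M)"
        using kinner_Cauchy_Schwarz abs_le_D1 by blast
      also have "\<dots> \<le> knorm (D n) * e"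
        using M[OF that order_refl] knorm_nonneg by (intro mult_left_mono) auto
      finally show ?thesis by simp
    qed
    ultimately show ?thesis using LIMSEQ_le[of "\<lambda>n. (knorm (D n))\<^sup>2" "r\<^sup>2"] by fastforce
  qed
  then have le: "r\<^sup>2 \<le> r * e" if "0 < e" for e using that by blast
  have "r = 0"
  proof (rule ccontr)
    assume "r \<noteq> 0"
    then have "0 < r" using r0 by simp
    then show False using le[of "r / 2"] by (simp add: power2_eq_square)
  qed
  then show ?thesis using r r0 by simp
qed

lemma kapprox_diff:
  assumes A: "kapprox A f" and B: "kapprox B g"
  shows "kapprox (\<lambda>n. A n - B n) (\<lambda>t. f t - g t)"
  unfolding kapprox_def
proof (intro conjI allI impI)
  fix e :: real assume "0 < e"
  then have e: "0 < e / 2" by simp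
  obtain M where M: "\<And>m n. m \<ge> M \<Longrightarrow> n \<ge> M \<Longrightarrow> knorm (A m - A n) < e / 2"
    using A e unfolding kapprox_def by blast
  obtain N where N: "\<And>m n. m \<ge> N \<Longrightarrow> n \<ge> N \<Longrightarrow> knorm (B m - B n) < e / 2"
    using B e unfolding kapprox_def by blast
  have "knorm ((A m - B m) - (A n - B n)) < e" if "m \<ge> max M N" "n \<ge> max M N" for m n
  proof -
    have "knorm ((A m - B m) - (A n - B n)) \<le> knorm (A m - A n) + knorm (((A m - B m) - (A n - B n)) - (A m - A n))"
      by (rule knorm_triangle)
    also have "((A m - B m) - (A n - B n)) - (A m - A n) = B n - B m" by simp
    finally show ?thesis using M[of m n] N[of n m] that by simp
  qed
  then show "\<exists>M. \<forall>m\<ge>M. \<forall>n\<ge>M. knorm ((A m - B m) - (A n - B n)) < e" by blast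
next
  fix t show "(\<lambda>n. kspan (A n - B n) t) \<longlonglongrightarrow> f t - g t"
    unfolding kspan_diff using A B unfolding kapprox_def by (intro tendsto_intros) auto
qed

lemma rkhs_norm_limit:
  assumes A: "kapprox A f"
  shows "(\<lambda>n. knorm (A n)) \<longlonglongrightarrow> rkhs_norm f"
proof -
  obtain r where r: "(\<lambda>n. knorm (A n)) \<longlonglongrightarrow> r"
    using kapprox_knorm_convergent[OF A] by (auto simp: convergent_def)
  have "rkhs_norm f = r" unfolding rkhs_norm_def
  proof (rule the_equality)
    fix q assume "\<exists>A. kapprox A f \<and> (\<lambda>n. knorm (A n)) \<longlonglongrightarrow> q"
    then obtain B where B: "kapprox B f" "(\<lambda>n. knorm (B n)) \<longlonglongrightarrow> q" by blast
    have "kapprox (\<lambda>n. A n - B n) (\<lambda>t. 0)" using kapprox_diff[OF A B(1)] by simp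
    then have "(\<lambda>n. knorm (A n - B n)) \<longlonglongrightarrow> 0" by (rule kapprox_zero_knorm)
    then have "(\<lambda>n. knorm (A n) - knorm (B n)) \<longlonglongrightarrow> 0"
      by (rule Lim_null_comparison[rotated]) (simp add: knorm_diff_le)
    moreover have "(\<lambda>n. knorm (A n) - knorm (B n)) \<longlonglongrightarrow> r - q" by (intro tendsto_diff r B)
    ultimately show "q = r" using LIMSEQ_unique by fastforce
  qed (use A r in blast)
  then show ?thesis using r by simp
qed

section \<open>Potentials of bounded charge densities\<close>

text \<open>The image of the signed measure u M under the simple map \<open>F\<close>: one atom for
  each value of \<open>F\<close>, carrying the charge of its fibre.\<close>

definition simple_comb :: "'b measure \<Rightarrow> ('b \<Rightarrow> 'a::euclidean_space) \<Rightarrow> ('b \<Rightarrow> real) \<Rightarrow> 'a \<Rightarrow>\<^sub>0 real" where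
  "simple_comb M F u = (\<Sum>x\<in>F ` space M. Poly_Mapping.single x (\<integral>t. indicator (F -` {x}) t * u t \<partial>M))"

lemma simple_comb_sum:
  fixes F :: "'b \<Rightarrow> 'a::euclidean_space" and g :: "'a \<Rightarrow> real"
  assumes F: "simple_function M F" and u: "integrable M u"
  shows "(\<Sum>s\<in>Poly_Mapping.keys (simple_comb M F u). Poly_Mapping.lookup (simple_comb M F u) s * g s) =
    (\<integral>t. u t * g (F t) \<partial>M)"
proof -
  define S where "S = F ` space M"
  have S: "finite S" using F by (simp add: S_def simple_function_def)
  define w where "w x = (\<integral>t. indicator (F -` {x}) t * u t \<partial>M)" for x
  have l: "Poly_Mapping.lookup (simple_comb M F u) x = (if x \<in> S then w x else 0)" for x
    using S by (simp add: simple_comb_def S_def[symmetric] w_def[symmetric] lookup_sum lookup_single when_def)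
  have "Poly_Mapping.keys (simple_comb M F u) \<subseteq> S" using l by (auto simp: in_keys_iff split: if_splits)
  then have "(\<Sum>s\<in>Poly_Mapping.keys (simple_comb M F u). Poly_Mapping.lookup (simple_comb M F u) s * g s) =
      (\<Sum>s\<in>S. Poly_Mapping.lookup (simple_comb M F u) s * g s)"
    by (intro sum.mono_neutral_left) (use S in \<open>auto simp: in_keys_iff\<close>)
  also have "\<dots> = (\<Sum>s\<in>S. w s * g s)" by (intro sum.cong) (simp_all add: l)
  also have "\<dots> = (\<Sum>s\<in>S. \<integral>t. indicator (F -` {s}) t * u t * g s \<partial>M)"
    by (simp add: w_def)
  also have "\<dots> = (\<integral>t. (\<Sum>s\<in>S. indicator (F -` {s}) t * u t * g s) \<partial>M)"
  proof (rule Bochner_Integration.integral_sum[symmetric])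
    fix s assume "s \<in> S"
    have "F -` {s} \<inter> space M \<in> sets M" using F by (rule simple_functionD)
    then have "integrable M (\<lambda>t. indicator (F -` {s} \<inter> space M) t *\<^sub>R u t)"
      using u by (rule integrable_mult_indicator)
    then have "integrable M (\<lambda>t. indicator (F -` {s}) t * u t)"
      by (rule Bochner_Integration.integrable_cong[THEN iffD1, rotated -1]) (auto simp: indicator_def)
    then show "integrable M (\<lambda>t. indicator (F -` {s}) t * u t * g s)" by simp
  qed
  also have "\<dots> = (\<integral>t. u t * g (F t) \<partial>M)"
  proof (rule Bochner_Integration.integral_cong[OF refl])
    fix t assume "t \<in> space M"
    then have "F t \<in> S" by (simp add: S_def)
    have "(\<Sum>s\<in>S. indicator (F -` {s}) t * u t * g s) = (\<Sum>s\<in>S. if s = F t then u t * g s else 0)"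
      by (intro sum.cong) (auto simp: indicator_def)
    then show "(\<Sum>s\<in>S. indicator (F -` {s}) t * u t * g s) = u t * g (F t)"
      using S \<open>F t \<in> S\<close> by simp
  qed
  finally show ?thesis .
qed

lemma kspan_simple_comb:
  assumes "simple_function M F" "integrable M u"
  shows "kspan (simple_comb M F u) y = (\<integral>t. u t * kappa (F t) y \<partial>M)"
  unfolding kspan_def by (rule simple_comb_sum[OF assms])

lemma kinner_simple_comb:
  assumes "simple_function M F" "integrable M u"
  shows "kinner a (simple_comb M F u) = (\<integral>t. u t * kspan a (F t) \<partial>M)"
  unfolding kinner_kspan by (rule simple_comb_sum[OF assms])

lemma kspan_continuous: "continuous_on UNIV (kspan a)"
  unfolding kspan_def[abs_def] kappa_def by (intro continuous_intros)

text \<open>The signed charge with density \<open>u\<close> is transported to space by \<phi>, later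
  a dilation by c. \<open>pot\<close> is its potential under \<open>kappa\<close> and
  \<open>energy\<close> its self-interaction. The density may change sign, as do the charges in the
  upper bound for the objective.\<close>

locale kernel_field = prob_space M for M :: "'b measure" +
  fixes \<phi> :: "'b \<Rightarrow> 'a::euclidean_space" and u :: "'b \<Rightarrow> real" and R B :: real
  assumes \<phi>[measurable]: "\<phi> \<in> borel_measurable M" and R: "\<And>t. t \<in> space M \<Longrightarrow> norm (\<phi> t) \<le> R"
    and u[measurable]: "u \<in> borel_measurable M" and B: "\<And>t. t \<in> space M \<Longrightarrow> \<bar>u t\<bar> \<le> B"
begin

lemma bounded_integrable:
  fixes f :: "'b \<Rightarrow> real"
  assumes "f \<in> borel_measurable M" "\<And>t. t \<in> space M \<Longrightarrow> \<bar>f t\<bar> \<le> C"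
  shows "integrable M f"
  by (rule integrable_const_bound[of _ C]) (use assms in auto)

lemma u_integrable: "integrable M u"
  by (rule bounded_integrable[OF u B])

lemma B_nonneg: "0 \<le> B"
proof -
  obtain t where "t \<in> space M" using not_empty by auto
  then show ?thesis using B[of t] by linarith
qed

lemma abs_integral_le:
  fixes f :: "'b \<Rightarrow> real"
  assumes "f \<in> borel_measurable M" "\<And>t. t \<in> space M \<Longrightarrow> \<bar>f t\<bar> \<le> C"
  shows "\<bar>\<integral>t. f t \<partial>M\<bar> \<le> C"
proof -
  have "\<bar>\<integral>t. f t \<partial>M\<bar> \<le> (\<integral>t. \<bar>f t\<bar> \<partial>M)" by (rule integral_abs_bound)
  also have "\<dots> \<le> (\<integral>t. C \<partial>M)"
    by (rule integral_mono) (use assms in \<open>auto intro!: bounded_integrable\<close>)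
  finally show ?thesis by (simp add: prob_space)
qed

definition pot :: "'a \<Rightarrow> real" where
  "pot y = (\<integral>t. u t * kappa (\<phi> t) y \<partial>M)"

lemma kappa_measurable[measurable]:
  "f \<in> borel_measurable M \<Longrightarrow> g \<in> borel_measurable M \<Longrightarrow> (\<lambda>t. kappa (f t) (g t)) \<in> borel_measurable M"
  unfolding kappa_def by measurable

lemma u_kappa_le: "\<bar>u t * kappa x y\<bar> \<le> B" if "t \<in> space M"
  using mult_mono[OF B[OF that] kappa_le_1, of x y] B_nonneg kappa_nonneg[of x y] by (simp add: abs_mult)

lemma u_kappa_diff_le: "\<bar>u t * kappa s x - u t * kappa s y\<bar> \<le> B * norm (x - y)" if "t \<in> space M"
  using mult_mono[OF B[OF that] kappa_lipschitz, of s x y] B_nonneg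
  by (simp add: abs_mult right_diff_distrib[symmetric])

lemma field_lipschitz:
  assumes [measurable]: "\<psi> \<in> borel_measurable M"
  shows "\<bar>(\<integral>t. u t * kappa (\<psi> t) x \<partial>M) - (\<integral>t. u t * kappa (\<psi> t) y \<partial>M)\<bar> \<le> B * norm (x - y)"
proof -
  have i: "integrable M (\<lambda>t. u t * kappa (\<psi> t) x)" for x
    by (rule bounded_integrable[OF _ u_kappa_le]) auto
  have "\<bar>\<integral>t. u t * kappa (\<psi> t) x - u t * kappa (\<psi> t) y \<partial>M\<bar> \<le> B * norm (x - y)"
    by (rule abs_integral_le[OF _ u_kappa_diff_le]) auto
  then show ?thesis using i by simp
qed

lemma pot_lipschitz: "\<bar>pot x - pot y\<bar> \<le> B * norm (x - y)"
  unfolding pot_def by (rule field_lipschitz) simp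

lemma pot_continuous: "continuous_on UNIV pot"
proof (rule continuous_onI)
  fix x and e :: real assume "0 < e"
  show "\<exists>d>0. \<forall>x'\<in>UNIV. dist x' x < d \<longrightarrow> dist (pot x') (pot x) \<le> e"
  proof (intro exI[of _ "e / (B + 1)"] conjI ballI impI)
    show "0 < e / (B + 1)" using \<open>0 < e\<close> B_nonneg by simp
    fix x' assume "dist x' x < e / (B + 1)"
    then have "(B + 1) * norm (x' - x) \<le> e" using B_nonneg by (simp add: dist_norm field_simps)
    then have "B * norm (x' - x) \<le> e"
      using norm_ge_zero[of "x' - x"] by (simp add: distrib_right del: norm_ge_zero)
    then show "dist (pot x') (pot x) \<le> e" using pot_lipschitz[of x' x] by (simp add: dist_real_def)
  qed
qed

lemma pot_le: "\<bar>pot y\<bar> \<le> B"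
  unfolding pot_def by (rule abs_integral_le[OF _ u_kappa_le]) auto

definition energy :: real where
  "energy = (\<integral>t. u t * pot (\<phi> t) \<partial>M)"

text \<open>Approximating \<phi> by simple functions turns the charge into finite combinations whose
  squared norms converge to the energy. The third clause is the pairing of the potential with a
  finite combination, from which the pairing with any member of \<open>rkhs\<close> is reached by a
  limit.\<close>

lemma kapprox_pot:
  "\<exists>A. kapprox A pot \<and> (\<lambda>n. (knorm (A n))\<^sup>2) \<longlonglongrightarrow> energy \<and>
    (\<forall>a. (\<lambda>n. kinner a (A n)) \<longlonglongrightarrow> (\<integral>t. u t * kspan a (\<phi> t) \<partial>M))"
proof -
  obtain F where F: "\<And>i. simple_function M (F i)" "\<And>x. x \<in> space M \<Longrightarrow> (\<lambda>i. F i x) \<longlonglongrightarrow> \<phi> x"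
    and Fb: "\<And>i x. x \<in> space M \<Longrightarrow> dist (F i x) 0 \<le> 2 * dist (\<phi> x) 0"
    using borel_measurable_implies_sequence_metric[OF \<phi>, of 0] by blast
  have Fm[measurable]: "F i \<in> borel_measurable M" for i using F(1) borel_measurable_simple_function by blast
  have F_le: "norm (F i x) \<le> 2 * R" if "x \<in> space M" for i x using Fb[OF that, of i] R[OF that] by simp
  have F_diff: "norm (F i x - \<phi> x) \<le> 3 * R" if "x \<in> space M" for i x
    using F_le[OF that, of i] R[OF that] norm_triangle_ineq4[of "F i x" "\<phi> x"] by linarith
  have F_diff2: "norm (F i x - F j x) \<le> norm (F i x - \<phi> x) + norm (F j x - \<phi> x)" for i j x
    using norm_triangle_ineq4[of "F i x - \<phi> x" "F j x - \<phi> x"] by simp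
  define A where "A n = simple_comb M (F n) u" for n
  have Asp: "kspan (A n) y = (\<integral>t. u t * kappa (F n t) y \<partial>M)" for n y
    unfolding A_def by (rule kspan_simple_comb[OF F(1) u_integrable])
  have Ain: "kinner a (A n) = (\<integral>t. u t * kspan a (F n t) \<partial>M)" for a n
    unfolding A_def by (rule kinner_simple_comb[OF F(1) u_integrable])
  have kspan_m[measurable]: "kspan a \<in> borel_measurable borel" for a :: "'a \<Rightarrow>\<^sub>0 real"
    using kspan_continuous by (rule borel_measurable_continuous_onI)
  have pot_m[measurable]: "pot \<in> borel_measurable borel"
    using pot_continuous by (rule borel_measurable_continuous_onI)
  have kspan_le: "\<bar>u t * kspan a x\<bar> \<le> B * knorm a" if "t \<in> space M" for t x and a :: "'a \<Rightarrow>\<^sub>0 real"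
    using mult_mono[OF B[OF that] kspan_le_knorm] B_nonneg by (simp add: abs_mult)
  have Alip: "\<bar>kspan (A n) x - kspan (A n) y\<bar> \<le> B * norm (x - y)" for n x y
    unfolding Asp by (rule field_lipschitz) simp
  have lim_sp: "(\<lambda>n. kspan (A n) y) \<longlonglongrightarrow> pot y" for y
    unfolding Asp pot_def
  proof (rule integral_dominated_convergence[where w = "\<lambda>_. B"])
    show "AE t in M. (\<lambda>n. u t * kappa (F n t) y) \<longlonglongrightarrow> u t * kappa (\<phi> t) y"
      unfolding kappa_def by (intro AE_I2 tendsto_intros F)
    show "AE t in M. norm (u t * kappa (F n t) y) \<le> B" for n using u_kappa_le by (intro AE_I2) auto
  qed auto
  have Abd: "\<bar>kspan (A n) y\<bar> \<le> B" for n y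
    unfolding Asp by (rule abs_integral_le[OF _ u_kappa_le]) auto
  define d where "d n = (\<integral>t. norm (F n t - \<phi> t) \<partial>M)" for n
  have dint: "integrable M (\<lambda>t. norm (F n t - \<phi> t))" for n
    by (rule bounded_integrable[where C = "3 * R"]) (use F_diff in auto)
  have d0: "d \<longlonglongrightarrow> 0"
  proof -
    have "(\<lambda>n. \<integral>t. norm (F n t - \<phi> t) \<partial>M) \<longlonglongrightarrow> (\<integral>t. norm (\<phi> t - \<phi> t) \<partial>M)"
    proof (rule integral_dominated_convergence[where w = "\<lambda>_. 3 * R"])
      show "AE t in M. (\<lambda>n. norm (F n t - \<phi> t)) \<longlonglongrightarrow> norm (\<phi> t - \<phi> t)"
        by (intro AE_I2 tendsto_intros F)
      show "AE t in M. norm (norm (F n t - \<phi> t)) \<le> 3 * R" for n using F_diff by (intro AE_I2) auto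
    qed auto
    then show ?thesis by (simp add: d_def[abs_def])
  qed
  \<comment> \<open>The squared norm is the difference of two integrals of \<open>kspan ?p\<close>,
    taken at F m t and at F n t. As \<open>kspan ?p\<close> has Lipschitz constant 2 B, the mean
    distances \<open>d\<close> control it.\<close>
  have knorm_diff: "(knorm (A m - A n))\<^sup>2 \<le> 2 * B * B * (d m + d n)" for m n
  proof -
    let ?p = "A m - A n"
    have i: "integrable M (\<lambda>t. u t * kspan ?p (F k t))" for k
      by (rule bounded_integrable[OF _ kspan_le]) auto
    have lip: "\<bar>kspan ?p x - kspan ?p y\<bar> \<le> 2 * B * norm (x - y)" for x y
      using Alip[of m x y] Alip[of n x y] unfolding kspan_diff by linarith
    have "(knorm ?p)\<^sup>2 = (\<integral>t. u t * kspan ?p (F m t) \<partial>M) - (\<integral>t. u t * kspan ?p (F n t) \<partial>M)"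
      by (simp add: knorm_power2 kinner_diff_right[of ?p] Ain)
    also have "\<dots> = (\<integral>t. u t * kspan ?p (F m t) - u t * kspan ?p (F n t) \<partial>M)"
      using i by simp
    also have "\<dots> \<le> (\<integral>t. 2 * B * B * (norm (F m t - \<phi> t) + norm (F n t - \<phi> t)) \<partial>M)"
    proof (rule integral_mono)
      show "integrable M (\<lambda>t. u t * kspan ?p (F m t) - u t * kspan ?p (F n t))" using i by simp
      show "integrable M (\<lambda>t. 2 * B * B * (norm (F m t - \<phi> t) + norm (F n t - \<phi> t)))" using dint by simp
      fix t assume t: "t \<in> space M"
      have "u t * kspan ?p (F m t) - u t * kspan ?p (F n t) \<le> \<bar>u t\<bar> * \<bar>kspan ?p (F m t) - kspan ?p (F n t)\<bar>"
        unfolding right_diff_distrib[symmetric] abs_mult[symmetric] by (rule abs_ge_self)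
      also have "\<dots> \<le> B * (2 * B * norm (F m t - F n t))"
        by (rule mult_mono[OF B[OF t] lip B_nonneg]) simp
      also have "\<dots> \<le> B * (2 * B * (norm (F m t - \<phi> t) + norm (F n t - \<phi> t)))"
        by (intro mult_left_mono F_diff2 mult_nonneg_nonneg B_nonneg) simp
      finally show "u t * kspan ?p (F m t) - u t * kspan ?p (F n t) \<le> 2 * B * B * (norm (F m t - \<phi> t) + norm (F n t - \<phi> t))"
        by (simp add: mult_ac)
    qed
    also have "\<dots> = 2 * B * B * (d m + d n)"
      using dint by (simp add: d_def)
    finally show ?thesis .
  qed
  have "kapprox A pot"
    unfolding kapprox_def
  proof (intro conjI allI impI lim_sp)
    fix e :: real assume e: "0 < e"
    have "(\<lambda>n. 2 * B * B * (d n + d n)) \<longlonglongrightarrow> 2 * B * B * (0 + 0)" by (intro tendsto_intros d0)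
    then have "\<forall>\<^sub>F n in sequentially. 2 * B * B * (d n + d n) < e\<^sup>2"
      by (rule order_tendstoD(2)) (use e in simp)
    then obtain N where N: "\<And>n. n \<ge> N \<Longrightarrow> 2 * B * B * (d n + d n) < e\<^sup>2"
      by (auto simp: eventually_sequentially)
    have "knorm (A m - A n) < e" if "m \<ge> N" "n \<ge> N" for m n
    proof -
      have "(knorm (A m - A n))\<^sup>2 \<le> (2 * B * B * (d m + d m) + 2 * B * B * (d n + d n)) / 2"
        using knorm_diff[of m n] by (simp add: algebra_simps)
      also have "\<dots> < e\<^sup>2" using N[OF that(1)] N[OF that(2)] by simp
      finally show ?thesis using e by (simp add: power2_less_imp_less)
    qed
    then show "\<exists>M. \<forall>m\<ge>M. \<forall>n\<ge>M. knorm (A m - A n) < e" by blast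
  qed
  moreover have "(\<lambda>n. (knorm (A n))\<^sup>2) \<longlonglongrightarrow> energy"
    unfolding knorm_power2 Ain energy_def
  proof (rule integral_dominated_convergence[where w = "\<lambda>_. B * B"])
    show "AE t in M. (\<lambda>n. u t * kspan (A n) (F n t)) \<longlonglongrightarrow> u t * pot (\<phi> t)"
    proof (intro AE_I2 tendsto_mult tendsto_const)
      fix t assume t: "t \<in> space M"
      have "(\<lambda>n. F n t - \<phi> t) \<longlonglongrightarrow> 0" using F(2)[OF t] by (simp add: LIM_zero_iff)
      then have "(\<lambda>n. B * norm (F n t - \<phi> t)) \<longlonglongrightarrow> 0"
        by (intro tendsto_mult_right_zero tendsto_norm_zero)
      then have "(\<lambda>n. kspan (A n) (F n t) - kspan (A n) (\<phi> t)) \<longlonglongrightarrow> 0"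
        by (rule Lim_null_comparison[rotated]) (simp add: Alip)
      from tendsto_add[OF this lim_sp[of "\<phi> t"]] show "(\<lambda>n. kspan (A n) (F n t)) \<longlonglongrightarrow> pot (\<phi> t)" by simp
    qed
    show "AE t in M. norm (u t * kspan (A n) (F n t)) \<le> B * B" for n
      using mult_mono[OF B Abd] B_nonneg by (intro AE_I2) (simp add: abs_mult)
  qed auto
  moreover have "(\<lambda>n. kinner a (A n)) \<longlonglongrightarrow> (\<integral>t. u t * kspan a (\<phi> t) \<partial>M)" for a
    unfolding Ain
  proof (rule integral_dominated_convergence[where w = "\<lambda>_. B * knorm a"])
    show "AE t in M. (\<lambda>n. u t * kspan a (F n t)) \<longlonglongrightarrow> u t * kspan a (\<phi> t)"
      unfolding kspan_def kappa_def by (intro AE_I2 tendsto_intros F)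
    show "AE t in M. norm (u t * kspan a (F n t)) \<le> B * knorm a" for n
      using kspan_le by (intro AE_I2) auto
  qed auto
  ultimately show ?thesis by blast
qed

lemma energy_nonneg: "0 \<le> energy"
proof -
  obtain A where A: "kapprox A pot" "(\<lambda>n. (knorm (A n))\<^sup>2) \<longlonglongrightarrow> energy"
    "\<And>a. (\<lambda>n. kinner a (A n)) \<longlonglongrightarrow> (\<integral>t. u t * kspan a (\<phi> t) \<partial>M)"
    using kapprox_pot by blast
  then show ?thesis by (intro LIMSEQ_le_const[OF A(2)]) simp
qed

lemma pot_rkhs: "pot \<in> rkhs" and rkhs_norm_pot: "(rkhs_norm pot)\<^sup>2 = energy"
proof -
  obtain A where A: "kapprox A pot" "(\<lambda>n. (knorm (A n))\<^sup>2) \<longlonglongrightarrow> energy"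
    "\<And>a. (\<lambda>n. kinner a (A n)) \<longlonglongrightarrow> (\<integral>t. u t * kspan a (\<phi> t) \<partial>M)"
    using kapprox_pot by blast
  from A(1) show "pot \<in> rkhs" by (auto simp: rkhs_def)
  have "(\<lambda>n. (knorm (A n))\<^sup>2) \<longlonglongrightarrow> (rkhs_norm pot)\<^sup>2"
    by (rule tendsto_power[OF rkhs_norm_limit[OF A(1)]])
  from this A(2) show "(rkhs_norm pot)\<^sup>2 = energy" by (rule LIMSEQ_unique)
qed

text \<open>The integral is the inner product of f with the potential, so the bound is
  Cauchy-Schwarz. It holds for finite combinations and passes to f by dominated convergence, the
  majorant coming from \<open>kspan_le_knorm\<close>.\<close>

lemma rkhs_integral_le:
  assumes f: "f \<in> rkhs"
  shows "integrable M (\<lambda>t. u t * f (\<phi> t))"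
    "(\<integral>t. u t * f (\<phi> t) \<partial>M) \<le> rkhs_norm f * sqrt energy"
proof -
  obtain C where C: "kapprox C f" using f by (auto simp: rkhs_def)
  then have Clim: "(\<lambda>n. kspan (C n) t) \<longlonglongrightarrow> f t" for t by (simp add: kapprox_def)
  have Cn: "(\<lambda>n. knorm (C n)) \<longlonglongrightarrow> rkhs_norm f" by (rule rkhs_norm_limit[OF C])
  obtain A where A: "kapprox A pot" "(\<lambda>n. (knorm (A n))\<^sup>2) \<longlonglongrightarrow> energy"
    "\<And>a. (\<lambda>n. kinner a (A n)) \<longlonglongrightarrow> (\<integral>t. u t * kspan a (\<phi> t) \<partial>M)"
    using kapprox_pot by blast
  have "(\<lambda>n. sqrt ((knorm (A n))\<^sup>2)) \<longlonglongrightarrow> sqrt energy" by (intro tendsto_real_sqrt A)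
  then have An: "(\<lambda>n. knorm (A n)) \<longlonglongrightarrow> sqrt energy" by (simp add: knorm_nonneg)
  have le: "(\<integral>t. u t * kspan a (\<phi> t) \<partial>M) \<le> knorm a * sqrt energy" for a
  proof (rule LIMSEQ_le[OF A(3)])
    show "(\<lambda>n. knorm a * knorm (A n)) \<longlonglongrightarrow> knorm a * sqrt energy" by (intro tendsto_intros An)
    show "\<exists>N. \<forall>n\<ge>N. kinner a (A n) \<le> knorm a * knorm (A n)"
      using kinner_Cauchy_Schwarz abs_le_D1 by blast
  qed
  have "Bseq (\<lambda>n. knorm (C n))" using Cn by (intro convergent_imp_Bseq convergentI)
  then obtain K where "\<And>n. norm (knorm (C n)) \<le> K" by (auto simp: Bseq_def)
  then have K: "knorm (C n) \<le> K" for n by (simp add: knorm_nonneg)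
  have kspan_m[measurable]: "kspan a \<in> borel_measurable borel" for a :: "'a \<Rightarrow>\<^sub>0 real"
    using kspan_continuous by (rule borel_measurable_continuous_onI)
  have "f \<in> borel_measurable borel"
    by (rule borel_measurable_LIMSEQ_real[OF Clim]) simp
  then have [measurable]: "(\<lambda>t. u t * f (\<phi> t)) \<in> borel_measurable M" by measurable
  have AEl: "AE t in M. (\<lambda>n. u t * kspan (C n) (\<phi> t)) \<longlonglongrightarrow> u t * f (\<phi> t)"
    by (intro AE_I2 tendsto_intros Clim)
  have AEb: "AE t in M. norm (u t * kspan (C n) (\<phi> t)) \<le> B * K" for n
    using mult_mono[OF B order_trans[OF kspan_le_knorm K]] B_nonneg by (intro AE_I2) (simp add: abs_mult)
  have int: "(\<lambda>n. \<integral>t. u t * kspan (C n) (\<phi> t) \<partial>M) \<longlonglongrightarrow> (\<integral>t. u t * f (\<phi> t) \<partial>M)"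
    by (rule integral_dominated_convergence[OF _ _ _ AEl AEb]) simp_all
  have "integrable M (\<lambda>t. u t * f (\<phi> t))"
    by (rule integrable_dominated_convergence[OF _ _ _ AEl AEb]) simp_all
  then   show "integrable M (\<lambda>t. u t * f (\<phi> t))" .
  show "(\<integral>t. u t * f (\<phi> t) \<partial>M) \<le> rkhs_norm f * sqrt energy"
  proof (rule LIMSEQ_le[OF int])
    show "(\<lambda>n. knorm (C n) * sqrt energy) \<longlonglongrightarrow> rkhs_norm f * sqrt energy" by (intro tendsto_intros Cn)
  qed (use le in blast)
qed

end

lemma zero_in_rkhs: "(\<lambda>_::'a::euclidean_space. 0) \<in> rkhs" and rkhs_norm_zero: "rkhs_norm (\<lambda>_::'a::euclidean_space. 0) = 0"
proof -
  have k: "kapprox (\<lambda>n. 0) (\<lambda>_::'a. 0)"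
    by (simp add: kapprox_def knorm_def kinner_def kspan_def)
  then show "(\<lambda>_::'a. 0) \<in> rkhs" by (auto simp: rkhs_def)
  have "(\<lambda>n. 0) \<longlonglongrightarrow> rkhs_norm (\<lambda>_::'a. 0)" using rkhs_norm_limit[OF k] by (simp add: knorm_def kinner_def)
  then show "rkhs_norm (\<lambda>_::'a. 0) = 0" using LIMSEQ_unique tendsto_const by blast
qed

section \<open>The Schroedinger equation on the unit cube\<close>

text \<open>A probability measure independent of c: dilation absorbs the factor c^(-d) of
  \<open>J_fun\<close>, and in the kernel c becomes a mere rate.\<close>

definition cubeM :: "'a::euclidean_space measure" where
  "cubeM = restrict_space lborel (cbox 0 One)"

lemma space_cubeM: "space cubeM = cbox 0 (One::'a::euclidean_space)"
  by (simp add: cubeM_def space_restrict_space)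

lemma prob_space_cubeM: "prob_space (cubeM :: 'a::euclidean_space measure)"
proof
  show "emeasure (cubeM :: 'a measure) (space cubeM) = 1"
    by (simp add: space_cubeM) (simp add: cubeM_def emeasure_restrict_space inner_diff_left)
qed

interpretation cube: prob_space "cubeM :: 'a::euclidean_space measure"
  by (rule prob_space_cubeM)

lemma borel_measurable_cubeM: "f \<in> borel_measurable borel \<Longrightarrow> f \<in> borel_measurable cubeM"
  unfolding cubeM_def by (rule measurable_restrict_space1) simp

lemma continuous_cubeM: "continuous_on UNIV f \<Longrightarrow> f \<in> borel_measurable cubeM"
  for f :: "'a::euclidean_space \<Rightarrow> 'b::topological_space"
  by (intro borel_measurable_cubeM borel_measurable_continuous_onI)

lemma zero_in_cube: "0 \<in> cbox 0 (One::'a::euclidean_space)"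
  by (simp add: mem_box)

lemma norm_cube_diff: "s \<in> cbox 0 One \<Longrightarrow> t \<in> cbox 0 One \<Longrightarrow> norm (s - t) \<le> DIM('a)"
  for s t :: "'a::euclidean_space"
proof -
  assume st: "s \<in> cbox 0 One" "t \<in> cbox 0 One"
  have "norm (s - t) \<le> (\<Sum>b\<in>Basis. \<bar>(s - t) \<bullet> b\<bar>)" by (rule norm_le_l1)
  also have "\<dots> \<le> (\<Sum>b\<in>(Basis::'a set). 1)"
  proof (rule sum_mono)
    fix b :: 'a assume "b \<in> Basis"
    then have "0 \<le> s \<bullet> b" "s \<bullet> b \<le> 1" "0 \<le> t \<bullet> b" "t \<bullet> b \<le> 1" using st by (simp_all add: mem_box)
    then show "\<bar>(s - t) \<bullet> b\<bar> \<le> 1" by (simp add: inner_diff_left)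
  qed
  finally show ?thesis by simp
qed

lemma norm_cube: "t \<in> cbox 0 One \<Longrightarrow> norm t \<le> DIM('a)" for t :: "'a::euclidean_space"
  using norm_cube_diff[OF _ zero_in_cube, of t] by simp

lemma integrable_cube:
  fixes f :: "'a::euclidean_space \<Rightarrow> real"
  assumes "f \<in> borel_measurable cubeM" "\<And>t. t \<in> cbox 0 One \<Longrightarrow> \<bar>f t\<bar> \<le> C"
  shows "integrable cubeM f"
  by (rule cube.integrable_const_bound[of _ C]) (use assms in \<open>auto simp: space_cubeM\<close>)

text \<open>Bounds are demanded on the cube only, since weights such as the reciprocal of a solution
  of the boundary value problem are controlled nowhere else.\<close>

definition pos_bounded :: "('a::euclidean_space \<Rightarrow> real) \<Rightarrow> bool" where
  "pos_bounded u \<longleftrightarrow> u \<in> borel_measurable cubeM \<and> (\<exists>a>0. \<exists>b. \<forall>t\<in>cbox 0 One. a \<le> u t \<and> u t \<le> b)"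

lemma pos_boundedE:
  assumes "pos_bounded u"
  obtains a b where "0 < a" "a \<le> b" "\<And>t. t \<in> cbox 0 One \<Longrightarrow> a \<le> u t" "\<And>t. t \<in> cbox 0 One \<Longrightarrow> u t \<le> b"
    "u \<in> borel_measurable cubeM"
proof -
  from assms obtain a b where ab: "u \<in> borel_measurable cubeM" "0 < a" "\<forall>t\<in>cbox 0 One. a \<le> u t \<and> u t \<le> b"
    unfolding pos_bounded_def by blast
  then have "a \<le> b" using zero_in_cube[where 'a='a] by (meson order_trans)
  then show thesis using ab by (intro that[of a b]) auto
qed

lemma pos_bounded_pos: "pos_bounded u \<Longrightarrow> t \<in> cbox 0 One \<Longrightarrow> 0 < u t"
  unfolding pos_bounded_def by (meson less_le_trans)

lemma pos_bounded_measurable: "pos_bounded u \<Longrightarrow> u \<in> borel_measurable cubeM"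
  by (simp add: pos_bounded_def)

lemma pos_bounded_continuous:
  assumes "continuous_on UNIV u" "\<And>x. 0 < u x"
  shows "pos_bounded u"
proof -
  have c: "continuous_on (cbox 0 One) u" using assms(1) continuous_on_subset by blast
  obtain p where p: "\<forall>t\<in>cbox 0 One. u p \<le> u t"
    using continuous_attains_inf[OF compact_cbox _ c] zero_in_cube by blast
  obtain q where q: "\<forall>t\<in>cbox 0 One. u t \<le> u q"
    using continuous_attains_sup[OF compact_cbox _ c] zero_in_cube by blast
  show ?thesis unfolding pos_bounded_def using p q assms continuous_cubeM by blast
qed

section \<open>The integral operator, its contraction property and the fixed point\<close>

definition Kop :: "real \<Rightarrow> ('a::euclidean_space \<Rightarrow> real) \<Rightarrow> 'a \<Rightarrow> real" where
  "Kop c u x = (\<integral>t. exp (- (c * norm (x - t))) * u t \<partial>cubeM)"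

lemma kernel_field_cube:
  fixes u :: "'a::euclidean_space \<Rightarrow> real"
  assumes "u \<in> borel_measurable cubeM" "\<And>t. t \<in> cbox 0 One \<Longrightarrow> \<bar>u t\<bar> \<le> B"
  shows "kernel_field cubeM (\<lambda>t. c *\<^sub>R t) u (\<bar>c\<bar> * DIM('a)) B"
proof
  show "(\<lambda>t::'a. c *\<^sub>R t) \<in> borel_measurable cubeM" by (intro continuous_cubeM continuous_intros)
  show "norm (c *\<^sub>R t) \<le> \<bar>c\<bar> * DIM('a)" if "t \<in> space cubeM" for t :: 'a
    using that norm_cube[of t] by (simp add: space_cubeM mult_left_mono)
qed (use assms in \<open>auto simp: space_cubeM\<close>)

lemma Kop_eq_pot:
  fixes u :: "'a::euclidean_space \<Rightarrow> real"
  assumes u: "u \<in> borel_measurable cubeM" "\<And>t. t \<in> cbox 0 One \<Longrightarrow> \<bar>u t\<bar> \<le> B" and c: "0 \<le> c"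
  shows "Kop c u x = kernel_field.pot cubeM (\<lambda>t. c *\<^sub>R t) u (c *\<^sub>R x)"
proof -
  interpret kernel_field cubeM "\<lambda>t. c *\<^sub>R t" u "\<bar>c\<bar> * DIM('a)" B by (rule kernel_field_cube[OF u])
  have "norm (c *\<^sub>R t - c *\<^sub>R x) = c * norm (x - t)" for t
    using c by (simp flip: scaleR_diff_right) (simp add: norm_minus_commute)
  then show ?thesis unfolding pot_def Kop_def kappa_def by (simp add: mult.commute)
qed

lemma Kop_continuous:
  fixes u :: "'a::euclidean_space \<Rightarrow> real"
  assumes u: "u \<in> borel_measurable cubeM" "\<And>t. t \<in> cbox 0 One \<Longrightarrow> \<bar>u t\<bar> \<le> B" and c: "0 \<le> c"
  shows "continuous_on UNIV (Kop c u)"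
proof -
  interpret kernel_field cubeM "\<lambda>t. c *\<^sub>R t" u "\<bar>c\<bar> * DIM('a)" B by (rule kernel_field_cube[OF u])
  have "continuous_on UNIV (\<lambda>x. pot (c *\<^sub>R x))"
    by (rule continuous_on_compose2[OF pot_continuous]) (auto intro!: continuous_intros)
  moreover have "Kop c u = (\<lambda>x. pot (c *\<^sub>R x))" using Kop_eq_pot[OF assms] by blast
  ultimately show ?thesis by simp
qed

lemma pos_bounded_abs:
  assumes "pos_bounded u"
  shows "\<exists>B. \<forall>t\<in>cbox 0 One. \<bar>u t\<bar> \<le> B"
proof (rule pos_boundedE[OF assms])
  fix a b assume "0 < a" "\<And>t. t \<in> cbox 0 One \<Longrightarrow> a \<le> u t" "\<And>t. t \<in> cbox 0 One \<Longrightarrow> u t \<le> b"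
  then have "\<forall>t\<in>cbox 0 One. \<bar>u t\<bar> \<le> b" by fastforce
  then show ?thesis by blast
qed

lemma Kop_integrable:
  fixes u :: "'a::euclidean_space \<Rightarrow> real"
  assumes u: "u \<in> borel_measurable cubeM" "\<And>t. t \<in> cbox 0 One \<Longrightarrow> \<bar>u t\<bar> \<le> B" and c: "0 \<le> c"
  shows "integrable cubeM (\<lambda>t. exp (- (c * norm (x - t))) * u t)"
proof (rule integrable_cube)
  show "(\<lambda>t. exp (- (c * norm (x - t))) * u t) \<in> borel_measurable cubeM"
    by (intro borel_measurable_times u continuous_cubeM continuous_intros)
  fix t :: 'a assume t: "t \<in> cbox 0 One"
  have "exp (- (c * norm (x - t))) * \<bar>u t\<bar> \<le> 1 * B" using c u(2)[OF t] by (intro mult_mono) auto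
  then show "\<bar>exp (- (c * norm (x - t))) * u t\<bar> \<le> B" by (simp add: abs_mult)
qed

text \<open>A Harnack inequality: the kernel never exceeds 1, and between two points of the cube,
  whose distance is at most d, it is at least exp (- c d).\<close>

lemma Kop_ratio:
  fixes u :: "'a::euclidean_space \<Rightarrow> real"
  assumes u: "u \<in> borel_measurable cubeM" "\<And>t. t \<in> cbox 0 One \<Longrightarrow> \<bar>u t\<bar> \<le> B"
    and u0: "\<And>t. t \<in> cbox 0 One \<Longrightarrow> 0 \<le> u t"
    and c: "0 \<le> c" and s: "s' \<in> cbox 0 One"
  shows "Kop c u s \<le> exp (c * DIM('a)) * Kop c u s'"
proof -
  have "Kop c u s \<le> (\<integral>t. exp (c * DIM('a)) * (exp (- (c * norm (s' - t))) * u t) \<partial>cubeM)"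
    unfolding Kop_def
  proof (rule integral_mono)
    fix t :: 'a assume "t \<in> space cubeM"
    then have t: "t \<in> cbox 0 One" by (simp add: space_cubeM)
    have "c * norm (s' - t) \<le> c * DIM('a)" by (rule mult_left_mono[OF norm_cube_diff[OF s t] c])
    moreover have "0 \<le> c * norm (s - t)" using c by simp
    ultimately have "exp (- (c * norm (s - t))) \<le> exp (c * DIM('a) + - (c * norm (s' - t)))"
      unfolding exp_le_cancel_iff by linarith
    from mult_right_mono[OF this u0[OF t]]
    show "exp (- (c * norm (s - t))) * u t \<le> exp (c * DIM('a)) * (exp (- (c * norm (s' - t))) * u t)"
      by (simp only: exp_add mult.assoc)
  qed (use Kop_integrable[OF u c] in auto)
  then show ?thesis by (simp add: Kop_def)
qed

lemma Kop_pos: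
  fixes u :: "'a::euclidean_space \<Rightarrow> real"
  assumes u: "pos_bounded u" and c: "0 \<le> c"
  shows "0 < Kop c u x"
proof -
  obtain a where a: "0 < a" "\<And>t. t \<in> cbox 0 One \<Longrightarrow> a \<le> u t" using u by (auto simp: pos_bounded_def)
  obtain B where B: "\<And>t. t \<in> cbox 0 One \<Longrightarrow> \<bar>u t\<bar> \<le> B" using pos_bounded_abs[OF u] by blast
  define e where "e = exp (- (c * (norm x + DIM('a)))) * a"
  have "e = (\<integral>t. e \<partial>(cubeM :: 'a measure))" by (simp add: cube.prob_space)
  also have "\<dots> \<le> Kop c u x"
    unfolding Kop_def
  proof (rule integral_mono)
    fix t :: 'a assume "t \<in> space cubeM"
    then have t: "t \<in> cbox 0 One" by (simp add: space_cubeM)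
    have "norm (x - t) \<le> norm x + DIM('a)" using norm_triangle_ineq4[of x t] norm_cube[OF t] by linarith
    from mult_left_mono[OF this c]
    have "exp (- (c * (norm x + DIM('a)))) \<le> exp (- (c * norm (x - t)))" by simp
    then show "e \<le> exp (- (c * norm (x - t))) * u t"
      unfolding e_def using a t by (intro mult_mono) auto
  qed (use Kop_integrable[OF pos_bounded_measurable[OF u] B c] in auto)
  finally show ?thesis using mult_pos_pos[OF exp_gt_zero a(1)] unfolding e_def by (rule less_le_trans[rotated])
qed

lemma Kop_pos_bounded:
  assumes u: "pos_bounded u" and c: "0 \<le> c"
  shows "continuous_on UNIV (Kop c u)" "pos_bounded (Kop c u)"
proof -
  obtain B where B: "\<And>t. t \<in> cbox 0 One \<Longrightarrow> \<bar>u t\<bar> \<le> B" using pos_bounded_abs[OF u] by blast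
  show "continuous_on UNIV (Kop c u)" by (rule Kop_continuous[OF pos_bounded_measurable[OF u] B c])
  then show "pos_bounded (Kop c u)" by (intro pos_bounded_continuous Kop_pos u c)
qed

text \<open>The normalisation-free form of Birkhoff's contraction theorem: the oscillation of
  \<open>ln u - ln v\<close> shrinks by the factor \<open>1 - \<delta>\<close>.\<close>

lemma Kop_contraction:
  fixes u v :: "'a::euclidean_space \<Rightarrow> real" and c D :: real
  assumes u: "pos_bounded u" and v: "pos_bounded v" and c: "0 \<le> c" and D: "0 \<le> D"
    and osc: "\<And>s s'. s \<in> cbox 0 One \<Longrightarrow> s' \<in> cbox 0 One \<Longrightarrow> u s * v s' \<le> exp D * (u s' * v s)"
    and s: "s \<in> cbox 0 One" "s' \<in> cbox 0 One"
  defines "\<delta> \<equiv> exp (- (2 * c * DIM('a)))"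
  shows "Kop c u s * Kop c v s' \<le> exp ((1 - \<delta>) * D) * (Kop c u s' * Kop c v s)"
proof -
  let ?Q = "cbox 0 (One::'a)"
  \<comment> \<open>The largest multiple of v below u on the cube. As u - a v is nonnegative, the
    Harnack inequality applies to it as well as to v.\<close>
  define a where "a = (INF t\<in>?Q. u t / v t)"
  have vpos: "0 < v t" if "t \<in> ?Q" for t using pos_bounded_pos[OF v that] .
  have upos: "0 < u t" if "t \<in> ?Q" for t using pos_bounded_pos[OF u that] .
  have bdd: "bdd_below ((\<lambda>t. u t / v t) ` ?Q)"
    by (rule bdd_belowI2[of _ 0]) (use vpos upos in \<open>force intro: divide_nonneg_pos\<close>)
  have a_le: "a * v t \<le> u t" if "t \<in> ?Q" for t
    using cINF_lower[OF bdd that] vpos[OF that] unfolding a_def by (simp add: pos_le_divide_eq)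
  have a_ge: "u t \<le> exp D * a * v t" if t: "t \<in> ?Q" for t
  proof -
    have "exp (- D) * (u t / v t) \<le> a" unfolding a_def
    proof (rule cINF_greatest)
      fix t' assume t': "t' \<in> ?Q"
      have "exp (- D) * (u t * v t') \<le> exp (- D) * (exp D * (u t' * v t))"
        by (rule mult_left_mono[OF osc[OF t t']]) simp
      also have "\<dots> = u t' * v t" by (simp add: exp_minus field_simps)
      finally show "exp (- D) * (u t / v t) \<le> u t' / v t'"
        using vpos[OF t] vpos[OF t'] by (simp add: field_simps)
    qed (use zero_in_cube in blast)
    then show ?thesis using vpos[OF t] by (simp add: exp_minus field_simps)
  qed
  have a0: "0 \<le> a" unfolding a_def
    by (rule cINF_greatest) (use vpos upos zero_in_cube in \<open>force intro: divide_nonneg_pos\<close>)+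
  obtain Bu where Bu: "\<And>t. t \<in> ?Q \<Longrightarrow> \<bar>u t\<bar> \<le> Bu" using pos_bounded_abs[OF u] by blast
  obtain Bv where Bv: "\<And>t. t \<in> ?Q \<Longrightarrow> \<bar>v t\<bar> \<le> Bv" using pos_bounded_abs[OF v] by blast
  note mu = pos_bounded_measurable[OF u] and mv = pos_bounded_measurable[OF v]
  have iu: "integrable cubeM (\<lambda>t. exp (- (c * norm (x - t))) * u t)" for x by (rule Kop_integrable[OF mu Bu c])
  have iv: "integrable cubeM (\<lambda>t. exp (- (c * norm (x - t))) * v t)" for x by (rule Kop_integrable[OF mv Bv c])
  have lin: "Kop c (\<lambda>t. u t - a * v t) x = Kop c u x - a * Kop c v x" for x
    unfolding Kop_def using iu iv by (simp add: right_diff_distrib mult.left_commute[of _ a])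
  have dle: "\<bar>u t - a * v t\<bar> \<le> Bu" if "t \<in> ?Q" for t
    using a_le[OF that] Bu[OF that] mult_nonneg_nonneg[OF a0 less_imp_le[OF vpos[OF that]]] by linarith
  have dm: "(\<lambda>t. u t - a * v t) \<in> borel_measurable cubeM" using mu mv by simp
  define U V U' V' where "U = Kop c u s" and "V = Kop c v s" and "U' = Kop c u s'" and "V' = Kop c v s'"
  have pos: "0 < U" "0 < V" "0 < U'" "0 < V'"
    unfolding U_def V_def U'_def V'_def by (intro Kop_pos u v c)+
  \<comment> \<open>One factor E is lost for u - a v and one for v, and \<delta> is the reciprocal
    of E^2.\<close>
  define E where "E = exp (c * DIM('a))"
  have E: "0 < E" "\<delta> * (E * E) = 1" unfolding E_def \<delta>_def by (simp_all add: exp_add[symmetric] algebra_simps)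
  have a_le': "0 \<le> u t - a * v t" "0 \<le> v t" if "t \<in> ?Q" for t using a_le[OF that] vpos[OF that] by simp_all
  have "Kop c (\<lambda>t. u t - a * v t) s \<le> E * Kop c (\<lambda>t. u t - a * v t) s'"
    unfolding E_def by (rule Kop_ratio[OF dm]) (fact dle a_le'(1) c s(2))+
  then have 1: "U - a * V \<le> E * (U' - a * V')" by (simp add: lin U_def V_def U'_def V'_def)
  have "Kop c v s' \<le> E * Kop c v s"
    unfolding E_def by (rule Kop_ratio[OF mv]) (fact Bv a_le'(2) c s(1))+
  then have 2: "V' \<le> E * V" by (simp add: V_def V'_def)
  have 3: "U \<le> exp D * a * V"
  proof -
    have "Kop c u s \<le> (\<integral>t. exp D * a * (exp (- (c * norm (s - t))) * v t) \<partial>cubeM)"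
      unfolding Kop_def
    proof (rule integral_mono[OF iu])
      fix t :: 'a assume "t \<in> space cubeM"
      then have t: "t \<in> ?Q" by (simp add: space_cubeM)
      show "exp (- (c * norm (s - t))) * u t \<le> exp D * a * (exp (- (c * norm (s - t))) * v t)"
        using mult_left_mono[OF a_ge[OF t], of "exp (- (c * norm (s - t)))"] by (simp add: mult_ac)
    qed (use iv in auto)
    then show ?thesis by (simp add: Kop_def U_def V_def)
  qed
  have V'a: "0 \<le> U' - a * V'"
  proof -
    have "0 \<le> Kop c (\<lambda>t. u t - a * v t) s'"
      unfolding Kop_def using a_le by (intro Bochner_Integration.integral_nonneg) (simp add: space_cubeM)
    then show ?thesis by (simp add: lin U'_def V'_def)
  qed
  have \<delta>: "0 < \<delta>" "\<delta> \<le> 1" unfolding \<delta>_def using c by auto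
  text \<open>The ratio at \<open>s'\<close> dominates a convex combination of \<open>a\<close> and the ratio at \<open>s\<close>.\<close>
  have 4: "\<delta> * (U * V' - a * V * V') \<le> (U' - a * V') * V"
  proof -
    have "(U - a * V) * V' \<le> E * (U' - a * V') * V'" using 1 pos by (intro mult_right_mono) auto
    also have "\<dots> \<le> E * (U' - a * V') * (E * V)" using 2 V'a E by (intro mult_left_mono) auto
    finally have "\<delta> * ((U - a * V) * V') \<le> \<delta> * (E * (U' - a * V') * (E * V))"
      using \<delta> by (intro mult_left_mono) auto
    also have "\<dots> = (\<delta> * (E * E)) * ((U' - a * V') * V)" by (simp only: mult_ac)
    also have "\<dots> = (U' - a * V') * V" using E by simp
    finally show ?thesis by (simp add: left_diff_distrib mult.assoc)
  qed
  \<comment> \<open>Convexity of exp between - D and 0 turns the average \<delta> + (1 - \<delta>)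
    exp (- D) into an oscillation bound in which D is shrunk by 1 - \<delta>.\<close>
  have cvx: "exp (- ((1 - \<delta>) * D)) \<le> \<delta> + (1 - \<delta>) * exp (- D)"
    using convex_onD[OF exp_convex, of "1 - \<delta>" 0 "- D"] \<delta> by simp
  have "exp (- ((1 - \<delta>) * D)) * (U * V') \<le> (\<delta> + (1 - \<delta>) * exp (- D)) * (U * V')"
    using pos by (intro mult_right_mono cvx) simp
  also have "\<dots> = \<delta> * (U * V') + (1 - \<delta>) * (exp (- D) * U) * V'" by (simp add: algebra_simps)
  also have "\<dots> \<le> \<delta> * (U * V') + (1 - \<delta>) * (a * V) * V'"
  proof -
    have "exp (- D) * U \<le> exp (- D) * (exp D * a * V)" by (intro mult_left_mono 3) simp
    also have "\<dots> = a * V" by (simp add: exp_minus field_simps)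
    finally show ?thesis using \<delta> pos by (intro add_left_mono mult_right_mono mult_left_mono) auto
  qed
  also have "\<dots> \<le> U' * V" using 4 by (simp add: algebra_simps)
  finally have "exp ((1 - \<delta>) * D) * (exp (- ((1 - \<delta>) * D)) * (U * V')) \<le> exp ((1 - \<delta>) * D) * (U' * V)"
    by (intro mult_left_mono) auto
  moreover have "exp ((1 - \<delta>) * D) * (exp (- ((1 - \<delta>) * D)) * (U * V')) = U * V'"
    unfolding mult.assoc[symmetric] exp_add[symmetric] by simp
  ultimately show ?thesis unfolding U_def V_def U'_def V'_def by simp
qed

lemma Kop_cong: "(\<And>t. t \<in> cbox 0 One \<Longrightarrow> u t = v t) \<Longrightarrow> Kop c u x = Kop c v x"
  unfolding Kop_def by (intro Bochner_Integration.integral_cong) (simp_all add: space_cubeM)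

lemma Kop_scale: "Kop c (\<lambda>t. k * u t) x = k * Kop c u x"
  unfolding Kop_def by (simp add: mult.left_commute[of _ k])

lemma contraction_factor:
  fixes c :: real assumes "0 \<le> c"
  defines "q \<equiv> 1 - exp (- (2 * c * DIM('a::euclidean_space)))"
  shows "0 \<le> q" "q < 1"
  unfolding q_def using assms by auto

text \<open>Both solutions are fixed by u \<mapsto> 1 / K u on the cube, so repeated contraction
  drives the oscillation of ln u - ln v to 0 and u = k v. The left side of the equation is
  homogeneous of degree two, hence k^2 = 1.\<close>

lemma schrodinger_unique:
  fixes u v :: "'a::euclidean_space \<Rightarrow> real" and c :: real
  assumes u: "pos_bounded u" and v: "pos_bounded v" and c: "0 \<le> c"
    and Ku: "\<And>x. x \<in> cbox 0 One \<Longrightarrow> u x * Kop c u x = 1"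
    and Kv: "\<And>x. x \<in> cbox 0 One \<Longrightarrow> v x * Kop c v x = 1"
    and x: "x \<in> cbox 0 One"
  shows "u x = v x"
proof -
  let ?Q = "cbox 0 (One::'a)"
  define q where "q = 1 - exp (- (2 * c * DIM('a)))"
  have q: "0 \<le> q" "q < 1" unfolding q_def using contraction_factor[OF c] by auto
  have upos: "0 < u t" if "t \<in> ?Q" for t using pos_bounded_pos[OF u that] .
  have vpos: "0 < v t" if "t \<in> ?Q" for t using pos_bounded_pos[OF v that] .
  obtain a1 b1 where 1: "0 < a1" "\<forall>t\<in>?Q. a1 \<le> u t \<and> u t \<le> b1" using u by (auto simp: pos_bounded_def)
  obtain a2 b2 where 2: "0 < a2" "\<forall>t\<in>?Q. a2 \<le> v t \<and> v t \<le> b2" using v by (auto simp: pos_bounded_def)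
  have b: "0 < b1" "0 < b2" using 1 2 zero_in_cube[where 'a='a] by (meson less_le_trans)+
  define D where "D = \<bar>ln (b1 * b2 / (a1 * a2))\<bar>"
  have eD: "b1 * b2 \<le> exp D * (a1 * a2)"
  proof -
    have "b1 * b2 / (a1 * a2) = exp (ln (b1 * b2 / (a1 * a2)))" using 1 2 b by simp
    also have "\<dots> \<le> exp D" unfolding D_def by simp
    finally show ?thesis using 1 2 by (simp add: pos_divide_le_eq)
  qed
  have osc: "u s * v s' \<le> exp (q ^ n * D) * (u s' * v s)" if "s \<in> ?Q" "s' \<in> ?Q" for n s s'
    using that
  proof (induction n arbitrary: s s')
    case 0
    have "u s * v s' \<le> b1 * b2" using 1 2 b 0 vpos[of s'] by (intro mult_mono) (auto intro: less_imp_le)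
    also have "\<dots> \<le> exp D * (a1 * a2)" by (rule eD)
    also have "\<dots> \<le> exp D * (u s' * v s)" using 1 2 0 by (intro mult_left_mono mult_mono) (auto intro: less_imp_le upos)
    finally show ?case by simp
  next
    case (Suc n)
    \<comment> \<open>Passing to reciprocals exchanges the two sides, so the contraction is applied
      with s and s' interchanged.\<close>
    have "Kop c u s' * Kop c v s \<le> exp (q * (q ^ n * D)) * (Kop c u s * Kop c v s')"
      unfolding q_def
      by (rule Kop_contraction[OF u v c]) (use Suc q in \<open>auto simp: D_def q_def\<close>)
    moreover have "Kop c u t = 1 / u t" "Kop c v t = 1 / v t" if "t \<in> ?Q" for t
      using Ku[OF that] Kv[OF that] upos[OF that] vpos[OF that] by (auto simp: field_simps)
    ultimately have "1 / u s' * (1 / v s) \<le> exp (q ^ Suc n * D) * (1 / u s * (1 / v s'))"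
      using Suc.prems by (simp add: mult.assoc)
    then show ?case
      using upos[OF Suc.prems(1)] upos[OF Suc.prems(2)] vpos[OF Suc.prems(1)] vpos[OF Suc.prems(2)]
      by (simp add: field_simps)
  qed
  have le: "u s * v s' \<le> u s' * v s" if "s \<in> ?Q" "s' \<in> ?Q" for s s'
  proof (rule LIMSEQ_le_const)
    have "(\<lambda>n. exp (q ^ n * D) * (u s' * v s)) \<longlonglongrightarrow> exp (0 * D) * (u s' * v s)"
      by (intro tendsto_intros LIMSEQ_realpow_zero q)
    then show "(\<lambda>n. exp (q ^ n * D) * (u s' * v s)) \<longlonglongrightarrow> u s' * v s" by simp
  qed (use osc[OF that] in blast)
  have eq: "u s * v 0 = u 0 * v s" if "s \<in> ?Q" for s
    using le[OF that zero_in_cube] le[OF zero_in_cube that] by (rule antisym)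
  define k where "k = u 0 / v 0"
  have k: "0 < k" unfolding k_def using upos[OF zero_in_cube] vpos[OF zero_in_cube] by simp
  have uk: "u s = k * v s" if "s \<in> ?Q" for s
    using eq[OF that] vpos[OF zero_in_cube] by (simp add: k_def field_simps)
  have "Kop c u x = k * Kop c v x"
    using Kop_cong[of u "\<lambda>t. k * v t"] uk by (simp add: Kop_scale)
  then have "k * k * (v x * Kop c v x) = 1" using Ku[OF x] uk[OF x] by (simp add: mult_ac)
  then have "k * k = 1" using Kv[OF x] by simp
  then have "k = 1" using k by (simp add: square_eq_1_iff)
  then show ?thesis using uk[OF x] by simp
qed

text \<open>The contraction sees functions only up to constant factors. Normalising the iterates at
  the origin turns projective convergence into convergence of \<open>ln (w n s)\<close> by a
  geometric series. The limit makes u * K u constant on the cube, and a rescaling makes that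
  constant 1.\<close>

lemma schrodinger_exists:
  fixes c :: real
  assumes c: "0 \<le> c"
  shows "\<exists>u :: 'a::euclidean_space \<Rightarrow> real. continuous_on UNIV u \<and> (\<forall>x. 0 < u x) \<and> (\<forall>x. u x * Kop c u x = 1)"
proof -
  let ?Q = "cbox 0 (One::'a)"
  define q where "q = 1 - exp (- (2 * c * DIM('a)))"
  have q: "0 \<le> q" "q < 1" unfolding q_def using contraction_factor[OF c] by auto
  define L where "L = c * DIM('a)"
  have L: "0 \<le> L" unfolding L_def using c by simp
  define w :: "nat \<Rightarrow> 'a \<Rightarrow> real" where "w = rec_nat (\<lambda>_. 1) (\<lambda>n f x. Kop c f 0 / Kop c f x)"
  have w0: "w 0 = (\<lambda>_. 1)" and wS: "w (Suc n) = (\<lambda>x. Kop c (w n) 0 / Kop c (w n) x)" for n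
    by (simp_all add: w_def)
  have w_good: "continuous_on UNIV (w n) \<and> (\<forall>x. 0 < w n x)" for n
  proof (induction n)
    case (Suc n)
    then have pb: "pos_bounded (w n)" by (auto intro: pos_bounded_continuous)
    have "0 < Kop c (w n) x" for x by (rule Kop_pos[OF pb c])
    then show ?case unfolding wS using Kop_pos_bounded(1)[OF pb c]
      by (auto intro!: continuous_intros simp: less_imp_neq[THEN not_sym])
  qed (simp add: w0)
  then have pb: "pos_bounded (w n)" for n by (auto intro: pos_bounded_continuous)
  note wm = pos_bounded_measurable[OF pb]
  have wpos: "0 < w n x" for n x using w_good by blast
  have Kpos: "0 < Kop c (w n) x" for n x by (rule Kop_pos[OF pb c])
  have w_zero: "w n 0 = 1" for n
    using Kpos[of _ 0] by (cases n) (auto simp: w0 wS less_imp_neq[THEN not_sym])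
  have ratio: "Kop c (w n) s \<le> exp L * Kop c (w n) s'" if "s' \<in> ?Q" for n s s'
  proof -
    obtain B where "\<And>t. t \<in> ?Q \<Longrightarrow> \<bar>w n t\<bar> \<le> B" using pos_bounded_abs[OF pb] by blast
    from Kop_ratio[OF wm this _ c that] show ?thesis using wpos by (simp add: L_def less_imp_le)
  qed
  have w_le: "w n x \<le> exp L" if "x \<in> ?Q" for n x
    using L ratio[OF that, of _ 0] Kpos[of _ x] by (cases n) (auto simp: w0 wS pos_divide_le_eq)
  have w_ge: "exp (- L) \<le> w n x" if "x \<in> ?Q" for n x
    using L ratio[OF zero_in_cube, of _ x] Kpos[of _ x] by (cases n) (auto simp: w0 wS exp_minus field_simps)
  have osc: "w (Suc n) s * w n s' \<le> exp (q ^ n * (2 * L)) * (w (Suc n) s' * w n s)" if "s \<in> ?Q" "s' \<in> ?Q" for n s s'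
    using that
  proof (induction n arbitrary: s s')
    case 0
    have "w (Suc 0) s \<le> exp L" using 0 w_le by blast
    also have "\<dots> = exp (2 * L) * exp (- L)" by (simp add: exp_add[symmetric])
    also have "\<dots> \<le> exp (2 * L) * w (Suc 0) s'" using w_ge[OF 0(2)] by (intro mult_left_mono) auto
    finally show ?case by (simp add: w0)
  next
    case (Suc n)
    define A B where "A = Kop c (w (Suc n))" and "B = Kop c (w n)"
    define e where "e = exp (q * (q ^ n * (2 * L)))"
    have pos: "0 < A y" "0 < B y" for y unfolding A_def B_def by (rule Kpos)+
    have wA: "w (Suc (Suc n)) y = A 0 / A y" and wB: "w (Suc n) y = B 0 / B y" for y
      by (subst wS, simp add: A_def B_def)+
    have "A s' * B s \<le> e * (A s * B s')"
      unfolding q_def A_def B_def e_def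
      by (rule Kop_contraction[OF pb pb c]) (use Suc q L in \<open>auto simp: q_def\<close>)
    then have "A 0 / A s * (B 0 / B s') \<le> e * (A 0 / A s' * (B 0 / B s))"
      using pos[of s] pos[of s'] pos[of 0] by (simp add: field_simps)
    then show ?case by (simp add: wA wB e_def mult.assoc)
  qed
  have step: "\<bar>ln (w (Suc n) s) - ln (w n s)\<bar> \<le> q ^ n * (2 * L)" if s: "s \<in> ?Q" for n s
  proof -
    have "ln (w (Suc n) s) \<le> ln (exp (q ^ n * (2 * L)) * w n s)"
      using osc[OF s zero_in_cube, of n] wpos by (simp add: w_zero)
    moreover have "ln (w n s) \<le> ln (exp (q ^ n * (2 * L)) * w (Suc n) s)"
      using osc[OF zero_in_cube s, of n] wpos by (simp add: w_zero)
    moreover have "w n s \<noteq> 0" "w (Suc n) s \<noteq> 0" using wpos by (simp_all add: less_imp_neq[THEN not_sym])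
    ultimately show ?thesis by (simp add: ln_mult abs_le_iff)
  qed
  have conv: "convergent (\<lambda>n. ln (w n s))" if s: "s \<in> ?Q" for s
  proof -
    have "summable (\<lambda>n. q ^ n * (2 * L))" using q by (intro summable_mult2 summable_geometric) simp
    then have "summable (\<lambda>n. ln (w (Suc n) s) - ln (w n s))"
      by (rule summable_comparison_test'[where N = 0]) (use step[OF s] in simp)
    moreover have "(\<Sum>i<n. ln (w (Suc i) s) - ln (w i s)) = ln (w n s) - ln (w 0 s)" for n
      by (rule sum_lessThan_telescope)
    ultimately have "convergent (\<lambda>n. ln (w n s) - ln (w 0 s))"
      by (simp only: summable_iff_convergent)
    then show ?thesis by (simp add: w0)
  qed
  define u where "u s = exp (lim (\<lambda>n. ln (w n s)))" for s
  have lim: "(\<lambda>n. w n s) \<longlonglongrightarrow> u s" if "s \<in> ?Q" for s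
  proof -
    have "(\<lambda>n. exp (ln (w n s))) \<longlonglongrightarrow> u s"
      unfolding u_def using conv[OF that] by (intro tendsto_exp) (simp add: convergent_LIMSEQ_iff)
    then show ?thesis using wpos by simp
  qed
  have um: "u \<in> borel_measurable cubeM"
    by (rule borel_measurable_LIMSEQ_real[where u = w]) (simp_all add: space_cubeM lim wm)
  have "exp (- L) \<le> u t \<and> u t \<le> exp L" if t: "t \<in> ?Q" for t
  proof
    show "exp (- L) \<le> u t" by (rule LIMSEQ_le_const[OF lim[OF t]]) (use w_ge[OF t] in blast)
    show "u t \<le> exp L" by (rule LIMSEQ_le_const2[OF lim[OF t]]) (use w_le[OF t] in blast)
  qed
  then have pbu: "pos_bounded u" unfolding pos_bounded_def using um exp_gt_zero by blast
  have Klim: "(\<lambda>n. Kop c (w n) x) \<longlonglongrightarrow> Kop c u x" for x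
    unfolding Kop_def
  proof (rule integral_dominated_convergence[where w = "\<lambda>_. exp L"])
    show "(\<lambda>t. exp (- (c * norm (x - t))) * u t) \<in> borel_measurable cubeM"
      by (intro borel_measurable_times um continuous_cubeM continuous_intros)
    show "(\<lambda>t. exp (- (c * norm (x - t))) * w n t) \<in> borel_measurable cubeM" for n
      by (intro borel_measurable_times wm continuous_cubeM continuous_intros)
    show "AE t in cubeM. (\<lambda>n. exp (- (c * norm (x - t))) * w n t) \<longlonglongrightarrow> exp (- (c * norm (x - t))) * u t"
      by (intro AE_I2 tendsto_mult tendsto_const lim) (simp add: space_cubeM)
    show "AE t in cubeM. norm (exp (- (c * norm (x - t))) * w n t) \<le> exp L" for n
    proof (rule AE_I2)
      fix t :: 'a assume "t \<in> space cubeM"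
      then have "exp (- (c * norm (x - t))) * w n t \<le> 1 * exp L"
        using c wpos[of n t] w_le[of t n] by (intro mult_mono) (auto simp: space_cubeM less_imp_le)
      then show "norm (exp (- (c * norm (x - t))) * w n t) \<le> exp L" using wpos[of n t] by (simp add: abs_mult)
    qed
  qed simp
  have Kupos: "0 < Kop c u x" for x by (rule Kop_pos[OF pbu c])
  have u_eq: "u x = Kop c u 0 / Kop c u x" if "x \<in> ?Q" for x
  proof (rule LIMSEQ_unique)
    show "(\<lambda>n. w (Suc n) x) \<longlonglongrightarrow> u x" using lim[OF that] by (rule LIMSEQ_Suc)
    show "(\<lambda>n. w (Suc n) x) \<longlonglongrightarrow> Kop c u 0 / Kop c u x"
      unfolding wS using Kupos[of x] by (intro tendsto_divide Klim) simp
  qed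
  define r where "r = sqrt (Kop c u 0)"
  have r: "0 < r" "r * r = Kop c u 0" unfolding r_def using Kupos[of 0] by simp_all
  \<comment> \<open>Outside the cube the limit defining \<open>u\<close> is not controlled. The
    quotient r / K u agrees with u / r on the cube, but is continuous and satisfies the equation
    everywhere. The square root appears because both factors of u * K u are divided by r.\<close>
  define U where "U x = r / Kop c u x" for x
  have "U x = (1 / r) * u x" if "x \<in> ?Q" for x
  proof -
    have "u x = r * r / Kop c u x" unfolding r(2) by (rule u_eq[OF that])
    then show ?thesis unfolding U_def using r(1) by simp
  qed
  then have "Kop c U x = (1 / r) * Kop c u x" for x
    using Kop_cong[of U "\<lambda>x. (1 / r) * u x" c x] by (simp only: Kop_scale)
  then have "U x * Kop c U x = 1" for x unfolding U_def using r(1) Kupos[of x] by simp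
  moreover have "continuous_on UNIV U"
    unfolding U_def using Kupos by (intro continuous_intros Kop_pos_bounded(1)[OF pbu c]) (simp add: less_imp_neq[THEN not_sym])
  moreover have "0 < U x" for x unfolding U_def using r(1) Kupos by simp
  ultimately show ?thesis by blast
qed

section \<open>Duality\<close>

lemma nn_integral_cube_scale:
  fixes F :: "'a::euclidean_space \<Rightarrow> ennreal"
  assumes [measurable]: "F \<in> borel_measurable borel" and c: "0 < c"
  shows "(\<integral>\<^sup>+ s\<in>cbox 0 (c *\<^sub>R One). F s \<partial>lborel) = ennreal (c ^ DIM('a)) * (\<integral>\<^sup>+ t. F (c *\<^sub>R t) \<partial>cubeM)"
proof -
  have ind: "indicator (cbox 0 (c *\<^sub>R One)) (0 + c *\<^sub>R t) = (indicator (cbox 0 One) t :: ennreal)" for t :: 'a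
    using c by (simp add: indicator_def mem_box zero_le_mult_iff less_imp_le cong: ball_cong)
  have "(\<integral>\<^sup>+ s\<in>cbox 0 (c *\<^sub>R One). F s \<partial>lborel) =
      (\<integral>\<^sup>+ s. F s * indicator (cbox 0 (c *\<^sub>R One)) s \<partial>density (distr lborel borel (\<lambda>x. 0 + c *\<^sub>R x)) (\<lambda>_. \<bar>c\<bar>^DIM('a)))"
    using lborel_affine[of c "0::'a"] c by simp
  also have "\<dots> = (\<integral>\<^sup>+ t. ennreal (\<bar>c\<bar>^DIM('a)) * (F (0 + c *\<^sub>R t) * indicator (cbox 0 (c *\<^sub>R One)) (0 + c *\<^sub>R t)) \<partial>lborel)"
    by (subst nn_integral_density, simp, simp, subst nn_integral_distr) simp_all
  also have "\<dots> = (\<integral>\<^sup>+ t. ennreal (c^DIM('a)) * (F (c *\<^sub>R t) * indicator (cbox 0 One) t) \<partial>lborel)"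
    unfolding ind using c by simp
  also have "\<dots> = ennreal (c ^ DIM('a)) * (\<integral>\<^sup>+ t. F (c *\<^sub>R t) \<partial>cubeM)"
    unfolding cubeM_def by (subst nn_integral_cmult) (simp_all add: nn_integral_restrict_space)
  finally show ?thesis .
qed

lemma elog_measurable [measurable]: "elog \<in> borel_measurable borel"
  unfolding elog_def[abs_def] by measurable

lemma J_fun_cube:
  fixes f1 f2 :: "'a::euclidean_space \<Rightarrow> real"
  assumes "continuous_on UNIV f1" "continuous_on UNIV f2" and c: "0 < c"
  defines "e \<equiv> \<lambda>t. elog ((f1 (c *\<^sub>R t))\<^sup>2 + (f2 (c *\<^sub>R t))\<^sup>2)"
  shows "J_fun c f1 f2 = ereal (inverse (c ^ DIM('a))) *
    (enn2ereal (ennreal (c ^ DIM('a)) * (\<integral>\<^sup>+ t. e2ennreal (e t) \<partial>cubeM)) -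
     enn2ereal (ennreal (c ^ DIM('a)) * (\<integral>\<^sup>+ t. e2ennreal (- e t) \<partial>cubeM)))"
proof -
  have [measurable]: "f1 \<in> borel_measurable borel" "f2 \<in> borel_measurable borel"
    using assms by (auto intro: borel_measurable_continuous_onI)
  show ?thesis unfolding J_fun_def e_def by (subst (1 2) nn_integral_cube_scale) (use c in auto)
qed

text \<open>The logarithm is - \<infinity> at common zeros, so its integral need not be real. The
  positive and the negative parts are compared separately in the extended range, and only the
  majorant is a real integral.\<close>

lemma J_fun_le:
  fixes f1 f2 :: "'a::euclidean_space \<Rightarrow> real"
  assumes f: "continuous_on UNIV f1" "continuous_on UNIV f2" and c: "0 < c"
    and \<psi>: "integrable cubeM \<psi>"
    and le: "\<And>t. t \<in> cbox 0 One \<Longrightarrow> elog ((f1 (c *\<^sub>R t))\<^sup>2 + (f2 (c *\<^sub>R t))\<^sup>2) \<le> ereal (\<psi> t)"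
  shows "J_fun c f1 f2 \<le> ereal (\<integral>t. \<psi> t \<partial>cubeM)"
proof -
  obtain p n where pn: "0 \<le> p" "0 \<le> n" "(\<integral>\<^sup>+t. ennreal (\<psi> t) \<partial>cubeM) = ennreal p"
    "(\<integral>\<^sup>+t. ennreal (- \<psi> t) \<partial>cubeM) = ennreal n" "(\<integral>t. \<psi> t \<partial>cubeM) = p - n"
    using \<psi> by (rule integrableE)
  define k where "k = c ^ DIM('a)"
  have k: "0 < k" using c by (simp add: k_def)
  define e where "e t = elog ((f1 (c *\<^sub>R t))\<^sup>2 + (f2 (c *\<^sub>R t))\<^sup>2)" for t
  have "(\<integral>\<^sup>+ t. e2ennreal (e t) \<partial>cubeM) \<le> (\<integral>\<^sup>+t. e2ennreal (ereal (\<psi> t)) \<partial>cubeM)"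
    using le by (intro nn_integral_mono e2ennreal_mono) (simp add: space_cubeM e_def)
  then have "ennreal k * (\<integral>\<^sup>+ t. e2ennreal (e t) \<partial>cubeM) \<le> ennreal (k * p)"
    using k pn by (simp add: ennreal_mult mult_left_mono)
  then have P: "enn2ereal (ennreal k * (\<integral>\<^sup>+ t. e2ennreal (e t) \<partial>cubeM)) \<le> ereal (k * p)"
    using k pn by (metis enn2ereal_ennreal less_eq_ennreal.rep_eq mult_nonneg_nonneg less_imp_le)
  have "(\<integral>\<^sup>+t. e2ennreal (- ereal (\<psi> t)) \<partial>cubeM) \<le> (\<integral>\<^sup>+ t. e2ennreal (- e t) \<partial>cubeM)"
    using le by (intro nn_integral_mono e2ennreal_mono) (simp add: space_cubeM e_def del: uminus_ereal.simps)
  then have "ennreal (k * n) \<le> ennreal k * (\<integral>\<^sup>+ t. e2ennreal (- e t) \<partial>cubeM)"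
    using k pn by (simp add: ennreal_mult mult_left_mono)
  then have N: "ereal (k * n) \<le> enn2ereal (ennreal k * (\<integral>\<^sup>+ t. e2ennreal (- e t) \<partial>cubeM))"
    using k pn by (metis enn2ereal_ennreal less_eq_ennreal.rep_eq mult_nonneg_nonneg less_imp_le)
  have "J_fun c f1 f2 \<le> ereal (inverse k) * (ereal (k * p) - ereal (k * n))"
    unfolding J_fun_cube[OF f c] k_def[symmetric] e_def[symmetric]
    using k by (intro ereal_mult_left_mono ereal_minus_mono P N) simp
  also have "\<dots> = ereal (p - n)" using k by (simp add: field_simps)
  finally show ?thesis using pn by simp
qed

lemma J_fun_eq:
  fixes f1 f2 :: "'a::euclidean_space \<Rightarrow> real"
  assumes f: "continuous_on UNIV f1" "continuous_on UNIV f2" and c: "0 < c"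
    and \<psi>: "integrable cubeM \<psi>"
    and eq: "\<And>t. t \<in> cbox 0 One \<Longrightarrow> elog ((f1 (c *\<^sub>R t))\<^sup>2 + (f2 (c *\<^sub>R t))\<^sup>2) = ereal (\<psi> t)"
  shows "J_fun c f1 f2 = ereal (\<integral>t. \<psi> t \<partial>cubeM)"
proof -
  obtain p n where pn: "0 \<le> p" "0 \<le> n" "(\<integral>\<^sup>+t. ennreal (\<psi> t) \<partial>cubeM) = ennreal p"
    "(\<integral>\<^sup>+t. ennreal (- \<psi> t) \<partial>cubeM) = ennreal n" "(\<integral>t. \<psi> t \<partial>cubeM) = p - n"
    using \<psi> by (rule integrableE)
  define k where "k = c ^ DIM('a)"
  have k: "0 < k" using c by (simp add: k_def)
  define e where "e t = elog ((f1 (c *\<^sub>R t))\<^sup>2 + (f2 (c *\<^sub>R t))\<^sup>2)" for t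
  have "(\<integral>\<^sup>+ t. e2ennreal (e t) \<partial>cubeM) = (\<integral>\<^sup>+t. ennreal (\<psi> t) \<partial>cubeM)"
    using eq by (intro nn_integral_cong) (simp add: space_cubeM e_def)
  then have P: "enn2ereal (ennreal k * (\<integral>\<^sup>+ t. e2ennreal (e t) \<partial>cubeM)) = ereal (k * p)"
    using k pn by (simp add: ennreal_mult[symmetric] enn2ereal_ennreal)
  have "(\<integral>\<^sup>+ t. e2ennreal (- e t) \<partial>cubeM) = (\<integral>\<^sup>+t. ennreal (- \<psi> t) \<partial>cubeM)"
    using eq by (intro nn_integral_cong) (simp add: space_cubeM e_def)
  then have N: "enn2ereal (ennreal k * (\<integral>\<^sup>+ t. e2ennreal (- e t) \<partial>cubeM)) = ereal (k * n)"
    using k pn by (simp add: ennreal_mult[symmetric] enn2ereal_ennreal)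
  have "J_fun c f1 f2 = ereal (inverse k) * (ereal (k * p) - ereal (k * n))"
    unfolding J_fun_cube[OF f c] k_def[symmetric] e_def[symmetric] P N ..
  also have "\<dots> = ereal (p - n)" using k by (simp add: field_simps)
  finally show ?thesis using pn by simp
qed

text \<open>On the cube the choice is forced by uniqueness. As \<open>Kop\<close> reads values on
  the cube only, the equation then determines the function everywhere.\<close>

definition schr :: "real \<Rightarrow> 'a::euclidean_space \<Rightarrow> real" where
  "schr c = (SOME u. continuous_on UNIV u \<and> (\<forall>x. 0 < u x) \<and> (\<forall>x. u x * Kop c u x = 1))"

lemma schr:
  fixes c :: real assumes "0 \<le> c"
  shows "continuous_on UNIV (schr c :: 'a::euclidean_space \<Rightarrow> real)" "\<And>x::'a. 0 < schr c x"
    "\<And>x::'a. schr c x * Kop c (schr c) x = 1"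
  using someI_ex[OF schrodinger_exists[OF assms, where 'a='a]] unfolding schr_def[symmetric] by blast+

lemma schr_pos_bounded: "0 \<le> c \<Longrightarrow> pos_bounded (schr c)"
  by (intro pos_bounded_continuous schr)

lemma ln_integrable:
  assumes "pos_bounded u"
  shows "integrable cubeM (\<lambda>t. ln (u t))"
proof (rule pos_boundedE[OF assms])
  fix a b assume a: "0 < a" "a \<le> b" and u: "\<And>t. t \<in> cbox 0 One \<Longrightarrow> a \<le> u t" "\<And>t. t \<in> cbox 0 One \<Longrightarrow> u t \<le> b"
    and [measurable]: "u \<in> borel_measurable cubeM"
  show ?thesis
  proof (rule integrable_cube[where C = "max \<bar>ln a\<bar> \<bar>ln b\<bar>"])
    fix t assume t: "t \<in> cbox 0 (One::'a)"
    have "ln a \<le> ln (u t)" "ln (u t) \<le> ln b" using a u[OF t] by simp_all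
    then show "\<bar>ln (u t)\<bar> \<le> max \<bar>ln a\<bar> \<bar>ln b\<bar>" by linarith
  qed simp
qed

text \<open>The dual functional at its minimiser, where u * K u = 1 reduces the quadratic term to
  1.\<close>

definition dual_value :: "'a::euclidean_space itself \<Rightarrow> real \<Rightarrow> real" where
  "dual_value T c = 1 - 2 * (\<integral>t. ln (schr c t) \<partial>(cubeM :: 'a measure))"

text \<open>The integral of u |f| is not directly a pairing with a member of \<open>rkhs\<close>.
  Writing |f| as the inner product of f with its own direction produces the two charges u f1 / |f|
  and u f2 / |f|. Directions have inner products at most 1 and the kernel is positive, so the two
  energies add up to at most \<langle>u, K u\<rangle> = 1.\<close>

lemma objective_le:
  fixes f1 f2 :: "'a::euclidean_space \<Rightarrow> real"
  assumes f: "continuous_on UNIV f1" "continuous_on UNIV f2" and c: "0 < c"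
  shows "objective c f1 f2 \<le> ereal (ln 2 - 2 + dual_value TYPE('a) c)"
proof -
  have c0: "0 \<le> c" using c by simp
  define g where "g t = (f1 (c *\<^sub>R t))\<^sup>2 + (f2 (c *\<^sub>R t))\<^sup>2" for t
  have f': "continuous_on UNIV (\<lambda>t. f1 (c *\<^sub>R t))" "continuous_on UNIV (\<lambda>t. f2 (c *\<^sub>R t))"
    by (auto intro!: continuous_on_compose2[OF f(1)] continuous_on_compose2[OF f(2)] continuous_intros)
  have g: "continuous_on UNIV g" unfolding g_def by (intro continuous_intros f')
  have g0: "0 \<le> g t" for t by (simp add: g_def)
  have gm: "g \<in> borel_measurable cubeM" by (rule continuous_cubeM[OF g])
  have "compact (g ` cbox 0 One)" using g by (intro compact_continuous_image continuous_on_subset[OF g]) auto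
  then obtain G where G: "\<And>t. t \<in> cbox 0 One \<Longrightarrow> g t \<le> G"
    by (metis bounded_has_Sup(1) compact_imp_bounded imageI empty_iff)
  \<comment> \<open>Finiteness from above excludes \<infinity> - \<infinity> when f1 or f2 lies
    outside \<open>rkhs\<close>.\<close>
  have J_fin: "J_fun c f1 f2 < \<infinity>"
  proof -
    have "J_fun c f1 f2 \<le> ereal (\<integral>t. g t \<partial>cubeM)"
    proof (rule J_fun_le[OF f c])
      show "integrable cubeM g" by (rule integrable_cube[OF gm]) (use g0 G in auto)
      fix t :: 'a
      have "ln (g t) \<le> g t" if "g t \<noteq> 0" using that g0[of t] ln_le_minus_one[of "g t"] by simp
      then show "elog ((f1 (c *\<^sub>R t))\<^sup>2 + (f2 (c *\<^sub>R t))\<^sup>2) \<le> ereal (g t)"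
        unfolding g_def[symmetric] elog_def by simp
    qed
    then show ?thesis by (rule le_less_trans) simp
  qed
  show ?thesis
  proof (cases "f1 \<in> rkhs \<and> f2 \<in> rkhs")
    case False
    have "objective c f1 f2 = - \<infinity>"
      using J_fin False unfolding objective_def I_fun_def
      by (cases "J_fun c f1 f2") auto
    then show ?thesis by simp
  next
    case True
    define u where "u = (schr c :: 'a \<Rightarrow> real)"
    have u: "continuous_on UNIV u" "\<And>x. 0 < u x" "\<And>x. u x * Kop c u x = 1"
      unfolding u_def by (intro schr c0)+
    have pb: "pos_bounded u" unfolding u_def by (rule schr_pos_bounded[OF c0])
    note um = pos_bounded_measurable[OF pb]
    obtain B where B: "\<And>t. t \<in> cbox 0 One \<Longrightarrow> \<bar>u t\<bar> \<le> B" using pos_bounded_abs[OF pb] by blast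
    define v1 v2 where "v1 t = u t * (f1 (c *\<^sub>R t) / sqrt (g t))" and "v2 t = u t * (f2 (c *\<^sub>R t) / sqrt (g t))" for t
    \<comment> \<open>At common zeros of f1 and f2 the quotients are 0 / 0 = 0, so the direction has
      norm 0 there instead of 1.\<close>
    have sq: "(f1 (c *\<^sub>R t) / sqrt (g t))\<^sup>2 + (f2 (c *\<^sub>R t) / sqrt (g t))\<^sup>2 \<le> 1" for t
      using g0[of t] by (cases "g t = 0") (simp_all add: power_divide add_divide_distrib[symmetric] g_def[symmetric])
    have fg: "\<bar>f1 (c *\<^sub>R t) / sqrt (g t)\<bar> \<le> 1" "\<bar>f2 (c *\<^sub>R t) / sqrt (g t)\<bar> \<le> 1" for t
      unfolding abs_square_le_1[symmetric]
      using order_trans[OF _ sq[of t], of "(f1 (c *\<^sub>R t) / sqrt (g t))\<^sup>2"]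
        order_trans[OF _ sq[of t], of "(f2 (c *\<^sub>R t) / sqrt (g t))\<^sup>2"] by simp_all
    have unit: "p * x + q * y \<le> 1" if "p\<^sup>2 + q\<^sup>2 \<le> 1" "x\<^sup>2 + y\<^sup>2 \<le> 1" for p q x y :: real
      using sum_squares_bound[of p x] sum_squares_bound[of q y] that by linarith
    have vB: "\<bar>v1 t\<bar> \<le> B" "\<bar>v2 t\<bar> \<le> B" if "t \<in> cbox 0 One" for t
      using mult_mono[OF B[OF that] fg(1)[of t]] mult_mono[OF B[OF that] fg(2)[of t]] B[OF that]
      unfolding v1_def v2_def abs_mult by auto
    have vm: "v1 \<in> borel_measurable cubeM" "v2 \<in> borel_measurable cubeM"
      unfolding v1_def v2_def
      by (intro borel_measurable_times um borel_measurable_divide continuous_cubeM f' continuous_intros g)+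
    interpret k1: kernel_field cubeM "\<lambda>t. c *\<^sub>R t" v1 "\<bar>c\<bar> * DIM('a)" B
      by (rule kernel_field_cube[OF vm(1) vB(1)])
    interpret k2: kernel_field cubeM "\<lambda>t. c *\<^sub>R t" v2 "\<bar>c\<bar> * DIM('a)" B
      by (rule kernel_field_cube[OF vm(2) vB(2)])
    have E: "k1.energy + k2.energy \<le> 1"
    proof -
      have K: "k1.pot (c *\<^sub>R t) = Kop c v1 t" "k2.pot (c *\<^sub>R t) = Kop c v2 t" for t
        using Kop_eq_pot[OF vm(1) vB(1) c0] Kop_eq_pot[OF vm(2) vB(2) c0] by simp_all
      have Km: "Kop c v1 \<in> borel_measurable cubeM" "Kop c v2 \<in> borel_measurable cubeM"
        using Kop_continuous[OF vm(1) vB(1) c0] Kop_continuous[OF vm(2) vB(2) c0] by (auto intro: continuous_cubeM)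
      have Kb: "\<bar>Kop c v1 t\<bar> \<le> B" "\<bar>Kop c v2 t\<bar> \<le> B" for t
        using k1.pot_le[of "c *\<^sub>R t"] k2.pot_le[of "c *\<^sub>R t"] unfolding K by auto
      have B0: "0 \<le> B" using B[OF zero_in_cube] by linarith
      have i: "integrable cubeM (\<lambda>t. v1 t * Kop c v1 t)" "integrable cubeM (\<lambda>t. v2 t * Kop c v2 t)"
        by (rule integrable_cube[where C = "B * B"];
            auto intro!: borel_measurable_times vm Km mult_mono vB Kb B0 simp: abs_mult)+
      have "k1.energy + k2.energy = (\<integral>t. v1 t * Kop c v1 t + v2 t * Kop c v2 t \<partial>cubeM)"
        unfolding k1.energy_def k2.energy_def K using i by simp
      also have "\<dots> \<le> (\<integral>t. 1 \<partial>(cubeM::'a measure))"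
      proof (rule integral_mono)
        fix t :: 'a assume "t \<in> space cubeM"
        have i1: "integrable cubeM (\<lambda>s. exp (- (c * norm (t - s))) * v1 s)" "integrable cubeM (\<lambda>s. exp (- (c * norm (t - s))) * v2 s)"
          "integrable cubeM (\<lambda>s. exp (- (c * norm (t - s))) * u s)"
          using Kop_integrable[OF vm(1) vB(1) c0, of t] Kop_integrable[OF vm(2) vB(2) c0, of t]
            Kop_integrable[OF um B c0, of t] by simp_all
        have "v1 t * Kop c v1 t + v2 t * Kop c v2 t =
           (\<integral>s. v1 t * (exp (- (c * norm (t - s))) * v1 s) + v2 t * (exp (- (c * norm (t - s))) * v2 s) \<partial>cubeM)"
          unfolding Kop_def using i1 by simp
        also have "\<dots> \<le> (\<integral>s. u t * (exp (- (c * norm (t - s))) * u s) \<partial>cubeM)"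
        proof (rule integral_mono)
          fix s :: 'a
          let ?a = "f1 (c *\<^sub>R t) / sqrt (g t)" and ?b = "f2 (c *\<^sub>R t) / sqrt (g t)"
          let ?x = "f1 (c *\<^sub>R s) / sqrt (g s)" and ?y = "f2 (c *\<^sub>R s) / sqrt (g s)"
          have le1: "?a * ?x + ?b * ?y \<le> 1" by (rule unit[OF sq sq])
          have "(u t * (exp (- (c * norm (t - s))) * u s)) * (?a * ?x + ?b * ?y) \<le> (u t * (exp (- (c * norm (t - s))) * u s)) * 1"
            using u(2)[of t] u(2)[of s] by (intro mult_left_mono le1) (simp add: less_imp_le)
          then show "v1 t * (exp (- (c * norm (t - s))) * v1 s) + v2 t * (exp (- (c * norm (t - s))) * v2 s)
             \<le> u t * (exp (- (c * norm (t - s))) * u s)"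
            unfolding v1_def v2_def by (simp add: distrib_left mult_ac)
        qed (use i1 in auto)
        also have "\<dots> = 1" using u(3)[of t] by (simp add: Kop_def)
        finally show "v1 t * Kop c v1 t + v2 t * Kop c v2 t \<le> 1" .
      qed (use i in auto)
      finally show ?thesis by (simp add: cube.prob_space)
    qed
    define \<psi> where "\<psi> t = sqrt 2 * (v1 t * f1 (c *\<^sub>R t) + v2 t * f2 (c *\<^sub>R t)) + (ln 2 - 2 - 2 * ln (u t))" for t
    note i1 = k1.rkhs_integral_le[OF conjunct1[OF True]] and i2 = k2.rkhs_integral_le[OF conjunct2[OF True]]
    have li: "integrable cubeM (\<lambda>t. ln (u t))" by (rule ln_integrable[OF pb])
    have \<psi>i: "integrable cubeM \<psi>" unfolding \<psi>_def using i1(1) i2(1) li by auto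
    have J: "J_fun c f1 f2 \<le> ereal (\<integral>t. \<psi> t \<partial>cubeM)"
    proof (rule J_fun_le[OF f c \<psi>i])
      fix t :: 'a
      have "ln (g t) \<le> \<psi> t" if "g t \<noteq> 0"
      proof -
        have gp: "0 < g t" using that g0[of t] by simp
        have "v1 t * f1 (c *\<^sub>R t) + v2 t * f2 (c *\<^sub>R t) = u t * (g t / sqrt (g t))"
          unfolding v1_def v2_def by (simp add: g_def power2_eq_square distrib_left add_divide_distrib mult_ac)
        also have "\<dots> = u t * sqrt (g t)" using gp by (simp add: real_div_sqrt)
        finally have v: "\<psi> t = sqrt 2 * (u t * sqrt (g t)) + (ln 2 - 2 - 2 * ln (u t))" unfolding \<psi>_def by simp
        \<comment> \<open>The tangent to the logarithm touches at |f| = sqrt 2 / u, the optimal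
          value.\<close>
        have "ln (sqrt (g t) * u t / sqrt 2) \<le> sqrt (g t) * u t / sqrt 2 - 1"
          using gp u(2)[of t] by (intro ln_le_minus_one) simp
        moreover have "ln (sqrt (g t) * u t / sqrt 2) = ln (g t) / 2 + ln (u t) - ln 2 / 2"
          using gp u(2)[of t] by (simp add: ln_mult ln_div ln_sqrt less_imp_neq[THEN not_sym])
        moreover have "sqrt (g t) * u t / sqrt 2 = sqrt 2 * (u t * sqrt (g t)) / 2"
          by (simp add: real_div_sqrt field_simps)
        ultimately show ?thesis unfolding v by linarith
      qed
      then show "elog ((f1 (c *\<^sub>R t))\<^sup>2 + (f2 (c *\<^sub>R t))\<^sup>2) \<le> ereal (\<psi> t)"
        unfolding g_def[symmetric] elog_def by simp
    qed
    \<comment> \<open>Completing the square trades each pairing for the penalty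
      \<open>I_fun\<close>, half a squared norm, plus an energy; the two energies together cost at
      most 1.\<close>
    have amgm: "sqrt 2 * (a * sqrt e) \<le> a\<^sup>2 / 2 + e" if "0 \<le> e" for a e :: real
    proof -
      have "0 \<le> (a / sqrt 2 - sqrt e)\<^sup>2" by simp
      also have "\<dots> = a\<^sup>2 / 2 + e - 2 * (a / sqrt 2) * sqrt e" using that by (simp add: power2_diff power_divide)
      also have "2 * (a / sqrt 2) = sqrt 2 * a" by (simp add: real_div_sqrt field_simps)
      finally show ?thesis by simp
    qed
    have "(\<integral>t. \<psi> t \<partial>cubeM) = sqrt 2 * ((\<integral>t. v1 t * f1 (c *\<^sub>R t) \<partial>cubeM) + (\<integral>t. v2 t * f2 (c *\<^sub>R t) \<partial>cubeM)) +
       (ln 2 - 2 - 2 * (\<integral>t. ln (u t) \<partial>cubeM))"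
      unfolding \<psi>_def using i1(1) i2(1) li by (simp add: cube.prob_space)
    also have "\<dots> \<le> sqrt 2 * (rkhs_norm f1 * sqrt k1.energy + rkhs_norm f2 * sqrt k2.energy) +
       (ln 2 - 2 - 2 * (\<integral>t. ln (u t) \<partial>cubeM))"
      by (intro add_right_mono mult_left_mono add_mono i1(2) i2(2)) simp
    also have "\<dots> \<le> ((rkhs_norm f1)\<^sup>2 / 2 + k1.energy) + ((rkhs_norm f2)\<^sup>2 / 2 + k2.energy) +
       (ln 2 - 2 - 2 * (\<integral>t. ln (u t) \<partial>cubeM))"
      using amgm[OF k1.energy_nonneg, of "rkhs_norm f1"] amgm[OF k2.energy_nonneg, of "rkhs_norm f2"]
      by (simp add: distrib_left)
    also have "\<dots> \<le> (rkhs_norm f1)\<^sup>2 / 2 + (rkhs_norm f2)\<^sup>2 / 2 + (ln 2 - 2 + dual_value TYPE('a) c)"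
      using E by (simp add: dual_value_def u_def)
    finally have *: "(\<integral>t. \<psi> t \<partial>cubeM) - (rkhs_norm f1)\<^sup>2 / 2 - (rkhs_norm f2)\<^sup>2 / 2 \<le> ln 2 - 2 + dual_value TYPE('a) c"
      by linarith
    have "objective c f1 f2 \<le> ereal (\<integral>t. \<psi> t \<partial>cubeM) - ereal ((rkhs_norm f1)\<^sup>2 / 2) - ereal ((rkhs_norm f2)\<^sup>2 / 2)"
    proof -
      have "I_fun f1 = ereal ((rkhs_norm f1)\<^sup>2 / 2)" "I_fun f2 = ereal ((rkhs_norm f2)\<^sup>2 / 2)"
        using True by (simp_all add: I_fun_def)
      then show ?thesis unfolding objective_def by (simp only:) (intro ereal_minus_mono J order_refl)
    qed
    also have "\<dots> \<le> ereal (ln 2 - 2 + dual_value TYPE('a) c)" using * by simp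
    finally show ?thesis .
  qed
qed

text \<open>A constant direction of (f1, f2) gives equality in the estimate for directions, so
  everything can be put into the first component. It is the potential of the charge sqrt 2 u with
  value sqrt 2 / u t at c t, and its energy 2 makes \<open>I_fun\<close> equal to 1.\<close>

lemma objective_attained:
  fixes c :: real
  assumes c: "0 < c"
  obtains f1 f2 :: "'a::euclidean_space \<Rightarrow> real"
  where "continuous_on UNIV f1" "continuous_on UNIV f2" "objective c f1 f2 = ereal (ln 2 - 2 + dual_value TYPE('a) c)"
proof -
  have c0: "0 \<le> c" using c by simp
  define u where "u = (schr c :: 'a \<Rightarrow> real)"
  have u: "continuous_on UNIV u" "\<And>x. 0 < u x" "\<And>x. u x * Kop c u x = 1"
    unfolding u_def by (intro schr c0)+
  have pb: "pos_bounded u" unfolding u_def by (rule schr_pos_bounded[OF c0])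
  define v where "v t = sqrt 2 * u t" for t
  have pbv: "pos_bounded v" unfolding v_def by (intro pos_bounded_continuous continuous_intros u) (simp add: u)
  obtain B where B: "\<And>t. t \<in> cbox 0 One \<Longrightarrow> \<bar>v t\<bar> \<le> B" using pos_bounded_abs[OF pbv] by blast
  note vm = pos_bounded_measurable[OF pbv]
  interpret k: kernel_field cubeM "\<lambda>t. c *\<^sub>R t" v "\<bar>c\<bar> * DIM('a)" B
    by (rule kernel_field_cube[OF vm B])
  have pot: "k.pot (c *\<^sub>R t) = sqrt 2 / u t" for t
  proof -
    have "k.pot (c *\<^sub>R t) = sqrt 2 * Kop c u t"
      using Kop_eq_pot[OF vm B c0, of t] Kop_scale[of c "sqrt 2" u t] by (simp add: v_def[abs_def])
    moreover have "Kop c u t = 1 / u t" using u(3)[of t] u(2)[of t] by (simp add: field_simps)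
    ultimately show ?thesis by simp
  qed
  have "k.energy = (\<integral>t. 2 \<partial>(cubeM :: 'a measure))"
    unfolding k.energy_def pot v_def using u(2) by (intro Bochner_Integration.integral_cong refl) (simp add: less_imp_neq[THEN not_sym])
  then have "k.energy = 2" by (simp add: cube.prob_space)
  then have I1: "I_fun k.pot = ereal 1" unfolding I_fun_def using k.pot_rkhs k.rkhs_norm_pot by simp
  have I2: "I_fun (\<lambda>_::'a. 0) = ereal 0" by (simp add: I_fun_def zero_in_rkhs rkhs_norm_zero)
  have li: "integrable cubeM (\<lambda>t. ln (u t))" by (rule ln_integrable[OF pb])
  have J: "J_fun c k.pot (\<lambda>_. 0) = ereal (\<integral>t. ln 2 - 2 * ln (u t) \<partial>cubeM)"
  proof (rule J_fun_eq[OF k.pot_continuous _ c])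
    show "integrable cubeM (\<lambda>t. ln 2 - 2 * ln (u t))" using li by simp
    fix t :: 'a
    have "ln ((sqrt 2 / u t)\<^sup>2) = ln 2 - 2 * ln (u t)" using u(2)[of t] by (simp add: power_divide ln_div ln_realpow)
    then show "elog ((k.pot (c *\<^sub>R t))\<^sup>2 + 0\<^sup>2) = ereal (ln 2 - 2 * ln (u t))"
      unfolding pot elog_def using u(2)[of t] by simp
  qed (rule continuous_on_const)
  have "objective c k.pot (\<lambda>_. 0) = ereal (ln 2 - 2 + dual_value TYPE('a) c)"
    unfolding objective_def J I1 I2 using li by (simp add: dual_value_def u_def[symmetric] cube.prob_space)
  then show thesis by (rule that[OF k.pot_continuous continuous_on_const])
qed

lemma V_G_ereal_eq:
  fixes c :: real
  assumes c: "0 < c"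
  shows "V_G_ereal TYPE('a::euclidean_space) c = ereal (ln 2 - 2 + dual_value TYPE('a) c)"
proof (rule antisym)
  show "V_G_ereal TYPE('a) c \<le> ereal (ln 2 - 2 + dual_value TYPE('a) c)"
    unfolding V_G_ereal_def by (rule SUP_least) (auto intro: objective_le[OF _ _ c])
  obtain f1 f2 :: "'a \<Rightarrow> real" where f: "continuous_on UNIV f1" "continuous_on UNIV f2"
    "objective c f1 f2 = ereal (ln 2 - 2 + dual_value TYPE('a) c)" by (rule objective_attained[OF c])
  show "ereal (ln 2 - 2 + dual_value TYPE('a) c) \<le> V_G_ereal TYPE('a) c"
    unfolding V_G_ereal_def f(3)[symmetric] by (rule SUP_upper2[of "(f1, f2)"]) (use f in auto)
qed

lemma V_G_eq: "0 < c \<Longrightarrow> V_G TYPE('a::euclidean_space) c = ln 2 - 2 + dual_value TYPE('a) c"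
  by (simp add: V_G_def V_G_ereal_eq)

section \<open>Dependence on the side length\<close>

lemma id_cubeM: "(\<lambda>x. x) \<in> borel_measurable cubeM"
  by (rule continuous_cubeM) simp

lemma cube_swap:
  fixes f :: "'a::euclidean_space \<Rightarrow> 'a \<Rightarrow> real"
  assumes "case_prod f \<in> borel_measurable (cubeM \<Otimes>\<^sub>M cubeM)"
    and b: "\<And>s t. s \<in> cbox 0 One \<Longrightarrow> t \<in> cbox 0 One \<Longrightarrow> \<bar>f s t\<bar> \<le> C"
  shows "(\<integral>t. \<integral>s. f s t \<partial>cubeM \<partial>cubeM) = (\<integral>s. \<integral>t. f s t \<partial>cubeM \<partial>cubeM)"
proof -
  interpret P: pair_prob_space "cubeM :: 'a measure" "cubeM :: 'a measure" ..
  have "integrable (cubeM \<Otimes>\<^sub>M cubeM) (case_prod f)"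
    by (rule P.P.integrable_const_bound[of _ C]) (use assms in \<open>auto simp: space_pair_measure space_cubeM\<close>)
  then show ?thesis by (rule P.Fubini_integral)
qed

lemma Kop_symmetric:
  fixes g h :: "'a::euclidean_space \<Rightarrow> real"
  assumes [measurable]: "g \<in> borel_measurable cubeM" "h \<in> borel_measurable cubeM"
    and b: "\<And>t. t \<in> cbox 0 One \<Longrightarrow> \<bar>g t\<bar> \<le> G" "\<And>t. t \<in> cbox 0 One \<Longrightarrow> \<bar>h t\<bar> \<le> H"
    and c: "0 \<le> c"
  shows "(\<integral>s. g s * Kop c h s \<partial>cubeM) = (\<integral>s. h s * Kop c g s \<partial>cubeM)"
proof -
  note id_cubeM [measurable]
  have "(\<integral>s. \<integral>t. g s * (exp (- (c * norm (s - t))) * h t) \<partial>cubeM \<partial>cubeM) =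
    (\<integral>t. \<integral>s. g s * (exp (- (c * norm (s - t))) * h t) \<partial>cubeM \<partial>cubeM)"
  proof (rule cube_swap[symmetric])
    show "(\<lambda>(s, t). g s * (exp (- (c * norm (s - t))) * h t)) \<in> borel_measurable (cubeM \<Otimes>\<^sub>M cubeM)"
      by measurable
    fix s t :: 'a assume st: "s \<in> cbox 0 One" "t \<in> cbox 0 One"
    have e: "exp (- (c * norm (s - t))) \<le> 1" using c by simp
    have "\<bar>g s\<bar> * (exp (- (c * norm (s - t))) * \<bar>h t\<bar>) \<le> G * (1 * H)"
      using b(1)[OF st(1)] b(2)[OF st(2)] e by (intro mult_mono) auto
    then show "\<bar>g s * (exp (- (c * norm (s - t))) * h t)\<bar> \<le> G * (1 * H)" by (simp add: abs_mult)
  qed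
  also have "\<dots> = (\<integral>t. \<integral>s. h t * (exp (- (c * norm (t - s))) * g s) \<partial>cubeM \<partial>cubeM)"
    by (simp add: norm_minus_commute mult_ac)
  finally show ?thesis by (simp add: Kop_def)
qed

text \<open>Minus the c-derivative of \<open>Kop c u x\<close> at fixed u.\<close>

definition Dop :: "real \<Rightarrow> ('a::euclidean_space \<Rightarrow> real) \<Rightarrow> 'a \<Rightarrow> real" where
  "Dop c u x = (\<integral>t. norm (x - t) * (exp (- (c * norm (x - t))) * u t) \<partial>cubeM)"

lemma Dop_facts:
  fixes u :: "'a::euclidean_space \<Rightarrow> real" and B c :: real
  assumes u[measurable]: "u \<in> borel_measurable cubeM" and B: "\<forall>t\<in>cbox 0 One. \<bar>u t\<bar> \<le> B" and c: "0 \<le> c"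
  shows "Dop c u \<in> borel_measurable cubeM"
    "s \<in> cbox 0 One \<Longrightarrow> integrable cubeM (\<lambda>t. norm (s - t) * (exp (- (c * norm (s - t))) * u t))"
    "s \<in> cbox 0 One \<Longrightarrow> \<bar>Dop c u s\<bar> \<le> DIM('a) * B"
proof -
  note id_cubeM [measurable]
  show "Dop c u \<in> borel_measurable cubeM"
    unfolding Dop_def[abs_def] by (rule cube.borel_measurable_lebesgue_integral) measurable
  have le: "\<bar>norm (s - t) * (exp (- (c * norm (s - t))) * u t)\<bar> \<le> DIM('a) * B"
    if st: "s \<in> cbox 0 One" "t \<in> cbox 0 One" for s t :: 'a
  proof -
    have "norm (s - t) * (exp (- (c * norm (s - t))) * \<bar>u t\<bar>) \<le> DIM('a) * (1 * B)"
      using norm_cube_diff[OF st] bspec[OF B st(2)] c by (intro mult_mono) auto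
    then show ?thesis by (simp add: abs_mult)
  qed
  show i: "integrable cubeM (\<lambda>t. norm (s - t) * (exp (- (c * norm (s - t))) * u t))" if "s \<in> cbox 0 One" for s
    by (rule integrable_cube[OF _ le[OF that]]) (intro borel_measurable_times u continuous_cubeM continuous_intros)
  show "\<bar>Dop c u s\<bar> \<le> DIM('a) * B" if "s \<in> cbox 0 One" for s
  proof -
    have "\<bar>Dop c u s\<bar> \<le> (\<integral>t. \<bar>norm (s - t) * (exp (- (c * norm (s - t))) * u t)\<bar> \<partial>cubeM)"
      unfolding Dop_def by (rule integral_abs_bound)
    also have "\<dots> \<le> (\<integral>t. DIM('a) * B \<partial>(cubeM :: 'a measure))"
      by (rule integral_mono) (use i[OF that] le[OF that] in \<open>auto simp: space_cubeM\<close>)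
    finally show ?thesis by (simp add: cube.prob_space)
  qed
qed

text \<open>By the envelope principle only the explicit dependence on c counts at a minimiser of the
  dual functional, so u is not differentiated.\<close>

definition slope :: "'a::euclidean_space itself \<Rightarrow> real \<Rightarrow> real" where
  "slope T c = (\<integral>s. schr c s * Dop c (schr c) s \<partial>(cubeM :: 'a measure))"

text \<open>The density \<open>v s * v t * exp (- c' * norm (s - t))\<close> is compared with the coupling \<open>schr c s * schr c t * exp (- c * norm (s - t))\<close>
  of the uniform distribution with itself through \<open>1 + x \<le> exp x\<close>.\<close>

lemma dual_comparison:
  fixes v :: "'a::euclidean_space \<Rightarrow> real"
  assumes c: "0 \<le> c" and c': "0 \<le> c'" and v: "pos_bounded v"
  shows "dual_value TYPE('a) c - (c' - c) * slope TYPE('a) c \<le>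
    (\<integral>s. v s * Kop c' v s \<partial>cubeM) - 2 * (\<integral>t. ln (v t) \<partial>cubeM)"
proof -
  define u where "u = (schr c :: 'a \<Rightarrow> real)"
  have u: "continuous_on UNIV u" "\<And>x. 0 < u x" "\<And>x. u x * Kop c u x = 1"
    unfolding u_def by (intro schr c)+
  have pu: "pos_bounded u" unfolding u_def by (rule schr_pos_bounded[OF c])
  define l where "l t = ln (v t) - ln (u t)" for t
  have vpos: "0 < v t" if "t \<in> cbox 0 One" for t using pos_bounded_pos[OF v that] .
  note um[measurable] = pos_bounded_measurable[OF pu] and vm[measurable] = pos_bounded_measurable[OF v]
  have lm[measurable]: "l \<in> borel_measurable cubeM" unfolding l_def by measurable
  have li: "integrable cubeM (\<lambda>t. ln (u t))" "integrable cubeM (\<lambda>t. ln (v t))" by (rule ln_integrable pu v)+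
  obtain Bu where Bu: "\<And>t. t \<in> cbox 0 One \<Longrightarrow> \<bar>u t\<bar> \<le> Bu" using pos_bounded_abs[OF pu] by blast
  obtain Bv where Bv: "\<And>t. t \<in> cbox 0 One \<Longrightarrow> \<bar>v t\<bar> \<le> Bv" using pos_bounded_abs[OF v] by blast
  obtain Bl where Bl: "\<And>t. t \<in> cbox 0 One \<Longrightarrow> \<bar>l t\<bar> \<le> Bl"
  proof -
    obtain a1 b1 where 1: "0 < a1" "\<forall>t\<in>cbox 0 One. a1 \<le> u t \<and> u t \<le> b1" using pu by (auto simp: pos_bounded_def)
    obtain a2 b2 where 2: "0 < a2" "\<forall>t\<in>cbox 0 One. a2 \<le> v t \<and> v t \<le> b2" using v by (auto simp: pos_bounded_def)
    have "\<bar>l t\<bar> \<le> \<bar>ln a1\<bar> + \<bar>ln b1\<bar> + \<bar>ln a2\<bar> + \<bar>ln b2\<bar>" if t: "t \<in> cbox 0 One" for t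
    proof -
      have "0 < b1" "0 < b2" using 1 2 t by (meson less_le_trans)+
      then have "ln a1 \<le> ln (u t)" "ln (u t) \<le> ln b1" "ln a2 \<le> ln (v t)" "ln (v t) \<le> ln b2"
        using 1 2 t u(2)[of t] vpos[OF t] by simp_all
      then show ?thesis unfolding l_def by linarith
    qed
    then show thesis by (rule that)
  qed
  have B0: "0 \<le> Bu" "0 \<le> Bl" "0 \<le> Bv" using Bu[OF zero_in_cube] Bl[OF zero_in_cube] Bv[OF zero_in_cube] by linarith+
  have ulm: "(\<lambda>t. u t * l t) \<in> borel_measurable cubeM" by measurable
  have ulb: "\<bar>u t * l t\<bar> \<le> Bu * Bl" if "t \<in> cbox 0 One" for t
    using mult_mono[OF Bu[OF that] Bl[OF that]] B0 by (simp add: abs_mult)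
  have Kulm: "Kop c (\<lambda>t. u t * l t) \<in> borel_measurable cubeM"
    by (rule continuous_cubeM[OF Kop_continuous[OF ulm ulb c]])
  have Kvm: "Kop c' v \<in> borel_measurable cubeM"
    by (rule continuous_cubeM[OF Kop_continuous[OF vm Bv c']])
  have "\<forall>t\<in>cbox 0 One. \<bar>u t\<bar> \<le> Bu" using Bu by blast
  note D = Dop_facts[OF um this c]
  have Kb: "\<bar>Kop c g x\<bar> \<le> B" if g: "g \<in> borel_measurable cubeM" "\<And>t. t \<in> cbox 0 One \<Longrightarrow> \<bar>g t\<bar> \<le> B" and c: "0 \<le> c"
    for c x B and g :: "'a \<Rightarrow> real"
  proof -
    interpret kernel_field cubeM "\<lambda>t. c *\<^sub>R t" g "\<bar>c\<bar> * DIM('a)" B by (rule kernel_field_cube[OF g])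
    show ?thesis using pot_le[of "c *\<^sub>R x"] Kop_eq_pot[OF that] by simp
  qed
  have point: "(1 + l s) + u s * Kop c (\<lambda>t. u t * l t) s - (c' - c) * (u s * Dop c u s) \<le> v s * Kop c' v s"
    if s: "s \<in> cbox 0 One" for s
  proof -
    have i: "integrable cubeM (\<lambda>t. exp (- (c * norm (s - t))) * u t)"
      "integrable cubeM (\<lambda>t. exp (- (c * norm (s - t))) * (u t * l t))"
      "integrable cubeM (\<lambda>t. exp (- (c' * norm (s - t))) * v t)"
      using Kop_integrable[OF um Bu c, of s] Kop_integrable[OF ulm ulb c, of s] Kop_integrable[OF vm Bv c', of s] by simp_all
    let ?I = "\<lambda>t. (u s * (1 + l s)) * (exp (- (c * norm (s - t))) * u t) + u s * (exp (- (c * norm (s - t))) * (u t * l t))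
       - (c' - c) * u s * (norm (s - t) * (exp (- (c * norm (s - t))) * u t))"
    have "(u s * (1 + l s)) * Kop c u s = (1 + l s) * (u s * Kop c u s)" by (simp only: mult_ac)
    then have "1 + l s = (u s * (1 + l s)) * Kop c u s" unfolding u(3) by simp
    moreover have "(\<integral>t. ?I t \<partial>cubeM) =
        (u s * (1 + l s)) * Kop c u s + u s * Kop c (\<lambda>t. u t * l t) s - (c' - c) * u s * Dop c u s"
      unfolding Dop_def Kop_def using i D(2)[OF s] by simp
    ultimately have "(1 + l s) + u s * Kop c (\<lambda>t. u t * l t) s - (c' - c) * (u s * Dop c u s) = (\<integral>t. ?I t \<partial>cubeM)"
      by simp
    also have "\<dots> \<le> (\<integral>t. v s * (exp (- (c' * norm (s - t))) * v t) \<partial>cubeM)"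
    proof (rule integral_mono)
      fix t :: 'a assume "t \<in> space cubeM"
      then have t: "t \<in> cbox 0 One" by (simp add: space_cubeM)
      \<comment> \<open>\<open>x\<close> is the logarithm of the density for v and c' relative to
        the coupling density \<open>p\<close>, so that p * exp x is the target integrand.\<close>
      define x where "x = l s + l t - (c' - c) * norm (s - t)"
      define p where "p = u s * (exp (- (c * norm (s - t))) * u t)"
      have "?I t = p * (1 + x)" unfolding p_def x_def by (simp add: algebra_simps)
      also have "\<dots> \<le> p * exp x"
        using u(2)[of s] u(2)[of t] by (intro mult_left_mono exp_ge_add_one_self) (simp add: p_def)
      also have "p * exp x = (u s * exp (l s)) * (u t * exp (l t)) * exp (- (c * norm (s - t)) + - ((c' - c) * norm (s - t)))"
        unfolding p_def x_def by (simp add: exp_add exp_diff exp_minus field_simps)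
      also have "u s * exp (l s) = v s" unfolding l_def using u(2)[of s] vpos[OF s] by (simp add: exp_diff)
      also have "u t * exp (l t) = v t" unfolding l_def using u(2)[of t] vpos[OF t] by (simp add: exp_diff)
      also have "- (c * norm (s - t)) + - ((c' - c) * norm (s - t)) = - (c' * norm (s - t))" by (simp add: algebra_simps)
      finally show "?I t \<le> v s * (exp (- (c' * norm (s - t))) * v t)" by (simp add: mult_ac)
    qed (use i D(2)[OF s] in simp_all)
    finally show ?thesis by (simp add: Kop_def)
  qed
  have iul: "integrable cubeM l" unfolding l_def using li by simp
  have iK: "integrable cubeM (\<lambda>s. u s * Kop c (\<lambda>t. u t * l t) s)"
    by (rule integrable_cube[where C = "Bu * (Bu * Bl)"])
       (auto intro!: borel_measurable_times um Kulm mult_mono Bu Kb[OF ulm ulb c] B0 simp: abs_mult)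
  have iD: "integrable cubeM (\<lambda>s. u s * Dop c u s)"
    by (rule integrable_cube[where C = "Bu * (DIM('a) * Bu)"])
       (auto intro!: borel_measurable_times um D mult_mono Bu B0 simp: abs_mult)
  have iv: "integrable cubeM (\<lambda>s. v s * Kop c' v s)"
    by (rule integrable_cube[where C = "Bv * Bv"])
       (auto intro!: borel_measurable_times vm Kvm mult_mono Bv Kb[OF vm Bv c'] B0 simp: abs_mult)
  \<comment> \<open>Both marginals of the coupling are uniform: moving the symmetric operator onto u
    produces the factor u * K u = 1 again.\<close>
  have "(\<integral>s. u s * Kop c (\<lambda>t. u t * l t) s \<partial>cubeM) = (\<integral>s. (u s * l s) * Kop c u s \<partial>cubeM)"
    by (rule Kop_symmetric[OF um ulm Bu ulb c])
  also have "\<dots> = (\<integral>s. l s * (u s * Kop c u s) \<partial>cubeM)" by (simp add: mult_ac)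
  also have "\<dots> = (\<integral>s. l s \<partial>cubeM)" by (simp add: u(3))
  finally have sw: "(\<integral>s. u s * Kop c (\<lambda>t. u t * l t) s \<partial>cubeM) = (\<integral>s. l s \<partial>cubeM)" .
  have "1 + 2 * (\<integral>s. l s \<partial>cubeM) - (c' - c) * slope TYPE('a) c =
     (\<integral>s. (1 + l s) + u s * Kop c (\<lambda>t. u t * l t) s - (c' - c) * (u s * Dop c u s) \<partial>cubeM)"
    using iul iK iD sw by (simp add: slope_def u_def[symmetric] cube.prob_space)
  also have "\<dots> \<le> (\<integral>s. v s * Kop c' v s \<partial>cubeM)"
    by (rule integral_mono) (use iul iK iD iv point in \<open>auto simp: space_cubeM\<close>)
  finally show ?thesis
    unfolding dual_value_def u_def[symmetric] using li by (simp add: l_def)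
qed

lemma dual_support:
  assumes c: "0 \<le> c" and c': "0 \<le> c'"
  shows "dual_value TYPE('a::euclidean_space) c - (c' - c) * slope TYPE('a) c \<le> dual_value TYPE('a) c'"
proof -
  have "(\<integral>s. schr c' s * Kop c' (schr c') s \<partial>(cubeM :: 'a measure)) = 1"
    by (simp add: schr(3)[OF c'] cube.prob_space)
  then show ?thesis using dual_comparison[OF c c' schr_pos_bounded[OF c', where 'a='a]] by (simp add: dual_value_def)
qed

lemma slope_nonneg: "0 \<le> c \<Longrightarrow> 0 \<le> slope TYPE('a::euclidean_space) c"
  unfolding slope_def Dop_def
  by (intro Bochner_Integration.integral_nonneg mult_nonneg_nonneg) (auto simp: schr(2) less_imp_le)

lemma schr_zero: "schr 0 (x :: 'a::euclidean_space) = 1"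
proof -
  let ?u = "schr 0 :: 'a \<Rightarrow> real"
  define k where "k = (\<integral>t. ?u t \<partial>cubeM)"
  have e: "?u x * k = 1" for x using schr(3)[of 0 x] by (simp add: Kop_def k_def)
  have k: "0 < k" using e[of 0] schr(2)[of 0 0] by (metis order_refl zero_less_mult_pos zero_less_one)
  then have u: "?u x = 1 / k" for x using e[of x] by (simp add: field_simps)
  have "k = (\<integral>t. ?u t \<partial>cubeM)" by (rule k_def)
  also have "\<dots> = (\<integral>t. 1 / k \<partial>(cubeM :: 'a measure))" by (simp only: u)
  finally have "k * k = 1" using k by (simp add: cube.prob_space field_simps)
  then show ?thesis using u k by (simp add: square_eq_1_iff)
qed

lemma dual_value_zero: "dual_value TYPE('a::euclidean_space) 0 = 1"
  by (simp add: dual_value_def schr_zero)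

lemma slope_zero: "slope TYPE('a::euclidean_space) 0 = (\<integral>s. \<integral>t. norm (s - t) \<partial>cubeM \<partial>(cubeM :: 'a measure))"
  by (simp add: slope_def Dop_def schr_zero)

section \<open>Trial functions and growth bounds\<close>

lemma pos_bounded_const: "0 < a \<Longrightarrow> pos_bounded (\<lambda>_. a)"
  by (rule pos_bounded_continuous) auto

text \<open>Constants suffice as trial functions: a = c^(d/2) gives the right order at infinity, and
  a = 1, the exact solution at c = 0, gives the expansion at 0.\<close>

lemma dual_le_const:
  assumes c: "0 \<le> c" and a: "0 < a"
  shows "dual_value TYPE('a::euclidean_space) c \<le> a\<^sup>2 * (\<integral>s. Kop c (\<lambda>_. 1) s \<partial>(cubeM :: 'a measure)) - 2 * ln a"
proof -
  have "Kop c (\<lambda>_. a) s = a * Kop c (\<lambda>_. 1) s" for s :: 'a using Kop_scale[of c a "\<lambda>_. 1" s] by simp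
  then show ?thesis using dual_comparison[OF c c pos_bounded_const[OF a], where 'a='a]
    by (simp add: cube.prob_space power2_eq_square mult_ac)
qed

lemma nn_integral_exp_half_line:
  assumes k: "0 < k"
  shows "(\<integral>\<^sup>+x. ennreal (exp (- (k * (x - a)))) * indicator {a..} x \<partial>lborel) = ennreal (1 / k)"
proof -
  have "(\<integral>\<^sup>+x. ennreal (exp (- (k * (x - a)))) * indicator {a..} x \<partial>lborel) =
     ennreal (0 - (- exp (- (k * (a - a))) / k))"
  proof (rule nn_integral_FTC_atLeast[where F = "\<lambda>x. - exp (- (k * (x - a))) / k"])
    show "((\<lambda>x. - exp (- (k * (x - a))) / k) \<longlongrightarrow> 0) at_top"
      using k by real_asymp
  qed (use k in \<open>auto intro!: derivative_eq_intros\<close>)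
  then show ?thesis by simp
qed

lemma nn_integral_exp_abs_le:
  assumes k: "0 < k"
  shows "(\<integral>\<^sup>+x. ennreal (exp (- (k * \<bar>x - a\<bar>))) \<partial>lborel) \<le> ennreal (2 / k)"
proof -
  define E where "E a x = ennreal (exp (- (k * (x - a)))) * indicator {a..} x" for a x :: real
  have [measurable]: "E a \<in> borel_measurable borel" for a unfolding E_def by measurable
  have E: "(\<integral>\<^sup>+x. E a x \<partial>lborel) = ennreal (1 / k)" for a
    unfolding E_def by (rule nn_integral_exp_half_line[OF k])
  have "(\<integral>\<^sup>+x. ennreal (exp (- (k * \<bar>x - a\<bar>))) \<partial>lborel) \<le> (\<integral>\<^sup>+x. E a x + E (- a) (0 + (-1) * x) \<partial>lborel)"
    by (intro nn_integral_mono) (auto simp: indicator_def E_def)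
  also have "\<dots> = (\<integral>\<^sup>+x. E a x \<partial>lborel) + (\<integral>\<^sup>+x. E (- a) (0 + (-1) * x) \<partial>lborel)"
    by (rule nn_integral_add) measurable
  also have "(\<integral>\<^sup>+x. E (- a) (0 + (-1) * x) \<partial>lborel) = (\<integral>\<^sup>+x. E (- a) x \<partial>lborel)"
    by (subst nn_integral_real_affine[where c = "-1" and t = 0]) simp_all
  also have "(\<integral>\<^sup>+x. E a x \<partial>lborel) + (\<integral>\<^sup>+x. E (- a) x \<partial>lborel) = ennreal (2 / k)"
    unfolding E using k by (subst ennreal_plus[symmetric]) auto
  finally show ?thesis .
qed

text \<open>The norm is at least the mean of the absolute coordinates, so the kernel is dominated by
  a product of one-dimensional exponentials of rate c / d, each with integral at most 2 d /
  c.\<close>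

lemma Kop_one_le:
  fixes x :: "'a::euclidean_space"
  assumes c: "0 < c"
  shows "Kop c (\<lambda>_. 1) x \<le> (2 * DIM('a) / c) ^ DIM('a)"
proof -
  define k where "k = c / DIM('a)"
  have k: "0 < k" using c by (simp add: k_def)
  have "ennreal (Kop c (\<lambda>_. 1) x) = (\<integral>\<^sup>+t. ennreal (exp (- (c * norm (x - t)))) \<partial>cubeM)"
    unfolding Kop_def using Kop_integrable[of "\<lambda>_. 1" 1 c x] c by (subst nn_integral_eq_integral) simp_all
  also have "\<dots> \<le> (\<integral>\<^sup>+t. ennreal (exp (- (c * norm (x - t)))) \<partial>lborel)"
    unfolding cubeM_def by (subst nn_integral_restrict_space) (auto intro!: nn_integral_mono simp: indicator_def)
  also have "\<dots> \<le> (\<integral>\<^sup>+t. (\<Prod>b\<in>Basis. ennreal (exp (- (k * \<bar>t \<bullet> b - x \<bullet> b\<bar>)))) \<partial>lborel)"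
  proof (rule nn_integral_mono)
    fix t :: 'a
    have "(\<Sum>b\<in>Basis. \<bar>t \<bullet> b - x \<bullet> b\<bar>) \<le> (\<Sum>b\<in>(Basis :: 'a set). norm (x - t))"
      by (rule sum_mono) (metis Basis_le_norm inner_diff_left norm_minus_commute)
    then have "k * (\<Sum>b\<in>Basis. \<bar>t \<bullet> b - x \<bullet> b\<bar>) \<le> k * (DIM('a) * norm (x - t))"
      using k by (intro mult_left_mono) auto
    also have "\<dots> = c * norm (x - t)" by (simp add: k_def)
    finally have "exp (- (c * norm (x - t))) \<le> exp (\<Sum>b\<in>Basis. - (k * \<bar>t \<bullet> b - x \<bullet> b\<bar>))"
      by (simp add: sum_negf sum_distrib_left)
    also have "\<dots> = (\<Prod>b\<in>Basis. exp (- (k * \<bar>t \<bullet> b - x \<bullet> b\<bar>)))" by (rule exp_sum) simp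
    finally show "ennreal (exp (- (c * norm (x - t)))) \<le> (\<Prod>b\<in>Basis. ennreal (exp (- (k * \<bar>t \<bullet> b - x \<bullet> b\<bar>))))"
      by (subst prod_ennreal) (auto intro: ennreal_leI)
  qed
  also have "\<dots> = (\<Prod>b\<in>(Basis :: 'a set). \<integral>\<^sup>+y. ennreal (exp (- (k * \<bar>y - x \<bullet> b\<bar>))) \<partial>lborel)"
    by (rule nn_integral_lborel_prod) auto
  also have "\<dots> \<le> (\<Prod>b\<in>(Basis :: 'a set). ennreal (2 / k))"
    by (intro prod_mono_ennreal nn_integral_exp_abs_le k)
  also have "\<dots> = ennreal ((2 / k) ^ DIM('a))" using k by (simp add: ennreal_power)
  finally have "Kop c (\<lambda>_. 1) x \<le> (2 / k) ^ DIM('a)" using k by (subst (asm) ennreal_le_iff) auto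
  then show ?thesis by (simp add: k_def mult.commute)
qed

text \<open>The choice a^2 = c^d compensates the factor c^(-d) in the bound for
  \<open>Kop c (\<lambda>_. 1)\<close> and leaves - 2 ln a = - d ln c.\<close>

lemma dual_upper:
  assumes c: "1 \<le> c"
  shows "dual_value TYPE('a::euclidean_space) c \<le> (2 * real DIM('a)) ^ DIM('a) - real DIM('a) * ln c"
proof -
  define d where "d = DIM('a)"
  define a where "a = sqrt (c ^ d)"
  have cp: "0 < c" using c by simp
  have a: "0 < a" "a\<^sup>2 = c ^ d" "2 * ln a = d * ln c"
    using cp by (simp_all add: a_def ln_sqrt ln_realpow)
  have Kc: "continuous_on UNIV (Kop c (\<lambda>_::'a. 1))"
    by (rule Kop_continuous[where B = 1]) (use cp in auto)
  have "(\<integral>s. Kop c (\<lambda>_. 1) s \<partial>(cubeM :: 'a measure)) \<le> (\<integral>s. (2 * d / c) ^ d \<partial>(cubeM :: 'a measure))"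
  proof (rule integral_mono)
    show "integrable cubeM (Kop c (\<lambda>_::'a. 1))"
      using Kop_one_le[OF cp, where 'a='a] Kop_pos[OF pos_bounded_const[OF zero_less_one, where 'a='a]] cp
      by (intro integrable_cube[where C = "(2 * DIM('a) / c) ^ DIM('a)"] continuous_cubeM[OF Kc])
         (auto simp: abs_of_pos)
  qed (use Kop_one_le[OF cp] in \<open>auto simp: d_def\<close>)
  then have "a\<^sup>2 * (\<integral>s. Kop c (\<lambda>_. 1) s \<partial>(cubeM :: 'a measure)) \<le> c ^ d * (2 * d / c) ^ d"
    unfolding a(2) using cp by (intro mult_left_mono) (auto simp: cube.prob_space)
  also have "\<dots> = (2 * d) ^ d" using cp by (simp add: power_divide)
  finally show ?thesis
    using dual_le_const[OF less_imp_le[OF cp] a(1), where 'a='a] a(3) by (simp add: d_def)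
qed

text \<open>By the triangle inequality K u, and with it u = 1 / K u, varies by at most the factor
  exp (c |s - t|). On a box of side 1 / c containing s this keeps u comparable to u s, so K u s is
  at least of order c^(-d) u s; as u s = 1 / K u s, this bounds (K u s)^2 from below.\<close>

lemma dual_lower:
  assumes c: "1 \<le> c"
  shows "1 - 2 * real DIM('a) - real DIM('a) * ln c \<le> dual_value TYPE('a::euclidean_space) c"
proof -
  define d where "d = DIM('a)"
  define u where "u = (schr c :: 'a \<Rightarrow> real)"
  have cp: "0 < c" "0 \<le> c" using c by simp_all
  have u: "continuous_on UNIV u" "\<And>x. 0 < u x" "\<And>x. u x * Kop c u x = 1"
    unfolding u_def by (intro schr cp)+
  have pu: "pos_bounded u" unfolding u_def by (rule schr_pos_bounded[OF cp(2)])
  note um = pos_bounded_measurable[OF pu]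
  obtain B where B: "\<And>t. t \<in> cbox 0 One \<Longrightarrow> \<bar>u t\<bar> \<le> B" using pos_bounded_abs[OF pu] by blast
  note ki = Kop_integrable[OF um B cp(2)]
  have Kp: "0 < Kop c u x" for x by (rule Kop_pos[OF pu cp(2)])
  have u_ge: "exp (- (c * norm (s - t))) * u s \<le> u t" for s t
  proof -
    have "Kop c u t \<le> (\<integral>r. exp (c * norm (s - t)) * (exp (- (c * norm (s - r))) * u r) \<partial>cubeM)"
      unfolding Kop_def
    proof (rule integral_mono)
      fix r :: 'a
      have "c * norm (s - r) \<le> c * (norm (s - t) + norm (t - r))"
        using cp norm_triangle_ineq[of "s - t" "t - r"] by (intro mult_left_mono) auto
      then have "exp (- (c * norm (t - r))) \<le> exp (c * norm (s - t) + - (c * norm (s - r)))"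
        by (simp add: distrib_left)
      then have "exp (- (c * norm (t - r))) * u r \<le> exp (c * norm (s - t) + - (c * norm (s - r))) * u r"
        using u(2)[of r] by (intro mult_right_mono) auto
      then show "exp (- (c * norm (t - r))) * u r \<le> exp (c * norm (s - t)) * (exp (- (c * norm (s - r))) * u r)"
        by (simp only: exp_add mult.assoc)
    qed (use ki in auto)
    then have K: "Kop c u t \<le> exp (c * norm (s - t)) * Kop c u s" by (simp add: Kop_def)
    have "u t = 1 / Kop c u t" "u s = 1 / Kop c u s" using u(3)[of t] u(3)[of s] Kp[of t] Kp[of s] by (simp_all add: field_simps)
    moreover have "1 / (exp (c * norm (s - t)) * Kop c u s) \<le> 1 / Kop c u t"
      using K Kp[of t] by (intro divide_left_mono mult_pos_pos) (auto simp: Kp)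
    ultimately show ?thesis by (simp add: exp_minus divide_inverse)
  qed
  have key: "exp (- 2 * d) * (1 / c) ^ d \<le> (Kop c u s)\<^sup>2" if s: "s \<in> cbox 0 One" for s
  proof -
    \<comment> \<open>Lower corner of a box of side 1 / c that contains s. The minimum moves it back
      into the unit cube when s is close to an upper face, which is possible because c \<ge>
      1.\<close>
    define p where "p = (\<Sum>b\<in>Basis. min (s \<bullet> b) (1 - 1 / c) *\<^sub>R b)"
    define Bx where "Bx = cbox p (p + (1 / c) *\<^sub>R One)"
    have c1: "1 / c \<le> 1" "0 < 1 / c" using c by auto
    have pb: "p \<bullet> b = min (s \<bullet> b) (1 - 1 / c)" if "b \<in> Basis" for b using that by (simp add: p_def)
    have sb: "0 \<le> s \<bullet> b" "s \<bullet> b \<le> 1" if "b \<in> Basis" for b using s that by (auto simp: mem_box)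
    have tb: "p \<bullet> b \<le> t \<bullet> b" "t \<bullet> b \<le> p \<bullet> b + 1 / c" if "t \<in> Bx" "b \<in> Basis" for t b
      using that by (auto simp: Bx_def mem_box inner_add_left)
    have sub: "Bx \<subseteq> cbox 0 One"
    proof
      fix t assume t: "t \<in> Bx"
      have "0 \<le> t \<bullet> b \<and> t \<bullet> b \<le> 1" if b: "b \<in> Basis" for b
      proof -
        have "0 \<le> p \<bullet> b" "p \<bullet> b \<le> 1 - 1 / c" using pb[OF b] sb[OF b] c1 by (simp_all add: c)
        then show ?thesis using tb[OF t b] by linarith
      qed
      then show "t \<in> cbox 0 One" by (simp add: mem_box)
    qed
    have near: "c * norm (s - t) \<le> d" if t: "t \<in> Bx" for t
    proof -
      have "norm (s - t) \<le> (\<Sum>b\<in>Basis. \<bar>(s - t) \<bullet> b\<bar>)" by (rule norm_le_l1)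
      also have "\<dots> \<le> (\<Sum>b\<in>(Basis :: 'a set). 1 / c)"
      proof (rule sum_mono)
        fix b :: 'a assume b: "b \<in> Basis"
        show "\<bar>(s - t) \<bullet> b\<bar> \<le> 1 / c"
          using tb[OF t b] pb[OF b] sb[OF b] c1 by (simp add: inner_diff_left min_def abs_le_iff split: if_splits)
      qed
      finally show ?thesis using cp by (simp add: d_def field_simps)
    qed
    have mB: "Bx \<in> sets cubeM" using sub by (simp add: cubeM_def sets_restrict_space_iff Bx_def)
    have "emeasure cubeM Bx = ennreal ((1 / c) ^ d)"
      using sub c1 by (simp add: cubeM_def emeasure_restrict_space) (simp add: Bx_def d_def inner_add_left)
    then have meas: "measure cubeM Bx = (1 / c) ^ d" using c1 by (simp add: measure_def)
    have "exp (- 2 * d) * u s * (1 / c) ^ d = (\<integral>t. exp (- 2 * d) * u s * indicator Bx t \<partial>cubeM)"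
      using mB meas by simp
    also have "\<dots> \<le> Kop c u s"
      unfolding Kop_def
    proof (rule integral_mono)
      show "integrable cubeM (\<lambda>t. exp (- 2 * d) * u s * indicator Bx t)" using mB by (simp add: cube.emeasure_finite less_top[symmetric])
      show "integrable cubeM (\<lambda>t. exp (- (c * norm (s - t))) * u t)" by (rule ki)
      fix t :: 'a
      show "exp (- 2 * d) * u s * indicator Bx t \<le> exp (- (c * norm (s - t))) * u t"
      proof (cases "t \<in> Bx")
        case True
        have "exp (- 2 * d) \<le> exp (- (c * norm (s - t)) + - (c * norm (s - t)))"
          using near[OF True] by simp
        then have "exp (- 2 * d) * u s \<le> exp (- (c * norm (s - t)) + - (c * norm (s - t))) * u s"
          using u(2)[of s] by (intro mult_right_mono) auto
        also have "\<dots> = exp (- (c * norm (s - t))) * (exp (- (c * norm (s - t))) * u s)" by (simp only: exp_add mult.assoc)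
        also have "\<dots> \<le> exp (- (c * norm (s - t))) * u t" by (intro mult_left_mono u_ge) simp
        finally show ?thesis using True by simp
      next
        case False
        then show ?thesis using u(2)[of t] by simp
      qed
    qed
    finally have A: "exp (- 2 * d) * u s * (1 / c) ^ d * Kop c u s \<le> Kop c u s * Kop c u s"
      using Kp[of s] by (intro mult_right_mono) auto
    have "exp (- 2 * d) * u s * (1 / c) ^ d * Kop c u s = exp (- 2 * d) * (1 / c) ^ d * (u s * Kop c u s)"
      by (simp only: mult_ac)
    then show ?thesis using A unfolding u(3) by (simp only: mult_1_right power2_eq_square)
  qed
  have "2 * ln (u s) \<le> 2 * d + d * ln c" if s: "s \<in> cbox 0 One" for s
  proof -
    have "ln (exp (- 2 * d) * (1 / c) ^ d) \<le> ln ((Kop c u s)\<^sup>2)"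
      using key[OF s] cp Kp[of s] by (subst ln_le_cancel_iff) auto
    moreover have "ln (exp (- 2 * d) * (1 / c) ^ d) = - 2 * d - d * ln c"
      using cp by (simp add: ln_mult ln_realpow ln_div)
    moreover have "ln ((Kop c u s)\<^sup>2) = - 2 * ln (u s)"
    proof -
      have "Kop c u s = 1 / u s" using u(3)[of s] u(2)[of s] by (simp add: field_simps)
      then show ?thesis using u(2)[of s] by (simp add: ln_realpow ln_div power_divide)
    qed
    ultimately show ?thesis by linarith
  qed
  then have "(\<integral>s. 2 * ln (u s) \<partial>cubeM) \<le> (\<integral>s. 2 * d + d * ln c \<partial>(cubeM :: 'a measure))"
    using ln_integrable[OF pu] by (intro integral_mono) (auto simp: space_cubeM)
  then show ?thesis by (simp add: dual_value_def u_def[symmetric] cube.prob_space d_def)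
qed

text \<open>A vanishing slope would give a horizontal supporting line and thus a lower bound for
  \<open>dual_value\<close>, whereas \<open>dual_upper\<close> sends it to - \<infinity>.\<close>

lemma slope_pos:
  assumes c: "0 \<le> c"
  shows "0 < slope TYPE('a::euclidean_space) c"
proof (rule ccontr)
  assume "\<not> 0 < slope TYPE('a) c"
  then have s: "slope TYPE('a) c = 0" using slope_nonneg[OF c, where 'a='a] by simp
  define C where "C = (2 * real DIM('a)) ^ DIM('a)"
  have le: "dual_value TYPE('a) c \<le> C - real DIM('a) * ln x" if "1 \<le> x" for x
    using dual_support[OF c, of x, where 'a='a] dual_upper[OF that, where 'a='a] s that by (simp add: C_def)
  \<comment> \<open>At side length exp y the upper bound is C - d y \<le> C - y, at least 1 below
    the supposed lower bound.\<close>
  define y where "y = max 0 (C - dual_value TYPE('a) c + 1)"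
  have y: "0 \<le> y" "C - dual_value TYPE('a) c + 1 \<le> y" by (auto simp: y_def)
  then have "dual_value TYPE('a) c \<le> C - real DIM('a) * y" using le[of "exp y"] by simp
  moreover have "1 * y \<le> real DIM('a) * y"
    using y DIM_positive[where 'a='a] by (intro mult_right_mono) auto
  ultimately show False using y by linarith
qed

section \<open>Convexity, monotonicity and limits of the value\<close>

lemma convex_on_supporting_lines:
  fixes f m :: "real \<Rightarrow> real"
  assumes S: "convex S" and m: "\<And>x y. x \<in> S \<Longrightarrow> y \<in> S \<Longrightarrow> f x - (y - x) * m x \<le> f y"
  shows "convex_on S f"
proof (rule convex_onI[OF _ S])
  fix t x y :: real assume t: "0 < t" "t < 1" and xy: "x \<in> S" "y \<in> S"
  define z where "z = (1 - t) *\<^sub>R x + t *\<^sub>R y"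
  have z: "z \<in> S" unfolding z_def by (rule convexD_alt[OF S xy]) (use t in auto)
  have "(1 - t) * (f z - (x - z) * m z) + t * (f z - (y - z) * m z) \<le> (1 - t) * f x + t * f y"
    using t m[OF z xy(1)] m[OF z xy(2)] by (intro add_mono mult_left_mono) auto
  moreover have "(1 - t) * (f z - (x - z) * m z) + t * (f z - (y - z) * m z) = f z - ((1 - t) * x + t * y - z) * m z"
    by (simp add: algebra_simps)
  ultimately show "f ((1 - t) *\<^sub>R x + t *\<^sub>R y) \<le> (1 - t) * f x + t * f y" by (simp add: z_def)
qed

lemma V_G_convex: "convex_on {0<..} (V_G TYPE('a::euclidean_space))"
proof (rule convex_on_supporting_lines)
  fix x y :: real assume "x \<in> {0<..}" "y \<in> {0<..}"
  then show "V_G TYPE('a) x - (y - x) * slope TYPE('a) x \<le> V_G TYPE('a) y"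
    using dual_support[of x y, where 'a='a] by (simp add: V_G_eq)
qed simp

lemma V_G_continuous: "continuous_on {0<..} (V_G TYPE('a::euclidean_space))"
  by (rule convex_on_continuous[OF _ V_G_convex]) simp

lemma V_G_strict_antimono: "strict_antimono_on {0<..} (V_G TYPE('a::euclidean_space))"
proof (rule monotone_onI)
  fix x y :: real assume xy: "x \<in> {0<..}" "y \<in> {0<..}" "x < y"
  then have "V_G TYPE('a) y - (x - y) * slope TYPE('a) y \<le> V_G TYPE('a) x"
    using dual_support[of y x, where 'a='a] by (simp add: V_G_eq)
  moreover have "(x - y) * slope TYPE('a) y < 0"
    using xy slope_pos[of y, where 'a='a] by (intro mult_neg_pos) auto
  ultimately show "V_G TYPE('a) y < V_G TYPE('a) x" by linarith
qed

lemma dual_value_le_1: "0 \<le> c \<Longrightarrow> dual_value TYPE('a::euclidean_space) c \<le> 1"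
  using dual_support[of c 0, where 'a='a] mult_nonneg_nonneg[OF _ slope_nonneg[of c, where 'a='a], of c]
  by (simp add: dual_value_zero)

lemma dual_value_ge: "0 \<le> c \<Longrightarrow> 1 - c * slope TYPE('a::euclidean_space) 0 \<le> dual_value TYPE('a) c"
  using dual_support[of 0 c, where 'a='a] by (simp add: dual_value_zero)

lemma V_G_limit_zero: "(V_G TYPE('a::euclidean_space) \<longlongrightarrow> ln 2 - 1) (at_right 0)"
proof (rule tendsto_sandwich)
  have "((\<lambda>c. ln 2 - 2 + (1 - c * slope TYPE('a) 0)) \<longlongrightarrow> ln 2 - 2 + (1 - 0 * slope TYPE('a) 0)) (at_right 0)"
    by (intro tendsto_intros)
  then show "((\<lambda>c. ln 2 - 2 + (1 - c * slope TYPE('a) 0)) \<longlongrightarrow> ln 2 - 1) (at_right 0)" by simp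
  show "((\<lambda>c::real. ln 2 - 1 :: real) \<longlongrightarrow> ln 2 - 1) (at_right 0)" by simp
  show "\<forall>\<^sub>F c in at_right 0. ln 2 - 2 + (1 - c * slope TYPE('a) 0) \<le> V_G TYPE('a) c"
    using dual_value_ge[where 'a='a] by (auto simp: eventually_at_right_field V_G_eq intro!: exI[of _ 1])
  show "\<forall>\<^sub>F c in at_right 0. V_G TYPE('a) c \<le> ln 2 - 1"
    using dual_value_le_1[where 'a='a] by (auto simp: eventually_at_right_field V_G_eq intro!: exI[of _ 1])
qed

lemma V_G_at_top: "(\<lambda>c. V_G TYPE('a::euclidean_space) c - (- real DIM('a) * ln c)) \<in> O[at_top](\<lambda>_. 1)"
proof (rule bigoI)
  define P where "P = (2 * real DIM('a)) ^ DIM('a)"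
  define C where "C = 1 + 2 * real DIM('a) + P + 2"
  show "\<forall>\<^sub>F c in at_top. norm (V_G TYPE('a) c - (- real DIM('a) * ln c)) \<le> C * norm (1 :: real)"
    using eventually_ge_at_top[of 1]
  proof eventually_elim
    case (elim c)
    have "0 < ln (2::real)" "ln (2::real) < 2" using ln_bound[of 2] by auto
    moreover have "0 \<le> P" by (simp add: P_def)
    moreover have "dual_value TYPE('a) c \<le> P - real DIM('a) * ln c"
      using dual_upper[OF elim, where 'a='a] by (simp add: P_def)
    moreover have "V_G TYPE('a) c = ln 2 - 2 + dual_value TYPE('a) c" using elim by (simp add: V_G_eq)
    ultimately have "\<bar>V_G TYPE('a) c + real DIM('a) * ln c\<bar> \<le> C"
      using dual_lower[OF elim, where 'a='a] unfolding C_def by linarith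
    then show ?case by simp
  qed
qed

section \<open>The boundary value problem in dimension one\<close>

lemma cbox_One_real: "cbox 0 (One::real) = {0..1}"
  by (simp add: cbox_interval)

lemma integral_cube_scale_real:
  fixes F :: "real \<Rightarrow> real"
  assumes c: "0 < c" and F: "continuous_on {0..c} F"
  shows "integral {0..c} F = c * (\<integral>t. F (c * t) \<partial>cubeM)"
proof -
  have "integral {0..c} F = (LINT x:{0..c}|lborel. F x)"
    by (rule set_borel_integral_eq_integral(2)[OF borel_integrable_atLeastAtMost'[OF F], symmetric])
  also have "\<dots> = (\<integral>x. indicator {0..c} x *\<^sub>R F x \<partial>lborel)" by (simp add: set_lebesgue_integral_def)
  also have "\<dots> = c * (\<integral>x. indicator {0..c} (0 + c * x) *\<^sub>R F (0 + c * x) \<partial>lborel)"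
    using lborel_integral_real_affine[of c "\<lambda>x. indicator {0..c} x *\<^sub>R F x" 0] c by simp
  also have "(\<lambda>x. indicator {0..c} (0 + c * x) *\<^sub>R F (0 + c * x)) = (\<lambda>x. indicator {0..1} x *\<^sub>R F (c * x))"
    using c by (auto simp: indicator_def zero_le_mult_iff)
  also have "(\<integral>x. indicator {0..1} x *\<^sub>R F (c * x) \<partial>lborel) = (\<integral>t. F (c * t) \<partial>cubeM)"
    unfolding cubeM_def cbox_One_real by (subst integral_restrict_space) simp_all
  finally show ?thesis .
qed

lemma integral_cube_real:
  fixes F :: "real \<Rightarrow> real"
  shows "continuous_on {0..1} F \<Longrightarrow> (\<integral>t. F t \<partial>cubeM) = integral {0..1} F"
  using integral_cube_scale_real[of 1 F] by simp

lemma integral_cube_reflect: "(\<integral>t. F (1 - t) \<partial>cubeM) = (\<integral>t. F t \<partial>cubeM)" for F :: "real \<Rightarrow> real"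
proof -
  have "(\<integral>t. F t \<partial>cubeM) = (\<integral>x. indicator {0..1} x *\<^sub>R F x \<partial>lborel)"
    unfolding cubeM_def cbox_One_real by (subst integral_restrict_space) simp_all
  also have "\<dots> = (\<integral>x. indicator {0..1} (1 + (-1) * x) *\<^sub>R F (1 + (-1) * x) \<partial>lborel)"
    using lborel_integral_real_affine[of "-1" "\<lambda>x. indicator {0..1} x *\<^sub>R F x" 1] by simp
  also have "(\<lambda>x. indicator {0..1} (1 + (-1) * x) *\<^sub>R F (1 + (-1) * x)) = (\<lambda>x. indicator {0..1::real} x *\<^sub>R F (1 - x))"
    by (auto simp: indicator_def)
  also have "(\<integral>x. indicator {0..1} x *\<^sub>R F (1 - x) \<partial>lborel) = (\<integral>t. F (1 - t) \<partial>cubeM)"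
    unfolding cubeM_def cbox_One_real by (subst integral_restrict_space) simp_all
  finally show ?thesis by simp
qed

text \<open>Splitting at s factorises exp (- |s - r|) into a function of s and one of r. The two
  parts carry the two exponential solutions of y'' = y, the form in which the kernel acts as a Green
  function.\<close>

lemma Kop_real:
  assumes c: "0 < c" and F: "continuous_on {0..c} F" and s: "s \<in> {0..c}"
  shows "Kop c (\<lambda>t. F (c * t)) (s / c) =
    (exp (- s) * integral {0..s} (\<lambda>r. exp r * F r) + exp s * integral {s..c} (\<lambda>r. exp (- r) * F r)) / c"
proof -
  let ?f = "\<lambda>r. exp (- \<bar>s - r\<bar>) * F r"
  have f: "continuous_on {0..c} ?f" by (intro continuous_intros F)
  have e: "c * \<bar>s / c - t\<bar> = \<bar>s - c * t\<bar>" for t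
  proof -
    have "c * \<bar>s / c - t\<bar> = \<bar>c * (s / c - t)\<bar>" using c by (simp only: abs_mult abs_of_pos)
    also have "c * (s / c - t) = s - c * t" using c by (simp add: right_diff_distrib)
    finally show ?thesis .
  qed
  have "c * Kop c (\<lambda>t. F (c * t)) (s / c) = integral {0..c} ?f"
    using integral_cube_scale_real[OF c f] by (simp add: Kop_def e)
  also have "\<dots> = integral {0..s} ?f + integral {s..c} ?f"
    using s by (intro Henstock_Kurzweil_Integration.integral_combine[symmetric] integrable_continuous_real f) auto
  also have "integral {0..s} ?f = integral {0..s} (\<lambda>r. exp (- s) * (exp r * F r))"
    by (intro Henstock_Kurzweil_Integration.integral_cong) (simp add: exp_diff exp_minus field_simps)
  also have "\<dots> = exp (- s) * integral {0..s} (\<lambda>r. exp r * F r)" by (rule integral_mult_right)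
  also have "integral {s..c} ?f = integral {s..c} (\<lambda>r. exp s * (exp (- r) * F r))"
    by (intro Henstock_Kurzweil_Integration.integral_cong) (simp add: exp_diff exp_minus field_simps)
  also have "\<dots> = exp s * integral {s..c} (\<lambda>r. exp (- r) * F r)" by (rule integral_mult_right)
  finally show ?thesis using c by (simp add: field_simps)
qed

text \<open>Reflecting the interval preserves the Schroedinger equation, so uniqueness applies. This
  supplies the boundary condition h 0 = h c.\<close>

lemma schr_symmetric:
  assumes c: "0 \<le> c" and x: "x \<in> {0..1}"
  shows "schr c (1 - x) = schr c (x :: real)"
proof -
  let ?u = "schr c :: real \<Rightarrow> real" and ?v = "\<lambda>x::real. schr c (1 - x) :: real"
  have u: "continuous_on UNIV ?u" "\<And>x. 0 < ?u x" "\<And>x. ?u x * Kop c ?u x = 1" by (intro schr c)+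
  have pv: "pos_bounded ?v"
  proof (rule pos_bounded_continuous)
    show "continuous_on UNIV ?v" by (rule continuous_on_compose2[OF u(1)]) (auto intro!: continuous_intros)
  qed (rule u(2))
  have K: "Kop c ?v x = Kop c ?u (1 - x)" for x
    unfolding Kop_def
    using integral_cube_reflect[of "\<lambda>t. exp (- (c * norm (x - t))) * schr c (1 - t)"]
      norm_minus_commute[of "1 - x"]
    by (simp add: algebra_simps abs_minus_commute)
  show ?thesis
    by (rule schrodinger_unique[OF pv schr_pos_bounded[OF c] c]) (use x u K cbox_One_real in auto)
qed

definition hfun :: "real \<Rightarrow> real \<Rightarrow> real" where
  "hfun c s = 1 / schr c (s / c)"

text \<open>The derivative of the splitting formula for h; the two contributions of the moving end
  point s cancel. In this form the values at 0 and c and the bound |h'| \<le> h can be read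
  off.\<close>

definition hder :: "real \<Rightarrow> real \<Rightarrow> real" where
  "hder c s = (exp s * integral {s..c} (\<lambda>r. exp (- r) * (1 / hfun c r)) -
     exp (- s) * integral {0..s} (\<lambda>r. exp r * (1 / hfun c r))) / c"

lemma hfun_pos: "0 < c \<Longrightarrow> 0 < hfun c s"
  using schr(2)[of c "s / c"] by (simp add: hfun_def)

lemma hfun_continuous: "0 < c \<Longrightarrow> continuous_on S (hfun c)"
proof -
  assume c: "0 < c"
  have "schr c x \<noteq> 0" for x :: real using schr(2)[of c x] c by simp
  then show ?thesis
    unfolding hfun_def using c
    by (intro continuous_intros continuous_on_compose2[OF schr(1)[of c]]) auto
qed

lemma hfun_solution:
  assumes c: "0 < c"
  shows "positive_bvp_solution c (hfun c) (hder c)"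
proof -
  have c0: "0 \<le> c" using c by simp
  define F where "F r = 1 / hfun c r" for r
  have F: "continuous_on S F" for S
    unfolding F_def using hfun_pos[OF c] by (intro continuous_intros hfun_continuous[OF c]) (simp add: less_imp_neq[THEN not_sym])
  have Fc: "(\<lambda>t. F (c * t)) = schr c" using c by (simp add: F_def hfun_def)
  define P where "P s = integral {0..s} (\<lambda>r. exp r * F r)" for s
  define R where "R s = integral {s..c} (\<lambda>r. exp (- r) * F r)" for s
  have h: "hfun c s = (exp (- s) * P s + exp s * R s) / c" if s: "s \<in> {0..c}" for s
  proof -
    have "hfun c s = Kop c (schr c) (s / c)"
      using schr(3)[OF c0, of "s / c"] schr(2)[OF c0, of "s / c"] by (simp add: hfun_def field_simps)
    then show ?thesis using Kop_real[OF c F s] unfolding Fc P_def R_def by simp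
  qed
  have h': "hder c s = (exp s * R s - exp (- s) * P s) / c" for s
    by (simp add: hder_def P_def R_def F_def)
  have dP: "(P has_real_derivative exp s * F s) (at s within {0..c})" if "s \<in> {0..c}" for s
    unfolding P_def by (rule integral_has_real_derivative[OF _ that]) (intro continuous_intros F)
  have dR: "(R has_real_derivative - (exp (- s) * F s)) (at s within {0..c})" if "s \<in> {0..c}" for s
    unfolding R_def by (rule integral_has_real_derivative'[OF _ that]) (intro continuous_intros F)
  have ee: "exp (- s) * (exp s * x) = x" "exp s * (exp (- s) * x) = x" for s x :: real
    by (simp_all add: mult.assoc[symmetric] exp_add[symmetric])
  have d1: "(hfun c has_real_derivative hder c s) (at s within {0..c})" if s: "s \<in> {0..c}" for s
  proof (rule has_field_derivative_transform_within[OF _ zero_less_one s h[symmetric]])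
    show "((\<lambda>s. (exp (- s) * P s + exp s * R s) / c) has_real_derivative hder c s) (at s within {0..c})"
      using c by (auto intro!: derivative_eq_intros dP[OF s] dR[OF s] simp: h' field_simps ee)
  qed
  have d2: "(hder c has_real_derivative - 2 / (c * hfun c s) + hfun c s) (at s within {0..c})" if s: "s \<in> {0..c}" for s
    unfolding h'[abs_def]
  proof -
    have "((\<lambda>s. (exp s * R s - exp (- s) * P s) / c) has_real_derivative
       ((exp s * R s + exp s * - (exp (- s) * F s)) - (- exp (- s) * P s + exp (- s) * (exp s * F s))) / c) (at s within {0..c})"
      using c by (auto intro!: derivative_eq_intros dP[OF s] dR[OF s] simp: algebra_simps diff_divide_distrib add_divide_distrib)
    also have "((exp s * R s + exp s * - (exp (- s) * F s)) - (- exp (- s) * P s + exp (- s) * (exp s * F s))) / c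
        = (exp (- s) * P s + exp s * R s) / c - 2 * F s / c"
      by (simp add: ee diff_divide_distrib add_divide_distrib)
    finally show "((\<lambda>s. (exp s * R s - exp (- s) * P s) / c) has_real_derivative - 2 / (c * hfun c s) + hfun c s) (at s within {0..c})"
      unfolding h[OF s, symmetric] by (simp add: F_def mult.commute)
  qed
  have "hfun c 0 = hfun c c" using schr_symmetric[OF c0, of 0] c by (simp add: hfun_def)
  moreover have "hder c 0 = hfun c 0" using h[of 0] h'[of 0] c by (simp add: P_def)
  moreover have "hder c c = - hfun c c" using h[of c] h'[of c] c by (simp add: R_def)
  ultimately show ?thesis
    unfolding positive_bvp_solution_def using d1 d2 hfun_pos[OF c] by simp
qed

text \<open>The functions exp r (y - y') and exp (- r) (y + y') have the derivatives 2 exp r / (c y)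
  and - 2 exp (- r) / (c y), and the boundary conditions make the first vanish at 0 and the second
  at c. Integration recovers y from 1 / y through the kernel, so the rescaled 1 / y solves the
  Schroedinger equation.\<close>

lemma positive_bvp_unique:
  assumes c: "0 < c" and y: "positive_bvp_solution c y y'" and s: "s \<in> {0..c}"
  shows "y s = hfun c s"
proof -
  have c0: "0 \<le> c" using c by simp
  have ypos: "\<And>s. s \<in> {0..c} \<Longrightarrow> 0 < y s"
    and dy: "\<And>s. s \<in> {0..c} \<Longrightarrow> (y has_real_derivative y' s) (at s within {0..c})"
    and dy': "\<And>s. s \<in> {0..c} \<Longrightarrow> (y' has_real_derivative - 2 / (c * y s) + y s) (at s within {0..c})"
    and bd: "y' 0 = y 0" "y 0 = y c" "y c = - y' c"
    using y unfolding positive_bvp_solution_def by auto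
  have yc: "continuous_on {0..c} y" using dy by (rule DERIV_continuous_on)
  define F where "F r = 1 / y r" for r
  have F: "continuous_on {0..c} F" unfolding F_def using ypos by (intro continuous_intros yc) force
  have rep: "Kop c (\<lambda>t. F (c * t)) (s / c) = y s" if s: "s \<in> {0..c}" for s
  proof -
    have "((\<lambda>r. exp r * F r) has_integral (c / 2 * (exp s * (y s - y' s)) - c / 2 * (exp 0 * (y 0 - y' 0)))) {0..s}"
    proof (rule fundamental_theorem_of_calculus)
      fix r assume "r \<in> {0..s}"
      then have r: "r \<in> {0..c}" and sub: "{0..s} \<subseteq> {0..c}" using s by auto
      have "((\<lambda>r. c / 2 * (exp r * (y r - y' r))) has_real_derivative exp r * F r) (at r within {0..c})"
        using c ypos[OF r] by (auto intro!: derivative_eq_intros dy[OF r] dy'[OF r] simp: F_def field_simps)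
      then show "((\<lambda>r. c / 2 * (exp r * (y r - y' r))) has_vector_derivative exp r * F r) (at r within {0..s})"
        unfolding has_real_derivative_iff_has_vector_derivative using sub by (rule has_vector_derivative_within_subset)
    qed (use s in auto)
    then have 1: "integral {0..s} (\<lambda>r. exp r * F r) = c / 2 * (exp s * (y s - y' s))"
      using bd by (simp add: integral_unique)
    have "((\<lambda>r. exp (- r) * F r) has_integral (- c / 2 * (exp (- c) * (y c + y' c)) - - c / 2 * (exp (- s) * (y s + y' s)))) {s..c}"
    proof (rule fundamental_theorem_of_calculus)
      fix r assume "r \<in> {s..c}"
      then have r: "r \<in> {0..c}" and sub: "{s..c} \<subseteq> {0..c}" using s by auto
      have "((\<lambda>r. - c / 2 * (exp (- r) * (y r + y' r))) has_real_derivative exp (- r) * F r) (at r within {0..c})"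
        using c ypos[OF r] by (auto intro!: derivative_eq_intros dy[OF r] dy'[OF r] simp: F_def field_simps)
      then show "((\<lambda>r. - c / 2 * (exp (- r) * (y r + y' r))) has_vector_derivative exp (- r) * F r) (at r within {s..c})"
        unfolding has_real_derivative_iff_has_vector_derivative using sub by (rule has_vector_derivative_within_subset)
    qed (use s in auto)
    then have 2: "integral {s..c} (\<lambda>r. exp (- r) * F r) = c / 2 * (exp (- s) * (y s + y' s))"
      using bd by (simp add: integral_unique)
    have ee: "exp (- s) * (k * (exp s * x)) = k * x" "exp s * (k * (exp (- s) * x)) = k * x" for k x :: real
      by (simp_all add: mult.left_commute[of _ k] mult.assoc[symmetric] exp_add[symmetric])
    show ?thesis unfolding Kop_real[OF c F s] 1 2 ee using c by (simp add: field_simps)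
  qed
  let ?v = "\<lambda>t. F (c * t)"
  have vc: "continuous_on {0..1} ?v"
    by (rule continuous_on_compose2[OF F]) (use c in \<open>auto intro!: continuous_intros simp: mult_left_le\<close>)
  have vpos: "0 < ?v t" if "t \<in> {0..1}" for t
    using ypos[of "c * t"] that c by (auto simp: F_def mult_left_le)
  have "pos_bounded ?v" unfolding pos_bounded_def
  proof
    have "?v \<in> borel_measurable (restrict_space borel {0..1})" using vc by (rule borel_measurable_continuous_on_restrict)
    then show "?v \<in> borel_measurable cubeM"
      unfolding cubeM_def cbox_One_real by (subst measurable_cong_sets[where M' = "restrict_space borel {0..1}"]) (auto simp: sets_restrict_space)
    obtain p where p: "p \<in> {0..1}" "\<forall>t\<in>{0..1}. ?v p \<le> ?v t"
      using continuous_attains_inf[OF _ _ vc] by auto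
    obtain q where q: "\<forall>t\<in>{0..1}. ?v t \<le> ?v q"
      using continuous_attains_sup[OF _ _ vc] by auto
    show "\<exists>a>0. \<exists>b. \<forall>t\<in>cbox 0 One. a \<le> ?v t \<and> ?v t \<le> b"
      unfolding cbox_One_real using p q vpos[OF p(1)] by blast
  qed
  moreover have "?v x * Kop c ?v x = 1" if "x \<in> {0..1}" for x
    using rep[of "c * x"] vpos[OF that] that c by (simp add: mult_left_le F_def)
  ultimately have "?v (s / c) = schr c (s / c)"
    using s c by (intro schrodinger_unique[OF _ schr_pos_bounded[OF c0] c0, of ?v "s / c"])
      (auto simp: cbox_One_real schr(3)[OF c0])
  then show ?thesis using c ypos[OF s] schr(2)[OF c0, of "s / c"] by (simp add: F_def hfun_def field_simps)
qed

text \<open>Multiplying the equation by y shows that (y y' + y^2) / 2 + s / c is an antiderivative.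
  This reconciles the stated representation of the value with the dual formula, which contains only
  ln h.\<close>

lemma bvp_energy_integral:
  assumes c: "0 < c" and y: "positive_bvp_solution c y y'"
  shows "((\<lambda>s. 1 / 2 * (y s + y' s)\<^sup>2) has_integral (1 - (y 0)\<^sup>2)) {0..c}"
proof -
  have ypos: "\<And>s. s \<in> {0..c} \<Longrightarrow> 0 < y s"
    and dy: "\<And>s. s \<in> {0..c} \<Longrightarrow> (y has_real_derivative y' s) (at s within {0..c})"
    and dy': "\<And>s. s \<in> {0..c} \<Longrightarrow> (y' has_real_derivative - 2 / (c * y s) + y s) (at s within {0..c})"
    and bd: "y' 0 = y 0" "y 0 = y c" "y c = - y' c"
    using y unfolding positive_bvp_solution_def by auto
  define G where "G s = (y s * y' s + (y s)\<^sup>2) / 2 + s / c" for s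
  have "((\<lambda>s. 1 / 2 * (y s + y' s)\<^sup>2) has_integral (G c - G 0)) {0..c}"
  proof (rule fundamental_theorem_of_calculus)
    fix s assume s: "s \<in> {0..c}"
    have "(G has_real_derivative ((y' s * y' s + (- 2 / (c * y s) + y s) * y s) + 2 * y s * y' s) / 2 + 1 / c) (at s within {0..c})"
      unfolding G_def using c by (auto intro!: derivative_eq_intros dy[OF s] dy'[OF s])
    also have "((y' s * y' s + (- 2 / (c * y s) + y s) * y s) + 2 * y s * y' s) / 2 + 1 / c = 1 / 2 * (y s + y' s)\<^sup>2"
      using c ypos[OF s] by (simp add: field_simps power2_eq_square)
    finally show "(G has_vector_derivative 1 / 2 * (y s + y' s)\<^sup>2) (at s within {0..c})"
      by (simp add: has_real_derivative_iff_has_vector_derivative)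
  qed (use c in simp)
  moreover have "G c - G 0 = 1 - (y 0)\<^sup>2"
    using bd c by (simp add: G_def power2_eq_square)
  ultimately show ?thesis by simp
qed

lemma dual_value_hfun:
  assumes c: "0 < c"
  shows "dual_value TYPE(real) c = 1 + 2 / c * integral {0..c} (\<lambda>s. ln (hfun c s))"
proof -
  have cont: "continuous_on {0..c} (\<lambda>s. ln (hfun c s))"
    using hfun_pos[OF c] by (intro continuous_on_ln hfun_continuous[OF c]) (auto simp: less_imp_neq[THEN not_sym])
  have "(\<integral>t. ln (hfun c (c * t)) \<partial>cubeM) = (\<integral>t. - ln (schr c t) \<partial>(cubeM :: real measure))"
    using c schr(2)[of c] by (intro Bochner_Integration.integral_cong refl) (simp add: hfun_def ln_div)
  then show ?thesis unfolding dual_value_def integral_cube_scale_real[OF c cont] using c by simp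
qed

lemma V_G_real_formula:
  assumes c: "0 < c"
  shows "V_G TYPE(real) c = ln 2 - (hfun c 0)\<^sup>2 +
    integral {0..c} (\<lambda>s. 2 / c * ln (hfun c s) - 1 / 2 * (hfun c s + hder c s)\<^sup>2)"
proof -
  have cont: "continuous_on {0..c} (\<lambda>s. ln (hfun c s))"
    using hfun_pos[OF c] by (intro continuous_on_ln hfun_continuous[OF c]) (auto simp: less_imp_neq[THEN not_sym])
  have "((\<lambda>s. 2 / c * ln (hfun c s) - 1 / 2 * (hfun c s + hder c s)\<^sup>2) has_integral
     (2 / c * integral {0..c} (\<lambda>s. ln (hfun c s)) - (1 - (hfun c 0)\<^sup>2))) {0..c}"
    by (intro has_integral_diff has_integral_mult_right integrable_integral integrable_continuous_real cont
        bvp_energy_integral[OF c hfun_solution[OF c]])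
  from integral_unique[OF this] show ?thesis using dual_value_hfun[OF c] c by (simp add: V_G_eq)
qed

text \<open>The mean distance of two independent uniform points, the source of the coefficient of c
  in the expansion.\<close>

lemma slope_zero_real: "slope TYPE(real) 0 = 1 / 3"
proof -
  have inner: "(\<integral>t. norm (s - t) \<partial>(cubeM :: real measure)) = (s\<^sup>2 + (1 - s)\<^sup>2) / 2" if s: "s \<in> {0..1}" for s :: real
  proof -
    have 1: "((\<lambda>t. norm (s - t)) has_integral (s\<^sup>2 / 2)) {0..s}"
    proof -
      have "((\<lambda>t. norm (s - t)) has_integral (- ((s - s)\<^sup>2 / 2) - - ((s - 0)\<^sup>2 / 2))) {0..s}"
        using s by (intro fundamental_theorem_of_calculus)
          (auto intro!: derivative_eq_intros simp: field_simps simp flip: has_real_derivative_iff_has_vector_derivative)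
      then show ?thesis by simp
    qed
    have 2: "((\<lambda>t. norm (s - t)) has_integral ((1 - s)\<^sup>2 / 2)) {s..1}"
    proof -
      have "((\<lambda>t. norm (s - t)) has_integral ((1 - s)\<^sup>2 / 2 - (s - s)\<^sup>2 / 2)) {s..1}"
        using s by (intro fundamental_theorem_of_calculus)
          (auto intro!: derivative_eq_intros simp flip: has_real_derivative_iff_has_vector_derivative)
      then show ?thesis by simp
    qed
    have "((\<lambda>t. norm (s - t)) has_integral (s\<^sup>2 / 2 + (1 - s)\<^sup>2 / 2)) {0..1}"
      using s by (intro has_integral_combine[OF _ _ 1 2]) auto
    then have "integral {0..1} (\<lambda>t. norm (s - t)) = s\<^sup>2 / 2 + (1 - s)\<^sup>2 / 2" by (rule integral_unique)
    moreover have "(\<integral>t. norm (s - t) \<partial>(cubeM :: real measure)) = integral {0..1} (\<lambda>t. norm (s - t))"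
      by (rule integral_cube_real) (intro continuous_intros)
    ultimately show ?thesis by simp
  qed
  have "slope TYPE(real) 0 = (\<integral>s. (s\<^sup>2 + (1 - s)\<^sup>2) / 2 \<partial>(cubeM :: real measure))"
    unfolding slope_zero by (intro Bochner_Integration.integral_cong refl) (simp add: inner space_cubeM cbox_One_real del: real_norm_def)
  also have "\<dots> = integral {0..1} (\<lambda>s. (s\<^sup>2 + (1 - s)\<^sup>2) / 2)"
    by (rule integral_cube_real) (auto intro!: continuous_intros)
  also have "\<dots> = 1 / 3"
  proof (rule integral_unique)
    have "((\<lambda>s::real. (s\<^sup>2 + (1 - s)\<^sup>2) / 2) has_integral ((1 ^ 3 - (1 - 1) ^ 3) / 6 - (0 ^ 3 - (1 - 0) ^ 3) / 6)) {0..1}"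
    by (rule fundamental_theorem_of_calculus)
       (auto intro!: derivative_eq_intros simp flip: has_real_derivative_iff_has_vector_derivative simp: field_simps)
    then show "((\<lambda>s::real. (s\<^sup>2 + (1 - s)\<^sup>2) / 2) has_integral 1 / 3) {0..1}" by simp
  qed
  finally show ?thesis .
qed

lemma exp_minus_le_quadratic:
  fixes x :: real assumes x: "0 \<le> x" shows "exp (- x) \<le> 1 - x + x\<^sup>2 / 2"
proof -
  have 1: "1 + x + x\<^sup>2 / 2 \<le> exp x" by (rule exp_lower_Taylor_quadratic[OF x])
  have p: "0 < 1 - x + x\<^sup>2 / 2"
    using zero_le_power2[of "x - 1"] by (simp add: power2_diff)
  \<comment> \<open>The product is (1 + x^2 / 2)^2 - x^2 = 1 + x^4 / 4.\<close>
  have "1 \<le> (1 + x + x\<^sup>2 / 2) * (1 - x + x\<^sup>2 / 2)"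
    using zero_le_power2[of "x\<^sup>2"] by (simp add: power2_eq_square field_simps)
  also have "\<dots> \<le> exp x * (1 - x + x\<^sup>2 / 2)" using 1 p by (intro mult_right_mono) auto
  finally show ?thesis by (simp add: exp_minus field_simps)
qed

lemma dual_value_real_upper:
  assumes c: "0 < c"
  shows "dual_value TYPE(real) c \<le> 1 - c / 3 + c\<^sup>2 / 2"
proof -
  have Kc: "continuous_on {0..1} (Kop c (\<lambda>_::real. 1))"
    using Kop_continuous[of "\<lambda>_::real. 1" 1 c] c by (auto intro: continuous_on_subset)
  have le: "Kop c (\<lambda>_. 1) s \<le> 1 + c\<^sup>2 / 2 - c * (\<integral>t. norm (s - t) \<partial>(cubeM :: real measure))" if s: "s \<in> {0..1}" for s :: real
  proof -
    have i: "integrable cubeM (\<lambda>t. norm (s - t))"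
      using s by (intro integrable_cube[where C = 1] continuous_cubeM continuous_intros) (auto simp: cbox_One_real)
    have "Kop c (\<lambda>_. 1) s \<le> (\<integral>t. (1 + c\<^sup>2 / 2) - c * norm (s - t) \<partial>(cubeM :: real measure))"
      unfolding Kop_def
    proof (rule integral_mono)
      show "integrable cubeM (\<lambda>t. exp (- (c * norm (s - t))) * 1)" using c by (intro Kop_integrable[where B = 1]) auto
      fix t :: real assume "t \<in> space cubeM"
      then have "\<bar>s - t\<bar> \<le> 1" using s by (auto simp: space_cubeM cbox_One_real)
      then have "c * \<bar>s - t\<bar> \<le> c * 1" using c by (intro mult_left_mono) auto
      then have "(c * \<bar>s - t\<bar>)\<^sup>2 \<le> (c * 1)\<^sup>2" using c by (intro power_mono) auto
      moreover have "exp (- (c * \<bar>s - t\<bar>)) \<le> 1 - c * \<bar>s - t\<bar> + (c * \<bar>s - t\<bar>)\<^sup>2 / 2"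
        using c by (intro exp_minus_le_quadratic) simp
      ultimately show "exp (- (c * norm (s - t))) * 1 \<le> 1 + c\<^sup>2 / 2 - c * norm (s - t)"
        unfolding real_norm_def mult_1_right by linarith
    qed (use i in simp)
    then show ?thesis using i by (simp add: cube.prob_space)
  qed
  have ni: "integrable cubeM (\<lambda>s::real. \<integral>t. norm (s - t) \<partial>(cubeM :: real measure))"
  proof -
    have "(\<lambda>s::real. Dop 0 (\<lambda>_. 1) s) \<in> borel_measurable cubeM" "\<And>s::real. s \<in> cbox 0 One \<Longrightarrow> \<bar>Dop 0 (\<lambda>_. 1) s\<bar> \<le> 1"
      using Dop_facts[of "\<lambda>_::real. 1" 1 0] by auto
    then have "integrable cubeM (\<lambda>s::real. Dop 0 (\<lambda>_. 1) s)" by (rule integrable_cube)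
    then show ?thesis by (simp add: Dop_def)
  qed
  have "(\<integral>s. Kop c (\<lambda>_. 1) s \<partial>(cubeM :: real measure)) \<le>
      (\<integral>s. 1 + c\<^sup>2 / 2 - c * (\<integral>t. norm (s - t) \<partial>(cubeM :: real measure)) \<partial>cubeM)"
  proof (rule integral_mono)
    show "integrable cubeM (Kop c (\<lambda>_::real. 1))"
      using Kop_one_le[OF c, where 'a=real] Kop_pos[OF pos_bounded_const[OF zero_less_one], where 'a=real] Kop_continuous[of "\<lambda>_::real. 1" 1 c] c
      by (intro integrable_cube[where C = "2 / c"] continuous_cubeM) (auto simp: abs_of_pos)
  qed (use ni le in \<open>auto simp: space_cubeM cbox_One_real\<close>)
  also have "\<dots> = 1 + c\<^sup>2 / 2 - c * slope TYPE(real) 0"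
    using ni by (simp add: slope_zero cube.prob_space)
  finally have "(\<integral>s. Kop c (\<lambda>_. 1) s \<partial>(cubeM :: real measure)) \<le> 1 - c / 3 + c\<^sup>2 / 2" by (simp add: slope_zero_real)
  then show ?thesis using dual_le_const[of c 1, where 'a=real] c by simp
qed

text \<open>The supporting line at 0 bounds the value from below, and the trial function 1 bounds it
  from above with an error of at most c^2 / 2.\<close>

lemma V_G_real_expansion: "(\<lambda>c. V_G TYPE(real) c - (ln 2 - 1 - c / 3)) \<in> O[at_right 0](\<lambda>c. c\<^sup>2)"
proof (rule bigoI)
  have "norm (V_G TYPE(real) c - (ln 2 - 1 - c / 3)) \<le> 1 / 2 * norm (c\<^sup>2)" if "0 < c" for c
    using dual_value_real_upper[OF that] dual_value_ge[of c, where 'a=real] that slope_zero_real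
    by (simp add: V_G_eq abs_le_iff)
  then show "\<forall>\<^sub>F c in at_right 0. norm (V_G TYPE(real) c - (ln 2 - 1 - c / 3)) \<le> 1 / 2 * norm (c\<^sup>2)"
    by (auto simp: eventually_at_right_field intro!: exI[of _ 1])
qed

section \<open>Analyticity\<close>

text \<open>Taylor coefficients at a point of the solution of \<open>b' = 1 - b\<^sup>2 - k v\<^sup>2\<close>, \<open>v' = - v b\<close>, \<open>y' = y b\<close>
  with initial value \<open>(b, v, y)\<close>. With \<open>b = y' / y\<close> and \<open>v = 1 / y\<close> this polynomial system encodes
  \<open>y'' = y - k / y\<close>.\<close>

function taylor_coeffs :: "real \<Rightarrow> real \<times> real \<times> real \<Rightarrow> nat \<Rightarrow> real \<times> real \<times> real" where
  "taylor_coeffs k p 0 = p"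
| "taylor_coeffs k p (Suc n) =
    (((if n = 0 then 1 else 0) -
        (\<Sum>i\<le>n. fst (taylor_coeffs k p i) * fst (taylor_coeffs k p (n - i))) -
        k * (\<Sum>i\<le>n. fst (snd (taylor_coeffs k p i)) * fst (snd (taylor_coeffs k p (n - i))))) / Suc n,
     - (\<Sum>i\<le>n. fst (snd (taylor_coeffs k p i)) * fst (taylor_coeffs k p (n - i))) / Suc n,
     (\<Sum>i\<le>n. snd (snd (taylor_coeffs k p i)) * fst (taylor_coeffs k p (n - i))) / Suc n)"
  by pat_completeness auto
termination by (relation "Wellfounded.measure (snd \<circ> snd)") auto

text \<open>A convolution of index n has n + 1 terms, which the division by n + 1 in the recursion
  compensates, so a geometric bound reproduces itself. In R = (2 + k) M the 2 pays for the constant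
  1 and for b^2, and k for k v^2.\<close>

lemma taylor_coeffs_bound:
  assumes k: "0 \<le> k" and M: "1 \<le> M"
    and p: "\<bar>fst p\<bar> \<le> M" "\<bar>fst (snd p)\<bar> \<le> M" "\<bar>snd (snd p)\<bar> \<le> M"
  defines "R \<equiv> (2 + k) * M"
  shows "\<bar>fst (taylor_coeffs k p n)\<bar> \<le> M * R ^ n \<and> \<bar>fst (snd (taylor_coeffs k p n))\<bar> \<le> M * R ^ n \<and>
    \<bar>snd (snd (taylor_coeffs k p n))\<bar> \<le> M * R ^ n"
proof (induction n rule: less_induct)
  case (less n)
  have R: "1 \<le> R" unfolding R_def using k M mult_mono[of 1 "2 + k" 1 M] by simp
  show ?case
  proof (cases n)
    case 0
    then show ?thesis using p by simp
  next
    case (Suc m)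
    let ?b = "\<lambda>i. fst (taylor_coeffs k p i)" and ?v = "\<lambda>i. fst (snd (taylor_coeffs k p i))"
      and ?y = "\<lambda>i. snd (snd (taylor_coeffs k p i))"
    have IH: "\<bar>?b i\<bar> \<le> M * R ^ i" "\<bar>?v i\<bar> \<le> M * R ^ i" "\<bar>?y i\<bar> \<le> M * R ^ i" if "i \<le> m" for i
      using less[of i] that Suc by auto
    define K where "K = M * M * R ^ m"
    have conv: "\<bar>\<Sum>i\<le>m. f i * g (m - i)\<bar> \<le> Suc m * K"
      if f: "\<And>i. i \<le> m \<Longrightarrow> \<bar>f i\<bar> \<le> M * R ^ i" and g: "\<And>i. i \<le> m \<Longrightarrow> \<bar>g i\<bar> \<le> M * R ^ i" for f g :: "nat \<Rightarrow> real"
    proof -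
      have "\<bar>\<Sum>i\<le>m. f i * g (m - i)\<bar> \<le> (\<Sum>i\<le>m. \<bar>f i * g (m - i)\<bar>)" by (rule sum_abs)
      also have "\<dots> \<le> (\<Sum>i\<le>m. K)"
      proof (rule sum_mono)
        fix i assume i: "i \<in> {..m}"
        have "\<bar>f i\<bar> * \<bar>g (m - i)\<bar> \<le> (M * R ^ i) * (M * R ^ (m - i))"
          using i f[of i] g[of "m - i"] M R by (intro mult_mono) auto
        also have "\<dots> = M * M * (R ^ i * R ^ (m - i))" by (simp only: mult_ac)
        also have "R ^ i * R ^ (m - i) = R ^ m" using i by (simp flip: power_add)
        finally show "\<bar>f i * g (m - i)\<bar> \<le> K" by (simp add: K_def abs_mult)
      qed
      finally show ?thesis by simp
    qed
    have K: "1 \<le> K"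
    proof -
      have "1 * 1 \<le> M * M" using M by (intro mult_mono) auto
      then have "1 * 1 \<le> (M * M) * R ^ m" using M one_le_power[OF R, of m] by (intro mult_mono) auto
      then show ?thesis by (simp add: K_def)
    qed
    have MR: "M * R ^ n = (2 + k) * K" by (simp add: Suc R_def K_def)
    have "\<bar>(if m = 0 then 1 else 0) - (\<Sum>i\<le>m. ?b i * ?b (m - i)) - k * (\<Sum>i\<le>m. ?v i * ?v (m - i))\<bar>
        \<le> K + Suc m * K + k * (Suc m * K)"
    proof -
      have "\<bar>(if m = 0 then 1 else 0 :: real)\<bar> \<le> K" using K by simp
      moreover have "\<bar>\<Sum>i\<le>m. ?b i * ?b (m - i)\<bar> \<le> Suc m * K" by (rule conv) (rule IH; assumption)+
      moreover have "\<bar>k * (\<Sum>i\<le>m. ?v i * ?v (m - i))\<bar> \<le> k * (Suc m * K)"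
        unfolding abs_mult abs_of_nonneg[OF k] using k by (intro mult_left_mono conv) (auto intro: IH)
      ultimately show ?thesis by linarith
    qed
    also have "\<dots> \<le> Suc m * ((2 + k) * K)" using K by (simp add: algebra_simps)
    finally have 1: "\<bar>?b n\<bar> \<le> M * R ^ n" unfolding MR by (simp add: Suc abs_divide pos_divide_le_eq mult.commute)
    have "Suc m * K \<le> Suc m * ((2 + k) * K)" using K k by (intro mult_left_mono) (auto simp: algebra_simps)
    moreover have "\<bar>\<Sum>i\<le>m. ?v i * ?b (m - i)\<bar> \<le> Suc m * K" "\<bar>\<Sum>i\<le>m. ?y i * ?b (m - i)\<bar> \<le> Suc m * K"
      by (rule conv; rule IH; assumption)+
    ultimately have "\<bar>\<Sum>i\<le>m. ?v i * ?b (m - i)\<bar> \<le> Suc m * ((2 + k) * K)" "\<bar>\<Sum>i\<le>m. ?y i * ?b (m - i)\<bar> \<le> Suc m * ((2 + k) * K)"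
      by linarith+
    then have "\<bar>?v n\<bar> \<le> M * R ^ n" "\<bar>?y n\<bar> \<le> M * R ^ n"
      unfolding MR by (simp_all add: Suc abs_divide pos_divide_le_eq mult.commute)
    then show ?thesis using 1 by blast
  qed
qed

text \<open>The Leibniz rule at the level of coefficients: the weights i and n + 1 - i of the two
  factors add up to n + 1.\<close>

lemma convolution_derivative:
  fixes a c :: "nat \<Rightarrow> real"
  shows "(\<Sum>i\<le>n. (Suc i * a (Suc i)) * c (n - i) + a i * (Suc (n - i) * c (Suc (n - i)))) =
    Suc n * (\<Sum>i\<le>Suc n. a i * c (Suc n - i))"
proof -
  have 1: "(\<Sum>i\<le>n. (Suc i * a (Suc i)) * c (n - i)) = (\<Sum>i\<le>Suc n. (i * a i) * c (Suc n - i))"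
    unfolding sum.atMost_Suc_shift by simp
  have "(\<Sum>i\<le>Suc n. a i * ((Suc n - i) * c (Suc n - i))) =
      (\<Sum>i\<le>n. a i * ((Suc n - i) * c (Suc n - i))) + a (Suc n) * ((Suc n - Suc n) * c (Suc n - Suc n))"
    by (rule sum.atMost_Suc)
  also have "\<dots> = (\<Sum>i\<le>n. a i * (Suc (n - i) * c (Suc (n - i))))"
    unfolding diff_self_eq_0 of_nat_0 mult_zero_left mult_zero_right add_0_right
    by (intro sum.cong refl) (simp only: atMost_iff Suc_diff_le)
  finally have 2: "(\<Sum>i\<le>n. a i * (Suc (n - i) * c (Suc (n - i)))) = (\<Sum>i\<le>Suc n. a i * ((Suc n - i) * c (Suc n - i)))" ..
  show ?thesis
    unfolding sum.distrib 1 2 sum_distrib_left unfolding sum.distrib[symmetric]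
  proof (intro sum.cong refl)
    fix i assume "i \<in> {..Suc n}"
    then have "real (Suc n - i) = real (Suc n) - real i" by (intro of_nat_diff) simp
    then show "real i * a i * c (Suc n - i) + a i * (real (Suc n - i) * c (Suc n - i)) =
        real (Suc n) * (a i * c (Suc n - i))"
      by (simp only:) (simp add: left_diff_distrib right_diff_distrib mult_ac)
  qed
qed

text \<open>The base point is allowed to move. The coefficients at s are polynomials in b s, v s and
  y s, so the system itself differentiates them; n! times the n-th coefficient is thereby the n-th
  derivative.\<close>

lemma taylor_coeffs_derivative:
  fixes b v y :: "real \<Rightarrow> real" and k s :: real and S :: "real set"
    and T :: "nat \<Rightarrow> real \<Rightarrow> real \<times> real \<times> real"
  assumes b: "\<And>s. s \<in> S \<Longrightarrow> (b has_real_derivative 1 - (b s)\<^sup>2 - k * (v s)\<^sup>2) (at s within S)"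
    and v: "\<And>s. s \<in> S \<Longrightarrow> (v has_real_derivative - v s * b s) (at s within S)"
    and y: "\<And>s. s \<in> S \<Longrightarrow> (y has_real_derivative y s * b s) (at s within S)"
    and s: "s \<in> S"
  defines "T \<equiv> \<lambda>n s. taylor_coeffs k (b s, v s, y s) n"
  shows "((\<lambda>s. fst (T n s)) has_real_derivative Suc n * fst (T (Suc n) s)) (at s within S) \<and>
    ((\<lambda>s. fst (snd (T n s))) has_real_derivative Suc n * fst (snd (T (Suc n) s))) (at s within S) \<and>
    ((\<lambda>s. snd (snd (T n s))) has_real_derivative Suc n * snd (snd (T (Suc n) s))) (at s within S)"
proof (induction n rule: less_induct)
  case (less n)
  let ?B = "\<lambda>n s. fst (T n s)" and ?V = "\<lambda>n s. fst (snd (T n s))" and ?Y = "\<lambda>n s. snd (snd (T n s))"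
  have B_Suc: "?B (Suc n) s = ((if n = 0 then 1 else 0) - (\<Sum>i\<le>n. ?B i s * ?B (n - i) s) - k * (\<Sum>i\<le>n. ?V i s * ?V (n - i) s)) / Suc n"
    and V_Suc: "?V (Suc n) s = - (\<Sum>i\<le>n. ?V i s * ?B (n - i) s) / Suc n"
    and Y_Suc: "?Y (Suc n) s = (\<Sum>i\<le>n. ?Y i s * ?B (n - i) s) / Suc n" for n s
    by (simp_all add: T_def)
  show ?case
  proof (cases n)
    case 0
    then show ?thesis using b[OF s] v[OF s] y[OF s] by (simp add: T_def power2_eq_square)
  next
    case (Suc m)
    have IH: "(?B i has_real_derivative Suc i * ?B (Suc i) s) (at s within S)"
      "(?V i has_real_derivative Suc i * ?V (Suc i) s) (at s within S)"
      "(?Y i has_real_derivative Suc i * ?Y (Suc i) s) (at s within S)" if "i \<le> m" for i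
      using less[of i] that Suc by auto
    have conv: "((\<lambda>s. \<Sum>i\<le>m. f i s * g (m - i) s) has_real_derivative
        Suc m * (\<Sum>i\<le>Suc m. f i s * g (Suc m - i) s)) (at s within S)"
      if f: "\<And>i. i \<le> m \<Longrightarrow> (f i has_real_derivative Suc i * f (Suc i) s) (at s within S)"
        and g: "\<And>i. i \<le> m \<Longrightarrow> (g i has_real_derivative Suc i * g (Suc i) s) (at s within S)" for f g :: "nat \<Rightarrow> real \<Rightarrow> real"
    proof -
      have "((\<lambda>s. \<Sum>i\<le>m. f i s * g (m - i) s) has_real_derivative
         (\<Sum>i\<le>m. f i s * (Suc (m - i) * g (Suc (m - i)) s) + Suc i * f (Suc i) s * g (m - i) s)) (at s within S)"
        by (intro DERIV_sum DERIV_mult' f g) auto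
      then show ?thesis
        using convolution_derivative[of "\<lambda>i. f i s" "\<lambda>i. g i s" m] by (simp add: add.commute)
    qed
    define bb vv vb yb where "bb = (\<Sum>i\<le>Suc m. ?B i s * ?B (Suc m - i) s)" and "vv = (\<Sum>i\<le>Suc m. ?V i s * ?V (Suc m - i) s)"
      and "vb = (\<Sum>i\<le>Suc m. ?V i s * ?B (Suc m - i) s)" and "yb = (\<Sum>i\<le>Suc m. ?Y i s * ?B (Suc m - i) s)"
    have "(?B (Suc m) has_real_derivative (0 - Suc m * bb - k * (Suc m * vv)) / Suc m) (at s within S)"
      unfolding B_Suc[abs_def] bb_def vv_def
      by (intro DERIV_cdivide DERIV_diff DERIV_const DERIV_cmult conv IH)
    also have "(0 - Suc m * bb - k * (Suc m * vv)) / Suc m = Suc n * ?B (Suc n) s"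
      unfolding B_Suc Suc bb_def[symmetric] vv_def[symmetric] by (simp add: field_simps del: of_nat_Suc)
    finally have 1: "(?B n has_real_derivative Suc n * ?B (Suc n) s) (at s within S)" by (simp only: Suc)
    have "(?V (Suc m) has_real_derivative - (Suc m * vb) / Suc m) (at s within S)"
      unfolding V_Suc[abs_def] vb_def by (intro DERIV_cdivide DERIV_minus conv IH)
    also have "- (Suc m * vb) / Suc m = Suc n * ?V (Suc n) s"
      unfolding V_Suc Suc vb_def[symmetric] by (simp add: field_simps del: of_nat_Suc)
    finally have 2: "(?V n has_real_derivative Suc n * ?V (Suc n) s) (at s within S)" by (simp only: Suc)
    have "(?Y (Suc m) has_real_derivative (Suc m * yb) / Suc m) (at s within S)"
      unfolding Y_Suc[abs_def] yb_def by (intro DERIV_cdivide conv IH)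
    also have "(Suc m * yb) / Suc m = Suc n * ?Y (Suc n) s"
      unfolding Y_Suc Suc yb_def[symmetric] by (simp add: field_simps del: of_nat_Suc)
    finally have "(?Y n has_real_derivative Suc n * ?Y (Suc n) s) (at s within S)" by (simp only: Suc)
    then show ?thesis using 1 2 by blast
  qed
qed

text \<open>The coefficient bound is uniform over the compact interval, so one radius 1 / R serves
  every base point, including the end points with their one-sided derivatives.\<close>

lemma positive_bvp_analytic:
  assumes c: "0 < c" and sol: "positive_bvp_solution c y y'"
  shows "real_analytic_on {0..c} y"
proof -
  let ?S = "{0..c}"
  have ypos: "\<And>s. s \<in> ?S \<Longrightarrow> 0 < y s"
    and dy: "\<And>s. s \<in> ?S \<Longrightarrow> (y has_real_derivative y' s) (at s within ?S)"
    and dy': "\<And>s. s \<in> ?S \<Longrightarrow> (y' has_real_derivative - 2 / (c * y s) + y s) (at s within ?S)"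
    using sol unfolding positive_bvp_solution_def by auto
  define b v k where "b s = y' s / y s" and "v s = 1 / y s" and "k = 2 / c" for s
  have k: "0 \<le> k" using c by (simp add: k_def)
  have db: "(b has_real_derivative 1 - (b s)\<^sup>2 - k * (v s)\<^sup>2) (at s within ?S)" if s: "s \<in> ?S" for s
    unfolding b_def v_def k_def using ypos[OF s] c
    by (auto intro!: derivative_eq_intros dy[OF s] dy'[OF s] simp: field_simps power2_eq_square)
  have dv: "(v has_real_derivative - v s * b s) (at s within ?S)" if s: "s \<in> ?S" for s
    unfolding b_def v_def using ypos[OF s] c
    by (auto intro!: derivative_eq_intros dy[OF s] simp: field_simps power2_eq_square)
  have dyb: "(y has_real_derivative y s * b s) (at s within ?S)" if s: "s \<in> ?S" for s
    unfolding b_def using ypos[OF s] dy[OF s] by simp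
  define a where "a n s = snd (snd (taylor_coeffs k (b s, v s, y s) n))" for n s
  have da: "(a n has_real_derivative Suc n * a (Suc n) s) (at s within ?S)" if "s \<in> ?S" for n s
    using taylor_coeffs_derivative[of ?S b k v y s n, OF db dv dyb that] unfolding a_def by blast
  have cont: "continuous_on ?S b" "continuous_on ?S v" "continuous_on ?S y"
    by (rule DERIV_continuous_on[OF db] DERIV_continuous_on[OF dv] DERIV_continuous_on[OF dyb]; assumption)+
  have bd: "\<exists>B. \<forall>s\<in>?S. \<bar>f s\<bar> \<le> B" if "continuous_on ?S f" for f :: "real \<Rightarrow> real"
    using compact_imp_bounded[OF compact_continuous_image[OF that compact_Icc]] by (auto simp: bounded_iff)
  obtain B1 B2 B3 where B: "\<forall>s\<in>?S. \<bar>b s\<bar> \<le> B1" "\<forall>s\<in>?S. \<bar>v s\<bar> \<le> B2" "\<forall>s\<in>?S. \<bar>y s\<bar> \<le> B3"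
    using bd[OF cont(1)] bd[OF cont(2)] bd[OF cont(3)] by blast
  define M where "M = max 1 (max B1 (max B2 B3))"
  have M: "1 \<le> M" by (simp add: M_def)
  define R where "R = (2 + k) * M"
  have R: "0 < R" using M k by (simp add: R_def add_pos_nonneg)
  have a_le: "\<bar>a n s\<bar> \<le> M * R ^ n" if "s \<in> ?S" for n s
  proof -
    have "\<bar>b s\<bar> \<le> M" "\<bar>v s\<bar> \<le> M" "\<bar>y s\<bar> \<le> M"
      using bspec[OF B(1) that] bspec[OF B(2) that] bspec[OF B(3) that] unfolding M_def by linarith+
    then show ?thesis
      using taylor_coeffs_bound[OF k M, of "(b s, v s, y s)" n] unfolding a_def R_def by simp
  qed
  show ?thesis unfolding real_analytic_on_def
  proof
    fix x assume x: "x \<in> ?S"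
    have "(\<lambda>n. a n x * (z - x) ^ n) sums y z" if z: "z \<in> ?S" "\<bar>z - x\<bar> < 1 / R" for z
    proof -
      define q where "q = R * \<bar>z - x\<bar>"
      have q: "0 \<le> q" "q < 1" using z R by (simp_all add: q_def field_simps)
      \<comment> \<open>The Taylor estimate divides by n! only, so a factor n + 1 remains; it is
        harmless against q^(n + 1).\<close>
      have rem: "\<bar>y z - (\<Sum>i\<le>n. a i x * (z - x) ^ i)\<bar> \<le> M * (real (Suc n) * q ^ Suc n)" for n
      proof -
        have "norm (fact 0 * a 0 z - (\<Sum>i\<le>n. fact i * a i x * (z - x) ^ i / fact i))
            \<le> (fact (Suc n) * (M * R ^ Suc n)) * norm (z - x) ^ Suc n / fact n"
        proof (rule field_Taylor[of ?S n "\<lambda>i s. fact i * a i s"])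
          show "((\<lambda>s. fact i * a i s) has_field_derivative fact (Suc i) * a (Suc i) s) (at s within ?S)"
            if "s \<in> ?S" for i s
            using DERIV_cmult[OF da[OF that, of i], of "fact i"] by (simp add: algebra_simps)
          show "norm (fact (Suc n) * a (Suc n) s) \<le> fact (Suc n) * (M * R ^ Suc n)" if "s \<in> ?S" for s
            using a_le[OF that, of "Suc n"] by (simp add: abs_mult del: fact_Suc power_Suc)
        qed (use x z in auto)
        also have "(fact (Suc n) * (M * R ^ Suc n)) * norm (z - x) ^ Suc n / fact n = M * (real (Suc n) * q ^ Suc n)"
          by (simp add: q_def power_mult_distrib)
        also have "a 0 z = y z" by (simp add: a_def)
        finally show ?thesis by simp
      qed
      have "(\<lambda>n. real n * q ^ n) \<longlonglongrightarrow> 0" using q by (intro powser_times_n_limit_0) simp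
      then have "(\<lambda>n. M * (real (Suc n) * q ^ Suc n)) \<longlonglongrightarrow> 0"
        by (intro tendsto_mult_right_zero) (rule LIMSEQ_Suc)
      then have "(\<lambda>n. y z - (\<Sum>i\<le>n. a i x * (z - x) ^ i)) \<longlonglongrightarrow> 0"
        by (rule Lim_null_comparison[rotated]) (intro always_eventually allI, simp only: real_norm_def, rule rem)
      then have "(\<lambda>n. y z - (y z - (\<Sum>i\<le>n. a i x * (z - x) ^ i))) \<longlonglongrightarrow> y z - 0"
        by (intro tendsto_diff tendsto_const)
      then show ?thesis by (simp add: sums_def_le)
    qed
    then show "\<exists>a r. 0 < r \<and> (\<forall>z\<in>?S. \<bar>z - x\<bar> < r \<longrightarrow> (\<lambda>n. a n * (z - x) ^ n) sums y z)"
      using R by (intro exI[of _ "\<lambda>n. a n x"] exI[of _ "1 / R"]) auto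
  qed
qed

section \<open>Smoothness in dimension one\<close>

lemma has_real_derivative_inverse:
  fixes f g :: "real \<Rightarrow> real"
  assumes "(f has_real_derivative f') (at (g y))" "f' \<noteq> 0" "open S" "continuous_on S f" "g y \<in> S" "f (g y) = y"
    "\<And>z. z \<in> S \<Longrightarrow> g (f z) = z"
  shows "(g has_real_derivative inverse f') (at y)"
  unfolding has_field_derivative_def
  by (rule has_derivative_inverse_strong_x[of S g y f "(*) f'"])
     (use assms in \<open>auto simp: has_field_derivative_def fun_eq_iff\<close>)

section \<open>A function of Lambert type and its inverse\<close>

text \<open>This is the function of ln (h / h 0) in the energy identity. It increases up to p = 1 /
  2, where it reaches its maximum 1 / (2 e); only the branch below is inverted.\<close>

definition lamb :: "real \<Rightarrow> real" where "lamb p = p * exp (- 2 * p)"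

lemma lamb_derivative: "(lamb has_real_derivative (1 - 2 * p) * exp (- 2 * p)) (at p)"
  unfolding lamb_def by (auto intro!: derivative_eq_intros simp: algebra_simps)

lemma lamb_half: "lamb (1 / 2) = 1 / (2 * exp 1)"
  by (simp add: lamb_def exp_minus field_simps)

lemma lamb_less: "p < q \<Longrightarrow> q \<le> 1 / 2 \<Longrightarrow> lamb p < lamb q"
  by (rule DERIV_pos_imp_increasing_open[of p q lamb])
     (use lamb_derivative in \<open>force intro: continuous_at_imp_continuous_on DERIV_isCont[OF lamb_derivative]\<close>)+

lemma lamb_le_half: "lamb p \<le> 1 / (2 * exp 1)"
proof -
  have "2 * p \<le> exp (2 * p - 1)" using exp_ge_add_one_self[of "2 * p - 1"] by simp
  then have "p * exp (- 2 * p) \<le> exp (2 * p - 1) * exp (- 2 * p) / 2" by simp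
  also have "exp (2 * p - 1) * exp (- 2 * p) = exp (- 1)" by (simp flip: exp_add)
  finally show ?thesis by (simp add: lamb_def exp_minus field_simps)
qed

lemma lamb_surj:
  assumes x: "x < 1 / (2 * exp 1)"
  shows "\<exists>p<1 / 2. lamb p = x"
proof -
  \<comment> \<open>A left end point for the intermediate value theorem: if x < 0 then lamb x \<le>
    x because exp (- 2 x) \<ge> 1, and if x \<ge> 0 then lamb 0 = 0 suffices.\<close>
  define l where "l = min 0 x"
  have l: "l \<le> 1 / 2" "lamb l \<le> x"
  proof -
    show "l \<le> 1 / 2" by (simp add: l_def)
    have "l * exp (- 2 * l) \<le> l * 1" by (rule mult_left_mono_neg) (simp_all add: l_def)
    then show "lamb l \<le> x" by (simp add: lamb_def l_def)
  qed
  have "\<exists>p. l \<le> p \<and> p \<le> 1 / 2 \<and> lamb p = x"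
    using x by (intro IVT' l continuous_at_imp_continuous_on ballI DERIV_isCont[OF lamb_derivative]) (simp add: lamb_half)
  then obtain p where p: "p \<le> 1 / 2" "lamb p = x" by blast
  moreover have "p \<noteq> 1 / 2"
  proof
    assume "p = 1 / 2"
    with p(2) have "lamb (1 / 2) = x" by (simp only:)
    with x show False unfolding lamb_half by simp
  qed
  ultimately show ?thesis by (intro exI[of _ p]) auto
qed

text \<open>A rescaled Lambert function; junk for arguments \<open>\<ge> 1 / (2 * exp 1)\<close>.\<close>

definition lambinv :: "real \<Rightarrow> real" where
  "lambinv x = (THE p. p < 1 / 2 \<and> lamb p = x)"

lemma lambinv_lamb: "p < 1 / 2 \<Longrightarrow> lambinv (lamb p) = p"
  unfolding lambinv_def
proof (rule the_equality)
  fix q assume "p < 1 / 2" "q < 1 / 2 \<and> lamb q = lamb p"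
  then show "q = p" using lamb_less[of p q] lamb_less[of q p] by (cases p q rule: linorder_cases) auto
qed auto

lemma lambinv:
  assumes "x < 1 / (2 * exp 1)"
  shows "lambinv x < 1 / 2" "lamb (lambinv x) = x"
  using lamb_surj[OF assms] lambinv_lamb by auto

lemma lambinv_derivative:
  assumes x: "x < 1 / (2 * exp 1)"
  shows "(lambinv has_real_derivative exp (2 * lambinv x) / (1 - 2 * lambinv x)) (at x)"
proof -
  have "(lambinv has_real_derivative inverse ((1 - 2 * lambinv x) * exp (- 2 * lambinv x))) (at x)"
  proof (rule has_real_derivative_inverse[of lamb _ lambinv x "{..<1 / 2}"])
    show "(lamb has_real_derivative (1 - 2 * lambinv x) * exp (- 2 * lambinv x)) (at (lambinv x))"
      by (rule lamb_derivative)
    show "continuous_on {..<1 / 2} lamb"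
      by (intro continuous_at_imp_continuous_on ballI DERIV_isCont[OF lamb_derivative])
  qed (use lambinv[OF x] lambinv_lamb in auto)
  then show ?thesis using lambinv[OF x] by (simp add: exp_minus field_simps)
qed

text \<open>This shape is stable under differentiation: the derivative exp (2 P) / (1 - 2 P) of P =
  lambinv x raises i by one and j by one or two.\<close>

definition lphi :: "nat \<Rightarrow> nat \<Rightarrow> real \<Rightarrow> real" where
  "lphi i j x = exp (2 * i * lambinv x) / (1 - 2 * lambinv x) ^ j"

lemma lphi_derivative:
  assumes x: "x < 1 / (2 * exp 1)"
  shows "(lphi i j has_real_derivative 2 * real i * lphi (i + 1) (j + 1) x + 2 * real j * lphi (i + 1) (j + 2) x) (at x)"
proof -
  define P where "P = lambinv x"
  define q where "q = 1 - 2 * P"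
  have q: "0 < q" using lambinv[OF x] by (simp add: P_def q_def)
  have D: "(lambinv has_real_derivative exp (2 * P) / q) (at x)"
    using lambinv_derivative[OF x] by (simp add: P_def q_def)
  have "((\<lambda>x. (1 - 2 * lambinv x) powi (- int j)) has_real_derivative 2 * j * (exp (2 * P) / q) * q powi (- int j - 1)) (at x)"
    using q by (auto intro!: derivative_eq_intros D simp: P_def[symmetric] q_def[symmetric])
  moreover have "((\<lambda>x. exp (2 * i * lambinv x)) has_real_derivative exp (2 * i * P) * (2 * i * (exp (2 * P) / q))) (at x)"
    by (auto intro!: derivative_eq_intros D simp: P_def[symmetric])
  ultimately have "((\<lambda>x. exp (2 * i * lambinv x) * (1 - 2 * lambinv x) powi (- int j)) has_real_derivative
      exp (2 * i * P) * (2 * j * (exp (2 * P) / q) * q powi (- int j - 1)) +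
      exp (2 * i * P) * (2 * i * (exp (2 * P) / q)) * q powi (- int j)) (at x)"
    using DERIV_mult'[of "\<lambda>x. exp (2 * i * lambinv x)" _ x UNIV] unfolding P_def q_def by blast
  moreover have "exp (2 * i * P) * (2 * j * (exp (2 * P) / q) * q powi (- int j - 1)) +
      exp (2 * i * P) * (2 * i * (exp (2 * P) / q)) * q powi (- int j) =
      2 * i * (exp (2 * real (i + 1) * P) / q ^ (j + 1)) + 2 * j * (exp (2 * real (i + 1) * P) / q ^ (j + 2))"
    using q by (simp add: power_int_minus power_int_diff divide_inverse exp_add distrib_left distrib_right mult_ac power_inverse)
  ultimately show ?thesis
    by (simp add: lphi_def[abs_def] power_int_minus divide_inverse P_def[symmetric] q_def[symmetric])
qed

lemma lphi_continuous: "continuous_on {..<1 / (2 * exp 1)} (lphi i j)"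
  by (intro continuous_at_imp_continuous_on ballI) (use DERIV_isCont[OF lphi_derivative] in auto)

lemma lphi_pos: "x < 1 / (2 * exp 1) \<Longrightarrow> 0 < lphi i j x"
  using lambinv(1)[of x] by (simp add: lphi_def)

section \<open>Parameter integrals over the logarithmic derivative\<close>

text \<open>The range of w does not depend on g, and for g in \<open>gset\<close> the argument g (1
  - w^2) stays below the branch value 1 / (2 e), so one can differentiate under the integral. Each
  derivative releases one more factor 1 - w^2, counted by k.\<close>

definition Mint :: "nat \<Rightarrow> nat \<Rightarrow> nat \<Rightarrow> real \<Rightarrow> real" where
  "Mint i j k g = integral {-1..1} (\<lambda>w. lphi i j (g * (1 - w\<^sup>2)) * (1 - w\<^sup>2) ^ k)"

abbreviation gset :: "real set" where "gset \<equiv> {0<..<1 / (2 * exp 1)}"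

lemma gset_arg:
  assumes "g \<in> gset" "w \<in> {-1..1}"
  shows "g * (1 - w\<^sup>2) < 1 / (2 * exp 1)" "0 \<le> 1 - w\<^sup>2"
proof -
  show 1: "0 \<le> 1 - w\<^sup>2" using assms by (simp add: abs_square_le_1 abs_le_iff)
  have "g * (1 - w\<^sup>2) \<le> g * 1" using assms 1 by (intro mult_left_mono) auto
  also have "g * 1 < 1 / (2 * exp 1)" using assms by simp
  finally show "g * (1 - w\<^sup>2) < 1 / (2 * exp 1)" .
qed

lemma Mint_integrand_continuous:
  "continuous_on (gset \<times> {-1..1}) (\<lambda>(g, w). lphi i j (g * (1 - w\<^sup>2)) * (1 - w\<^sup>2) ^ k)"
  unfolding case_prod_beta
  by (intro continuous_intros continuous_on_compose2[OF lphi_continuous]) (use gset_arg in auto)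

lemma Mint_integrable:
  assumes "g \<in> gset"
  shows "continuous_on {-1..1} (\<lambda>w. lphi i j (g * (1 - w\<^sup>2)) * (1 - w\<^sup>2) ^ k)"
  by (intro continuous_intros continuous_on_compose2[OF lphi_continuous]) (use gset_arg[OF assms] in auto)

lemma Mint_derivative:
  assumes g: "g \<in> gset"
  shows "(Mint i j k has_real_derivative
     2 * real i * Mint (i + 1) (j + 1) (k + 1) g + 2 * real j * Mint (i + 1) (j + 2) (k + 1) g) (at g)"
proof -
  let ?f = "\<lambda>i j k g w. lphi i j (g * (1 - w\<^sup>2)) * (1 - w\<^sup>2) ^ k"
  have alg: "(x * A + y * B) * r * r ^ k = x * (A * r ^ (k + 1)) + y * (B * r ^ (k + 1))" for x y A B r :: real
    by (simp add: algebra_simps)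
  let ?f' = "\<lambda>g w. 2 * real i * ?f (i + 1) (j + 1) (k + 1) g w + 2 * real j * ?f (i + 1) (j + 2) (k + 1) g w"
  have "((\<lambda>g. integral (cbox (-1) 1) (?f i j k g)) has_real_derivative integral (cbox (-1) 1) (?f' g)) (at g within gset)"
  proof (rule leibniz_rule_field_derivative)
    fix g w :: real assume gw: "g \<in> gset" "w \<in> cbox (-1) 1"
    then have x: "g * (1 - w\<^sup>2) < 1 / (2 * exp 1)" using gset_arg by auto
    have "((\<lambda>g. lphi i j (g * (1 - w\<^sup>2))) has_real_derivative
       (2 * real i * lphi (i + 1) (j + 1) (g * (1 - w\<^sup>2)) + 2 * real j * lphi (i + 1) (j + 2) (g * (1 - w\<^sup>2))) * (1 - w\<^sup>2)) (at g)"
      by (rule DERIV_chain2[where f = "lphi i j" and g = "\<lambda>g. g * (1 - w\<^sup>2)", OF lphi_derivative[OF x]])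
         (auto intro!: derivative_eq_intros)
    then have "((\<lambda>g. ?f i j k g w) has_real_derivative
       (2 * real i * lphi (i + 1) (j + 1) (g * (1 - w\<^sup>2)) + 2 * real j * lphi (i + 1) (j + 2) (g * (1 - w\<^sup>2))) * (1 - w\<^sup>2) *
         (1 - w\<^sup>2) ^ k) (at g within gset)"
      by (rule DERIV_cmult_right[OF has_field_derivative_at_within])
    also have "(2 * real i * lphi (i + 1) (j + 1) (g * (1 - w\<^sup>2)) + 2 * real j * lphi (i + 1) (j + 2) (g * (1 - w\<^sup>2))) * (1 - w\<^sup>2) *
         (1 - w\<^sup>2) ^ k = ?f' g w"
      by (rule alg)
    finally show "((\<lambda>g. ?f i j k g w) has_real_derivative ?f' g w) (at g within gset)" .
  next
    show "?f i j k g integrable_on cbox (-1) 1" if "g \<in> gset" for g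
      using integrable_continuous_real[OF Mint_integrable[OF that]] by simp
    have "continuous_on (gset \<times> {-1..1})
      (\<lambda>p. 2 * real i * (\<lambda>(g, w). ?f (i + 1) (j + 1) (k + 1) g w) p + 2 * real j * (\<lambda>(g, w). ?f (i + 1) (j + 2) (k + 1) g w) p)"
      by (intro continuous_intros Mint_integrand_continuous)
    then show "continuous_on (gset \<times> cbox (-1) 1) (\<lambda>(g, w). ?f' g w)" by (simp add: case_prod_beta)
  qed (use g in auto)
  moreover have "integral (cbox (-1) 1) (?f' g) =
     2 * real i * Mint (i + 1) (j + 1) (k + 1) g + 2 * real j * Mint (i + 1) (j + 2) (k + 1) g"
  proof -
    have i: "?f i j k g integrable_on {-1..1}" for i j k
      by (rule integrable_continuous_real[OF Mint_integrable[OF g]])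
    have "integral {-1..1} (?f' g) = integral {-1..1} (\<lambda>w. 2 * real i * ?f (i + 1) (j + 1) (k + 1) g w) +
        integral {-1..1} (\<lambda>w. 2 * real j * ?f (i + 1) (j + 2) (k + 1) g w)"
      by (rule Henstock_Kurzweil_Integration.integral_add) (rule integrable_on_mult_right[OF i])+
    then show ?thesis by (simp only: Mint_def cbox_interval integral_mult_right)
  qed
  ultimately show ?thesis
    using g by (simp add: Mint_def[abs_def] at_within_open[of g gset])
qed

lemma Mint_nonneg: "g \<in> gset \<Longrightarrow> 0 \<le> Mint i j k g"
  unfolding Mint_def
  by (intro integral_nonneg integrable_continuous_real Mint_integrable mult_nonneg_nonneg less_imp_le[OF lphi_pos]
      zero_le_power gset_arg)

lemma Mint_pos:
  assumes g: "g \<in> gset"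
  shows "0 < Mint i j 0 g"
proof -
  let ?F = "\<lambda>w. lphi i j (g * (1 - w\<^sup>2)) * (1 - w\<^sup>2) ^ 0"
  have c: "continuous_on {-1..1} ?F" by (rule Mint_integrable[OF g])
  obtain m where m: "m \<in> {-1..1}" "\<forall>w\<in>{-1..1}. ?F m \<le> ?F w"
    using continuous_attains_inf[OF compact_Icc _ c] by auto
  have p: "0 < ?F m" using lphi_pos[OF gset_arg(1)[OF g m(1)]] by simp
  have "integral {-1..1} (\<lambda>w::real. ?F m) \<le> integral {-1..1} ?F"
    by (rule integral_le) (use m c in \<open>auto intro!: integrable_continuous_real\<close>)
  then show ?thesis using p by (simp add: Mint_def)
qed

text \<open>The length in s of the trajectory with parameter g, that is, the side length to which g
  belongs.\<close>

definition cfun :: "real \<Rightarrow> real" where "cfun g = 2 * g * Mint 1 1 0 g"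

definition cder :: "real \<Rightarrow> real" where
  "cder g = 2 * Mint 1 1 0 g + 4 * g * Mint 2 2 1 g + 4 * g * Mint 2 3 1 g"

lemma cfun_derivative:
  assumes g: "g \<in> gset"
  shows "(cfun has_real_derivative cder g) (at g)"
proof -
  have "(Mint 1 1 0 has_real_derivative 2 * Mint 2 2 1 g + 2 * Mint 2 3 1 g) (at g)"
    using Mint_derivative[OF g, of 1 1 0] by (simp add: numeral_2_eq_2 numeral_3_eq_3)
  then have "((\<lambda>g. 2 * g * Mint 1 1 0 g) has_real_derivative 2 * g * (2 * Mint 2 2 1 g + 2 * Mint 2 3 1 g) + 2 * Mint 1 1 0 g) (at g)"
    by (intro DERIV_mult') (auto intro!: derivative_eq_intros)
  then show ?thesis by (simp add: cfun_def[abs_def] cder_def algebra_simps)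
qed

lemma cder_pos: "g \<in> gset \<Longrightarrow> 0 < cder g"
  unfolding cder_def using Mint_pos[of g 1 1] Mint_nonneg[of g 2 2 1] Mint_nonneg[of g 2 3 1]
  by (intro add_pos_nonneg) auto

lemma cfun_inj: "g \<in> gset \<Longrightarrow> g' \<in> gset \<Longrightarrow> cfun g = cfun g' \<Longrightarrow> g = g'"
proof -
  have less: "cfun a < cfun b" if "a \<in> gset" "b \<in> gset" "a < b" for a b
  proof (rule DERIV_pos_imp_increasing[OF that(3)])
    fix x assume "a \<le> x" "x \<le> b"
    then have "x \<in> gset" using that by auto
    then show "\<exists>y. (cfun has_real_derivative y) (at x) \<and> 0 < y" using cfun_derivative cder_pos by blast
  qed
  show "g \<in> gset \<Longrightarrow> g' \<in> gset \<Longrightarrow> cfun g = cfun g' \<Longrightarrow> g = g'"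
    using less[of g g'] less[of g' g] by (cases g g' rule: linorder_cases) auto
qed

definition gfun :: "real \<Rightarrow> real" where "gfun c = c * (hfun c 0)\<^sup>2 / 4"

text \<open>In the variables \<open>p = ln (h / h 0)\<close> and \<open>w = h' / h\<close> the energy identity reads
  \<open>lamb p = gfun c * (1 - w\<^sup>2)\<close>. The trajectory runs from \<open>w = 1\<close> to \<open>w = - 1\<close> and stays on the
  branch \<open>p < 1 / 2\<close>, so \<open>w\<close> can serve as the
  integration variable: \<open>ds = - 2 g lphi 1 1 (g (1 - w\<^sup>2)) dw\<close>.\<close>

lemma gfun_parametrization:
  assumes c: "0 < c"
  shows "gfun c \<in> gset" "cfun (gfun c) = c"
    "V_G TYPE(real) c = 2 * ln 2 - ln (Mint 1 1 0 (gfun c)) - Mint 1 0 0 (gfun c) / Mint 1 1 0 (gfun c)"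
proof -
  let ?S = "{0..c}"
  define g where "g = gfun c"
  define h h' where "h = hfun c" and "h' = hder c"
  have hp: "0 < h s" for s unfolding h_def by (rule hfun_pos[OF c])
  have sol: "positive_bvp_solution c h h'" unfolding h_def h'_def by (rule hfun_solution[OF c])
  have dh: "(h has_real_derivative h' s) (at s within ?S)"
    and dh': "(h' has_real_derivative - 2 / (c * h s) + h s) (at s within ?S)" if "s \<in> ?S" for s
    using sol that unfolding positive_bvp_solution_def by auto
  have bd: "h' 0 = h 0" "h 0 = h c" "h c = - h' c" using sol unfolding positive_bvp_solution_def by auto
  have g4: "4 * g = c * (h 0)\<^sup>2" by (simp add: g_def gfun_def h_def)
  have "0 < c * (h 0)\<^sup>2" using c hp[of 0] by simp
  then have g0: "0 < g" using g4 by linarith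
  define p w where "p s = ln (h s) - ln (h 0)" and "w s = h' s / h s" for s
  have dp: "(p has_real_derivative w s) (at s within ?S)" if s: "s \<in> ?S" for s
    unfolding p_def w_def using hp[of s] by (auto intro!: derivative_eq_intros dh[OF s])
  have eh: "exp (- 2 * p s) * (h s)\<^sup>2 = (h 0)\<^sup>2" for s
  proof -
    have "exp (- 2 * p s) = (exp (ln (h 0) - ln (h s)))\<^sup>2"
      unfolding p_def by (simp add: power2_eq_square flip: exp_add)
    also have "exp (ln (h 0) - ln (h s)) = h 0 / h s" using hp by (simp add: exp_diff)
    finally show ?thesis using hp[of s] by (simp add: power_divide)
  qed
  have chh: "2 / (c * (h s)\<^sup>2) = exp (- 2 * p s) / (2 * g)" for s
  proof -
    have "4 * g = c * (h s)\<^sup>2 * exp (- 2 * p s)" unfolding g4 eh[of s, symmetric] by simp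
    then show ?thesis using g0 c hp[of s] by (simp add: field_simps)
  qed
  have dw: "(w has_real_derivative 1 - (w s)\<^sup>2 - exp (- 2 * p s) / (2 * g)) (at s within ?S)" if s: "s \<in> ?S" for s
  proof -
    have "(w has_real_derivative 1 - (w s)\<^sup>2 - 2 / (c * (h s)\<^sup>2)) (at s within ?S)"
      unfolding w_def using hp[of s] c
      by (auto intro!: derivative_eq_intros dh[OF s] dh'[OF s] simp: field_simps power2_eq_square)
    then show ?thesis unfolding chh .
  qed
  have energy: "lamb (p s) = g * (1 - (w s)\<^sup>2)" if s: "s \<in> ?S" for s
  proof -
    \<comment> \<open>A first integral, found by multiplying the equation by h'. It vanishes because
      h' 0 = h 0 and p 0 = 0, and division by h^2 gives the relation between p and w.\<close>
    define Q where "Q s = (h' s)\<^sup>2 - (h s)\<^sup>2 + 4 / c * p s" for s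
    have dQ: "(Q has_real_derivative 0) (at s within ?S)" if s: "s \<in> ?S" for s
    proof -
      have "(Q has_real_derivative 2 * h' s * (- 2 / (c * h s) + h s) - 2 * h s * h' s + 4 / c * w s) (at s within ?S)"
        unfolding Q_def using c by (auto intro!: derivative_eq_intros dh[OF s] dh'[OF s] dp[OF s])
      also have "2 * h' s * (- 2 / (c * h s) + h s) - 2 * h s * h' s + 4 / c * w s = 0"
        using hp[of s] c by (simp add: w_def field_simps)
      finally show ?thesis .
    qed
    have "\<exists>k. \<forall>s\<in>?S. Q s = k" by (rule has_field_derivative_zero_constant[OF _ dQ]) auto
    then obtain k where k: "\<And>s. s \<in> ?S \<Longrightarrow> Q s = k" by blast
    have "Q s = Q 0" using k[OF s] k[of 0] c by simp
    also have "Q 0 = 0" by (simp add: Q_def bd(1) p_def)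
    finally have "(h' s)\<^sup>2 = (h s)\<^sup>2 - 4 / c * p s" by (simp add: Q_def)
    then have "(w s)\<^sup>2 = ((h s)\<^sup>2 - 4 / c * p s) / (h s)\<^sup>2" by (simp add: w_def power_divide)
    also have "\<dots> = 1 - p s * (2 * (2 / (c * (h s)\<^sup>2)))"
      using hp[of s] by (simp add: diff_divide_distrib)
    finally have "(w s)\<^sup>2 = 1 - p s * (2 * (2 / (c * (h s)\<^sup>2)))" .
    then show ?thesis unfolding chh lamb_def using g0 by simp
  qed
  have w1: "w 0 = 1" "w c = -1" using bd hp[of 0] hp[of c] by (simp_all add: w_def)
  \<comment> \<open>Both integrals in the splitting formula are nonnegative; up to positive weights,
    h is their sum and h' their difference.\<close>
  have wle: "\<bar>w s\<bar> \<le> 1" if s: "s \<in> ?S" for s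
  proof -
    have Fp: "0 \<le> 1 / hfun c r" for r using hfun_pos[OF c, of r] by simp
    have ci: "continuous_on T (\<lambda>r. 1 / hfun c r)" for T
      using hfun_pos[OF c] by (intro continuous_intros hfun_continuous[OF c]) (simp add: less_imp_neq[THEN not_sym])
    define P R where "P = integral {0..s} (\<lambda>r. exp r * (1 / hfun c r))" and "R = integral {s..c} (\<lambda>r. exp (- r) * (1 / hfun c r))"
    have PR: "0 \<le> P" "0 \<le> R" unfolding P_def R_def
      by (intro integral_nonneg integrable_continuous_real continuous_intros ci mult_nonneg_nonneg Fp exp_ge_zero)+
    have Fc: "(\<lambda>t. 1 / hfun c (c * t)) = schr c" using c by (simp add: hfun_def)
    have "h s = Kop c (schr c) (s / c)"
      using schr(3)[of c "s / c"] schr(2)[of c "s / c"] c by (simp add: h_def hfun_def field_simps)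
    also have "\<dots> = (exp (- s) * P + exp s * R) / c"
      using Kop_real[OF c ci s] unfolding Fc P_def R_def .
    finally have "h s = (exp (- s) * P + exp s * R) / c" .
    moreover have "h' s = (exp s * R - exp (- s) * P) / c" by (simp add: h'_def hder_def P_def R_def)
    ultimately have "\<bar>h' s\<bar> \<le> h s"
      using PR c mult_nonneg_nonneg[of "exp s" R] mult_nonneg_nonneg[of "exp (- s)" P]
      by (simp add: abs_le_iff divide_right_mono flip: minus_divide_left)
    then show ?thesis unfolding w_def using hp[of s] by (simp add: abs_divide pos_divide_le_eq)
  qed
  have cont: "continuous_on ?S p" "continuous_on ?S w"
    by (rule DERIV_continuous_on[OF dp] DERIV_continuous_on[OF dw]; assumption)+
  \<comment> \<open>At a zero of w the energy identity reads g = lamb (p z), so g is at most the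
    maximum of \<open>lamb\<close>.\<close>
  obtain z where z: "z \<in> ?S" "w z = 0"
    using IVT2'[of w c 0 0] cont(2) w1 c by auto
  then have gz: "g = lamb (p z)" using energy[OF z(1)] by simp
  have g_le: "g \<le> 1 / (2 * exp 1)" unfolding gz by (rule lamb_le_half)
  have p_nonneg: "0 \<le> p s" if s: "s \<in> ?S" for s
  proof -
    have "(w s)\<^sup>2 \<le> 1" using wle[OF s] by (simp add: abs_square_le_1)
    then have "0 \<le> lamb (p s)" unfolding energy[OF s] using g0 by simp
    then show ?thesis by (simp add: lamb_def zero_le_mult_iff)
  qed
  text \<open>Gronwall's argument: \<open>1 / 2 - p\<close> cannot reach \<open>0\<close>, because \<open>\<bar>w\<bar> \<le> 2 * (1 / 2 - p)\<close> as long as it is positive.\<close>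
  have p_half: "p s < 1 / 2" if s: "s \<in> ?S" for s
  proof (rule ccontr)
    assume "\<not> p s < 1 / 2"
    then obtain r0 where r0: "0 \<le> r0" "r0 \<le> s" "p r0 = 1 / 2"
      using IVT'[of p 0 "1 / 2" s] s continuous_on_subset[OF cont(1), of "{0..s}"] by (auto simp: p_def)
    \<comment> \<open>By compactness there is a first time at which p equals 1 / 2; before it p
      stays below 1 / 2, where the differential inequality applies.\<close>
    define Z where "Z = {r \<in> ?S. p r = 1 / 2}"
    have "compact Z"
    proof -
      have "closed Z" unfolding Z_def using continuous_closed_preimage_constant[OF cont(1), of "1 / 2"] by simp
      moreover have "bounded Z" by (rule bounded_subset[of ?S]) (auto simp: Z_def)
      ultimately show ?thesis by (simp add: compact_eq_bounded_closed)
    qed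
    moreover have "r0 \<in> Z" using r0 s by (auto simp: Z_def)
    ultimately obtain r where r: "r \<in> Z" "\<And>t. t \<in> Z \<Longrightarrow> r \<le> t"
      using compact_attains_inf[of Z] by blast
    have rS: "r \<in> ?S" "p r = 1 / 2" using r(1) by (auto simp: Z_def)
    have below: "p t < 1 / 2" if t: "0 \<le> t" "t < r" for t
    proof (rule ccontr)
      assume "\<not> p t < 1 / 2"
      then obtain q where "0 \<le> q" "q \<le> t" "p q = 1 / 2"
        using IVT'[of p 0 "1 / 2" t] t rS continuous_on_subset[OF cont(1), of "{0..t}"] by (auto simp: p_def)
      then have "q \<in> Z" using t rS by (auto simp: Z_def)
      then show False using r(2)[of q] t \<open>q \<le> t\<close> by simp
    qed
    let ?E = "\<lambda>t. (1 / 2 - p t) * exp (2 * t)"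
    have "?E 0 \<le> ?E r"
    proof (rule DERIV_nonneg_imp_increasing_open[of 0 r ?E])
      show "0 \<le> r" using rS by simp
      show "continuous_on {0..r} ?E"
        using rS by (intro continuous_intros continuous_on_subset[OF cont(1)]) auto
      fix t assume t: "0 < t" "t < r"
      then have tS: "t \<in> ?S" using rS by auto
      have dpt: "(p has_real_derivative w t) (at t)"
        using dp[OF tS] t rS by (simp add: at_within_Icc_at)
      define D where "D = 1 / 2 - p t"
      have D: "0 < D" "2 * D \<le> 1" using below[of t] t p_nonneg[OF tS] by (simp_all add: D_def)
      \<comment> \<open>As g is at most 1 / (2 e), the energy identity bounds w^2 by 1 - (1 - 2 D)
        exp (2 D), and exp (2 D) \<ge> 1 + 2 D leaves 4 D^2.\<close>
      have "(w t)\<^sup>2 \<le> (2 * D)\<^sup>2"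
      proof -
        have "(w t)\<^sup>2 = 1 - lamb (p t) / g" using energy[OF tS] g0 by (simp add: field_simps)
        also have "\<dots> \<le> 1 - lamb (p t) / (1 / (2 * exp 1))"
        proof -
          have "0 \<le> lamb (p t)" using p_nonneg[OF tS] by (simp add: lamb_def)
          then have "lamb (p t) / (1 / (2 * exp 1)) \<le> lamb (p t) / g"
            using g_le g0 by (intro divide_left_mono) auto
          then show ?thesis by simp
        qed
        also have "lamb (p t) / (1 / (2 * exp 1)) = (1 - 2 * D) * exp (2 * D)"
          by (simp add: lamb_def D_def mult.assoc flip: exp_add)
        also have "1 - (1 - 2 * D) * exp (2 * D) \<le> 1 - (1 - 2 * D) * (1 + 2 * D)"
          using D exp_ge_add_one_self[of "2 * D"] by (intro diff_left_mono mult_left_mono) auto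
        finally show ?thesis by (simp add: power2_eq_square algebra_simps)
      qed
      then have "\<bar>w t\<bar>\<^sup>2 \<le> (2 * D)\<^sup>2" by (simp only: power2_abs)
      then have "\<bar>w t\<bar> \<le> 2 * D" by (rule power2_le_imp_le) (use D in simp)
      then have "0 \<le> (- w t + 2 * D) * exp (2 * t)" by simp
      moreover have "(?E has_real_derivative (- w t + 2 * D) * exp (2 * t)) (at t)"
        by (auto intro!: derivative_eq_intros dpt simp: D_def algebra_simps)
      ultimately show "\<exists>y. (?E has_real_derivative y) (at t) \<and> 0 \<le> y" by blast
    qed
    moreover have "p 0 = 0" by (simp add: p_def)
    ultimately have "(1 / 2 - 0) * exp (2 * 0) \<le> (1 / 2 - 1 / 2) * exp (2 * r)" by (simp only: rS(2))
    then show False by simp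
  qed
  have "g < 1 / (2 * exp 1)"
    unfolding gz lamb_half[symmetric] by (rule lamb_less[OF p_half[OF z(1)]]) simp
  then have gg: "g \<in> gset" using g0 by simp
  then show "gfun c \<in> gset" by (simp add: g_def)
  have inv: "lambinv (g * (1 - (w s)\<^sup>2)) = p s" if s: "s \<in> ?S" for s
    using lambinv_lamb[OF p_half[OF s]] energy[OF s] by simp
  \<comment> \<open>The new variable is - w, so that the interval runs upwards from - 1 to 1;
    evenness of \<open>G\<close> undoes the sign.\<close>
  have subst: "((\<lambda>s. G (w s)) has_integral (integral {-1..1} (\<lambda>x. 2 * g * lphi 1 1 (g * (1 - x\<^sup>2)) * G x))) ?S"
    if G: "continuous_on {-1..1} G" and even: "\<And>x. G (- x) = G x" for G
  proof -
    let ?F = "\<lambda>x. 2 * g * lphi 1 1 (g * (1 - x\<^sup>2)) * G x"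
    let ?d = "\<lambda>s. - (1 - (w s)\<^sup>2 - exp (- 2 * p s) / (2 * g))"
    have Fc: "continuous_on {-1..1} ?F"
      using Mint_integrable[OF gg, of 1 1 0] by (intro continuous_intros G) simp
    have sub: "((\<lambda>s. ?d s *\<^sub>R ?F (- w s)) has_integral (integral {- w 0..- w c} ?F)) ?S"
    proof (rule has_integral_substitution[OF _ _ _ Fc])
      show "(\<lambda>s. - w s) ` ?S \<subseteq> {-1..1}" using wle by (fastforce simp: abs_le_iff)
      show "((\<lambda>s. - w s) has_real_derivative ?d s) (at s within ?S)" if "s \<in> ?S" for s
        by (rule DERIV_minus[OF dw[OF that]])
    qed (use c w1 in auto)
    have "?d s *\<^sub>R ?F (- w s) = G (w s)" if s: "s \<in> ?S" for s
    proof -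
      define q where "q = 1 - 2 * p s"
      have q: "0 < q" using p_half[OF s] by (simp add: q_def)
      have "1 - (w s)\<^sup>2 = p s * exp (- 2 * p s) / g" using energy[OF s] g0 by (simp add: lamb_def field_simps)
      then have "?d s = - (p s * exp (- 2 * p s) / g - exp (- 2 * p s) / (2 * g))" by (simp only:)
      also have "\<dots> = q * exp (- 2 * p s) / (2 * g)" using g0 by (simp add: q_def field_simps)
      finally have "?d s = q * exp (- 2 * p s) / (2 * g)" .
      moreover have "?F (- w s) = 2 * g * (exp (2 * p s) / q) * G (w s)"
        by (simp add: lphi_def inv[OF s] even q_def)
      moreover have "q * exp (- 2 * p s) / (2 * g) * (2 * g * (exp (2 * p s) / q) * G (w s)) = (exp (- 2 * p s) * exp (2 * p s)) * G (w s)"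
        using q g0 by (simp add: field_simps)
      ultimately show ?thesis by (simp flip: exp_add)
    qed
    from has_integral_eq[OF this sub] have "((\<lambda>s. G (w s)) has_integral (integral {- w 0..- w c} ?F)) ?S" .
    then show ?thesis unfolding w1 by simp
  qed
  have "((\<lambda>s. 1) has_integral (integral {-1..1} (\<lambda>x. 2 * g * lphi 1 1 (g * (1 - x\<^sup>2)) * 1))) ?S"
    by (rule subst) auto
  then have "integral ?S (\<lambda>s. 1) = integral {-1..1} (\<lambda>x. 2 * g * lphi 1 1 (g * (1 - x\<^sup>2)) * 1)" by (rule integral_unique)
  also have "\<dots> = cfun g" unfolding cfun_def Mint_def by (simp add: integral_mult_right)
  finally have cg: "cfun g = c" using c by simp
  then show "cfun (gfun c) = c" by (simp add: g_def)
  let ?M11 = "Mint 1 1 0 g" and ?M10 = "Mint 1 0 0 g"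
  have M11: "0 < ?M11" by (rule Mint_pos[OF gg])
  have lc: "continuous_on {-1..1} (\<lambda>x. lambinv (g * (1 - x\<^sup>2)))"
  proof (rule continuous_on_compose2[where g = lambinv and t = "{..<1 / (2 * exp 1)}"])
    show "continuous_on {..<1 / (2 * exp 1)} lambinv"
      by (intro continuous_at_imp_continuous_on ballI) (use DERIV_isCont[OF lambinv_derivative] in auto)
  qed (use gset_arg[OF gg] in \<open>auto intro!: continuous_intros\<close>)
  have "((\<lambda>s. lambinv (g * (1 - (w s)\<^sup>2))) has_integral
      (integral {-1..1} (\<lambda>x. 2 * g * lphi 1 1 (g * (1 - x\<^sup>2)) * lambinv (g * (1 - x\<^sup>2))))) ?S"
    by (rule subst[OF lc]) simp
  then have "(p has_integral (integral {-1..1} (\<lambda>x. 2 * g * lphi 1 1 (g * (1 - x\<^sup>2)) * lambinv (g * (1 - x\<^sup>2))))) ?S"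
    by (rule has_integral_eq[rotated]) (rule inv)
  then have "integral ?S p = integral {-1..1} (\<lambda>x. 2 * g * lphi 1 1 (g * (1 - x\<^sup>2)) * lambinv (g * (1 - x\<^sup>2)))"
    by (rule integral_unique)
  \<comment> \<open>For P = lambinv (g (1 - x^2)) one has 2 P / (1 - 2 P) = 1 / (1 - 2 P) -
    1.\<close>
  also have "\<dots> = integral {-1..1} (\<lambda>x. g * (lphi 1 1 (g * (1 - x\<^sup>2)) * (1 - x\<^sup>2) ^ 0) - g * (lphi 1 0 (g * (1 - x\<^sup>2)) * (1 - x\<^sup>2) ^ 0))"
  proof (rule Henstock_Kurzweil_Integration.integral_cong)
    fix x :: real assume "x \<in> {-1..1}"
    then have "lambinv (g * (1 - x\<^sup>2)) < 1 / 2" using lambinv gset_arg[OF gg] by blast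
    then show "2 * g * lphi 1 1 (g * (1 - x\<^sup>2)) * lambinv (g * (1 - x\<^sup>2)) =
       g * (lphi 1 1 (g * (1 - x\<^sup>2)) * (1 - x\<^sup>2) ^ 0) - g * (lphi 1 0 (g * (1 - x\<^sup>2)) * (1 - x\<^sup>2) ^ 0)"
      by (simp add: lphi_def field_simps)
  qed
  also have "\<dots> = g * ?M11 - g * ?M10"
  proof -
    have i: "(\<lambda>x. g * (lphi i j (g * (1 - x\<^sup>2)) * (1 - x\<^sup>2) ^ k)) integrable_on {-1..1}" for i j k
      by (rule integrable_on_mult_right[OF integrable_continuous_real[OF Mint_integrable[OF gg]]])
    show ?thesis unfolding Mint_def Henstock_Kurzweil_Integration.integral_diff[OF i i] integral_mult_right ..
  qed
  finally have ip: "integral ?S p = g * ?M11 - g * ?M10" .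
  have "integral ?S (\<lambda>s. ln (h s)) = integral ?S (\<lambda>s. ln (h 0) + p s)" by (simp add: p_def)
  also have "\<dots> = c * ln (h 0) + integral ?S p"
    using c by (subst Henstock_Kurzweil_Integration.integral_add) (auto intro!: integrable_continuous_real cont)
  finally have ih: "integral ?S (\<lambda>s. ln (h s)) = c * ln (h 0) + (g * ?M11 - g * ?M10)" by (simp add: ip)
  have cM: "c = 2 * g * ?M11" using cg by (simp add: cfun_def)
  have "(h 0)\<^sup>2 = 2 / ?M11" using g4 cM c g0 M11 by (simp add: field_simps)
  then have "ln ((h 0)\<^sup>2) = ln 2 - ln ?M11" using M11 by (simp add: ln_div)
  moreover have "ln ((h 0)\<^sup>2) = 2 * ln (h 0)" using hp[of 0] by (simp add: ln_realpow)
  ultimately have lh: "2 * ln (h 0) = ln 2 - ln ?M11" by simp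
  have "dual_value TYPE(real) c = 1 + 2 * ln (h 0) + 2 / c * (g * ?M11 - g * ?M10)"
    unfolding dual_value_hfun[OF c] h_def[symmetric] ih using c by (simp add: distrib_left)
  also have "2 / c * (g * ?M11 - g * ?M10) = 1 - ?M10 / ?M11"
    using g0 M11 unfolding cM by (simp add: field_simps)
  finally have "V_G TYPE(real) c = 2 * ln 2 - ln ?M11 - ?M10 / ?M11"
    using V_G_eq[OF c, where 'a=real] lh by simp
  then show "V_G TYPE(real) c = 2 * ln 2 - ln (Mint 1 1 0 (gfun c)) - Mint 1 0 0 (gfun c) / Mint 1 1 0 (gfun c)"
    by (simp add: g_def)
qed

text \<open>A solution exists for every c, which makes \<open>gfun\<close> a right inverse of
  \<open>cfun\<close>; injectivity of \<open>cfun\<close> makes it a left inverse, and positivity of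
  \<open>cder\<close> allows the inverse function rule.\<close>

lemma gfun_derivative:
  assumes c: "0 < c"
  shows "(gfun has_real_derivative inverse (cder (gfun c))) (at c)"
proof (rule has_real_derivative_inverse[of cfun _ gfun c gset])
  show "(cfun has_real_derivative cder (gfun c)) (at (gfun c))"
    by (rule cfun_derivative[OF gfun_parametrization(1)[OF c]])
  show "cder (gfun c) \<noteq> 0" using cder_pos[OF gfun_parametrization(1)[OF c]] by simp
  show "continuous_on gset cfun"
    by (intro continuous_at_imp_continuous_on ballI DERIV_isCont[OF cfun_derivative])
  show "gfun (cfun z) = z" if z: "z \<in> gset" for z
  proof -
    have "0 < cfun z" using z Mint_pos[OF z, of 1 1] by (simp add: cfun_def)
    then show ?thesis using cfun_inj[OF gfun_parametrization(1) z] gfun_parametrization(2) by blast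
  qed
qed (use gfun_parametrization[OF c] in auto)

text \<open>Induction on the order of the derivative meets only members of P. The iterated
  derivative agrees with them on U alone, which is enough because U is open and derivatives are
  local.\<close>

lemma smooth_on_closed_family:
  assumes U: "open U"
    and D: "\<And>f. P f \<Longrightarrow> \<exists>g. P g \<and> (\<forall>x\<in>U. (f has_real_derivative g x) (at x))"
    and f: "P f"
  shows "smooth_on U f"
proof -
  have eq: "\<exists>g. P g \<and> (\<forall>x\<in>U. (deriv ^^ k) f x = g x)" for k
  proof (induction k)
    case 0
    then show ?case using f by auto
  next
    case (Suc k)
    then obtain g where g: "P g" "\<forall>x\<in>U. (deriv ^^ k) f x = g x" by blast
    obtain g' where g': "P g'" "\<forall>x\<in>U. (g has_real_derivative g' x) (at x)" using D[OF g(1)] by blast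
    have "(deriv ^^ Suc k) f x = g' x" if x: "x \<in> U" for x
    proof -
      have "((deriv ^^ k) f has_real_derivative g' x) (at x)"
        by (rule has_field_derivative_transform_within_open[OF _ U x]) (use g g' x in auto)
      then show ?thesis by (simp add: DERIV_imp_deriv)
    qed
    then show ?case using g'(1) by blast
  qed
  have "(deriv ^^ k) f differentiable_on U" for k
  proof -
    obtain g where g: "P g" "\<forall>x\<in>U. (deriv ^^ k) f x = g x" using eq by blast
    obtain g' where g': "\<forall>x\<in>U. (g has_real_derivative g' x) (at x)" using D[OF g(1)] by blast
    have "((deriv ^^ k) f has_real_derivative g' x) (at x)" if x: "x \<in> U" for x
      by (rule has_field_derivative_transform_within_open[OF _ U x]) (use g g' x in auto)
    then show ?thesis
      by (meson differentiable_at_withinI differentiable_on_def real_differentiable_def)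
  qed
  then show ?thesis using U by (simp add: smooth_on_def)
qed

text \<open>The generators are chosen such that the family is closed under differentiation on \<open>{0<..}\<close>.\<close>

inductive gfamily :: "(real \<Rightarrow> real) \<Rightarrow> bool" where
  const: "gfamily (\<lambda>_. a)"
| gfun: "gfamily gfun"
| Mint: "gfamily (\<lambda>c. Mint i j k (gfun c))"
| cder: "gfamily (\<lambda>c. inverse (cder (gfun c)))"
| M11: "gfamily (\<lambda>c. inverse (Mint 1 1 0 (gfun c)))"
| V: "gfamily (V_G TYPE(real))"
| add: "gfamily f \<Longrightarrow> gfamily g \<Longrightarrow> gfamily (\<lambda>c. f c + g c)"
| mult: "gfamily f \<Longrightarrow> gfamily g \<Longrightarrow> gfamily (\<lambda>c. f c * g c)"

lemma gfamily_derivative: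
  assumes "gfamily f"
  shows "\<exists>f'. gfamily f' \<and> (\<forall>c\<in>{0<..}. (f has_real_derivative f' c) (at c))"
  using assms
proof induction
  let ?r = "\<lambda>c. inverse (cder (gfun c))" and ?m = "\<lambda>c. inverse (Mint 1 1 0 (gfun c))"
  define MD where "MD i j k c = (2 * real i * Mint (i + 1) (j + 1) (k + 1) (gfun c) +
      2 * real j * Mint (i + 1) (j + 2) (k + 1) (gfun c)) * ?r c" for i j k c
  have MDf: "gfamily (MD i j k)" for i j k
    unfolding MD_def by (intro gfamily.intros)
  have MD: "((\<lambda>c. Mint i j k (gfun c)) has_real_derivative MD i j k c) (at c)" if "0 < c" for i j k c
    unfolding MD_def by (rule DERIV_chain2[OF Mint_derivative[OF gfun_parametrization(1)[OF that]] gfun_derivative[OF that]])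
  have M11: "Mint 1 1 0 (gfun c) \<noteq> 0" if "0 < c" for c using Mint_pos[OF gfun_parametrization(1)[OF that], of 1 1] by simp
  {
    case (const a)
    show ?case by (intro exI[of _ "\<lambda>_. 0"] conjI gfamily.const) auto
  next
    case gfun
    show ?case using gfun_derivative by (intro exI[of _ ?r] conjI gfamily.cder) auto
  next
    case (Mint i j k)
    show ?case using MD MDf by (intro exI[of _ "MD i j k"]) auto
  next
    case cder
    define E where "E c = 2 * MD 1 1 0 c + (4 * ?r c * Mint 2 2 1 (gfun c) + 4 * gfun c * MD 2 2 1 c) +
       (4 * ?r c * Mint 2 3 1 (gfun c) + 4 * gfun c * MD 2 3 1 c)" for c
    have E: "gfamily E" unfolding E_def by (intro gfamily.intros MDf)
    have dE: "((\<lambda>c. cder (gfun c)) has_real_derivative E c) (at c)" if "0 < c" for c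
      unfolding cder_def E_def using that
      by (auto intro!: derivative_eq_intros MD gfun_derivative simp: cder_def)
    have "(?r has_real_derivative (- 1) * (?r c * (E c * ?r c))) (at c)" if "0 < c" for c
      using DERIV_inverse_fun[OF dE[OF that]] cder_pos[OF gfun_parametrization(1)[OF that]] by (simp add: mult_ac)
    moreover have "gfamily (\<lambda>c. (- 1) * (?r c * (E c * ?r c)))" by (intro gfamily.intros E)
    ultimately show ?case by auto
  next
    case M11
    have "(?m has_real_derivative (- 1) * (?m c * (MD 1 1 0 c * ?m c))) (at c)" if "0 < c" for c
      using DERIV_inverse_fun[OF MD[OF that] \<open>\<And>c. 0 < c \<Longrightarrow> Mint 1 1 0 (gfun c) \<noteq> 0\<close>[OF that]] by (simp add: mult_ac)
    moreover have "gfamily (\<lambda>c. (- 1) * (?m c * (MD 1 1 0 c * ?m c)))" by (intro gfamily.intros MDf)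
    ultimately show ?case by auto
  next
    case V
    \<comment> \<open>The logarithm is no generator; \<open>V_G\<close> stands in for it, and the
      derivative of this closed form is again built from generators. The closed form holds for
      positive arguments only, so the derivative is transferred locally.\<close>
    let ?W = "\<lambda>c. 2 * ln 2 - ln (Mint 1 1 0 (gfun c)) - Mint 1 0 0 (gfun c) * ?m c"
    let ?d = "\<lambda>c. (- 1) * (MD 1 1 0 c * ?m c) + ((- 1) * (MD 1 0 0 c * ?m c) + Mint 1 0 0 (gfun c) * (?m c * (MD 1 1 0 c * ?m c)))"
    have "(V_G TYPE(real) has_real_derivative ?d c) (at c)" if c: "0 < c" for c
    proof (rule has_field_derivative_transform_within_open[of ?W _ _ "{0<..}"])
      have m: "(?m has_real_derivative (- 1) * (?m c * (MD 1 1 0 c * ?m c))) (at c)"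
        using DERIV_inverse_fun[OF MD[OF c] M11[OF c]] by (simp add: mult_ac)
      have l: "((\<lambda>c. ln (Mint 1 1 0 (gfun c))) has_real_derivative ?m c * MD 1 1 0 c) (at c)"
        using DERIV_chain2[OF DERIV_ln MD[OF c, of 1 1 0]] Mint_pos[OF gfun_parametrization(1)[OF c], of 1 1] by simp
      show "(?W has_real_derivative ?d c) (at c)"
        by (rule DERIV_cong[OF DERIV_diff[OF DERIV_diff[OF DERIV_const l] DERIV_mult'[OF MD[OF c] m]]])
           (simp add: mult_ac)
      show "?W x = V_G TYPE(real) x" if "x \<in> {0<..}" for x
        using gfun_parametrization(3)[of x] that by (simp add: divide_inverse)
    qed (use c in auto)
    moreover have "gfamily ?d" by (intro gfamily.intros MDf)
    ultimately show ?case by auto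
  next
    case (add f g)
    then obtain f' g' where "gfamily f'" "\<forall>c\<in>{0<..}. (f has_real_derivative f' c) (at c)"
      "gfamily g'" "\<forall>c\<in>{0<..}. (g has_real_derivative g' c) (at c)" by blast
    then show ?case by (intro exI[of _ "\<lambda>c. f' c + g' c"]) (auto intro!: gfamily.add DERIV_add)
  next
    case (mult f g)
    then obtain f' g' where "gfamily f'" "\<forall>c\<in>{0<..}. (f has_real_derivative f' c) (at c)"
      "gfamily g'" "\<forall>c\<in>{0<..}. (g has_real_derivative g' c) (at c)" by blast
    then show ?case using mult.hyps
      by (intro exI[of _ "\<lambda>c. f c * g' c + f' c * g c"]) (auto intro!: gfamily.add gfamily.mult DERIV_mult')
  }
qed

lemma V_G_real_smooth: "smooth_on {0<..} (V_G TYPE(real))"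
  by (rule smooth_on_closed_family[of _ gfamily, OF _ gfamily_derivative gfamily.V]) auto

theorem proposition1p17:
  shows
    "(\<forall>c>0. \<bar>V_G_ereal TYPE('a::euclidean_space) c\<bar> \<noteq> \<infinity> \<and>
        (\<exists>f1 f2 :: 'a \<Rightarrow> real. continuous_on UNIV f1 \<and> continuous_on UNIV f2 \<and>
           objective c f1 f2 = V_G_ereal TYPE('a) c)) \<and>
     continuous_on {0<..} (V_G TYPE('a)) \<and>
     strict_antimono_on {0<..} (V_G TYPE('a)) \<and>
     convex_on {0<..} (V_G TYPE('a)) \<and>
     (V_G TYPE('a) \<longlongrightarrow> ln 2 - 1) (at_right 0) \<and>
     (\<lambda>c. V_G TYPE('a) c - (- real DIM('a) * ln c)) \<in> O[at_top](\<lambda>_. 1) \<and>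
     smooth_on {0<..} (V_G TYPE(real)) \<and>
     (\<lambda>c. V_G TYPE(real) c - (ln 2 - 1 - c / 3)) \<in> O[at_right 0](\<lambda>c. c\<^sup>2) \<and>
     (\<forall>c>0. \<exists>h h'. positive_bvp_solution c h h' \<and> real_analytic_on {0..c} h \<and>
        (\<forall>y y'. positive_bvp_solution c y y' \<longrightarrow> (\<forall>s\<in>{0..c}. y s = h s)) \<and>
        V_G TYPE(real) c = ln 2 - (h 0)\<^sup>2 +
          integral {0..c} (\<lambda>s. 2 / c * ln (h s) - 1 / 2 * (h s + h' s)\<^sup>2))"
proof (intro conjI allI impI)
  fix c :: real assume c: "0 < c"
  show "\<bar>V_G_ereal TYPE('a) c\<bar> \<noteq> \<infinity>" by (simp add: V_G_ereal_eq[OF c])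
  show "\<exists>f1 f2 :: 'a \<Rightarrow> real. continuous_on UNIV f1 \<and> continuous_on UNIV f2 \<and> objective c f1 f2 = V_G_ereal TYPE('a) c"
    unfolding V_G_ereal_eq[OF c] using objective_attained[OF c, where 'a='a] by metis
  show "\<exists>h h'. positive_bvp_solution c h h' \<and> real_analytic_on {0..c} h \<and>
      (\<forall>y y'. positive_bvp_solution c y y' \<longrightarrow> (\<forall>s\<in>{0..c}. y s = h s)) \<and>
      V_G TYPE(real) c = ln 2 - (h 0)\<^sup>2 + integral {0..c} (\<lambda>s. 2 / c * ln (h s) - 1 / 2 * (h s + h' s)\<^sup>2)"
    using hfun_solution[OF c] positive_bvp_analytic[OF c hfun_solution[OF c]] positive_bvp_unique[OF c]
      V_G_real_formula[OF c]
    by (intro exI[of _ "hfun c"] exI[of _ "hder c"]) blast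
qed (rule V_G_continuous V_G_strict_antimono V_G_convex V_G_limit_zero V_G_at_top V_G_real_smooth V_G_real_expansion)+

end
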